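(* Let $d\geq3$ and let $P\subset\mathbb R^d$ be a full-dimensional polytope. If $P$ is equiprojective, then the set of edge-2-faces of $P$ can be partitioned into pairs of edge-2-faces that compensate each other.
   Context: For a $2$-face $F$ of $P$, $\mathrm{Span}[F]$ denotes the unique $2$-dimensional linear subspace parallel to $F$; two $2$-faces are parallel if they have the same $\mathrm{Span}[\cdot]$; a class of 2-faces is an equivalence class for parallelism. For a $2$-dimensional linear subspace $W$, $\pi_W$ is the orthogonal projection onto $W$. A $2$-face $F$ is degenerating for $W$ if $\pi_W(F)$ is contained in a line (equivalently $W^\perp\cap \mathrm{Span}[F]\neq\{0\}$); a class is degenerating for $W$ if one (equivalently every) representative is. $W$ is admissible if no class of 2-faces of $P$ is degenerating for $W$. $P$ is $k$-equiprojective if $\pi_W(P)$ is a $k$-gon for every admissible plane $W$, and equiprojective if it is $k$-equiprojective for some $k$. Two parallel 2-faces $F\neq F'$ are simultaneously visible if there is a $2$-dimensional subspace $W$ such that the class of $F$ is the only class of 2-faces degenerating for $W$ and both $\pi_W(F)$ and $\pi_W(F')$ lie in the boundary of $\pi_W(P)$; the pair $(F,\varnothing)$ is also called simultaneously visible if there is such a $W$ for which $\pi_W(F)$ lies in the boundary of $\pi_W(P)$ and no other 2-face parallel to $F$ does. An edge-2-faces is a triple $(e,F,F')$ where $F,F'$ are simultaneously visible ($F'$ possibly $\varnothing$) and $e$ is an edge of $F$. Each edge-2-faces carries an orientation of $e$: if $F'\neq\varnothing$, let $A$ be the smallest affine subspace containing $F\cup F'$; then $Q=P\cap A$ is a $3$-polytope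 having $F$ and $F'$ as facets, and (fixing an orientation of the direction space of $A$) the boundary cycle of each of $F$ and $F'$ is oriented counterclockwise as seen from outside $Q$ (i.e. for an edge traversed along $u$, a vector $w\in\mathrm{Span}[G]$ pointing from the edge into the facet $G$, and the outward normal $n_G$ of $G$ in $Q$, $(u,w,n_G)$ is positively oriented); every edge-2-faces $(e,F,F')$ or $(e,F',F)$ gets the orientation of $e$ thus defined. If $F'=\varnothing$, one fixes arbitrarily one of the two cyclic orientations of the boundary of $F$ and orients its edges accordingly. Two distinct edge-2-faces $(e,F,F')$ and $(\tilde e,\tilde F,\tilde F')$ compensate each other if $e$ and $\tilde e$ are parallel with opposite orientations and either ($F=\tilde F'$ and $F'=\tilde F$) or ($F=\tilde F$ and $F'=\tilde F'$, possibly empty). *)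

theory Defs
  imports "HOL-Analysis.Analysis"
begin

section \<open>Planes and orthogonal projections\<close>

definition plane :: "'a::euclidean_space set \<Rightarrow> bool" where
  "plane W \<longleftrightarrow> subspace W \<and> dim W = 2"

definition orth_proj :: "'a::euclidean_space set \<Rightarrow> 'a \<Rightarrow> 'a" where
  "orth_proj W x = (THE y. y \<in> W \<and> x - y \<in> W\<^sup>\<bottom>)"

lemma orth_proj_eqI:
  assumes "subspace W" "y \<in> W" "x - y \<in> W\<^sup>\<bottom>"
  shows "orth_proj W x = y"
  unfolding orth_proj_def
proof (rule the_equality)
  show "y \<in> W \<and> x - y \<in> W\<^sup>\<bottom>" using assms by simp
next
  fix z assume z: "z \<in> W \<and> x - z \<in> W\<^sup>\<bottom>"
  have "z - y \<in> W" using z assms by (simp add: subspace_diff)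
  moreover have "z - y \<in> W\<^sup>\<bottom>"
    using subspace_diff[OF subspace_orthogonal_comp assms(3) conjunct2[OF z]] by simp
  ultimately have "(z - y) \<bullet> (z - y) = 0"
    by (simp add: orthogonal_comp_def orthogonal_def)
  then show "z = y" by simp
qed

lemma orth_proj:
  assumes "subspace W"
  shows "orth_proj W x \<in> W" "x - orth_proj W x \<in> W\<^sup>\<bottom>"
proof -
  obtain y z where "y \<in> span W" "\<And>w. w \<in> span W \<Longrightarrow> orthogonal z w" "x = y + z"
    using orthogonal_subspace_decomp_exists[of W x] by metis
  moreover have "span W = W" using assms by (simp add: span_eq_iff)
  ultimately have "y \<in> W" "x - y \<in> W\<^sup>\<bottom>"
    by (auto simp: orthogonal_comp_def orthogonal_commute)
  then show "orth_proj W x \<in> W" "x - orth_proj W x \<in> W\<^sup>\<bottom>"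
    using orth_proj_eqI[OF assms] by auto
qed

lemma linear_orth_proj:
  assumes "subspace W"
  shows "linear (orth_proj W)"
proof (rule linearI)
  fix x y
  have "x + y - (orth_proj W x + orth_proj W y) = (x - orth_proj W x) + (y - orth_proj W y)"
    by simp
  then show "orth_proj W (x + y) = orth_proj W x + orth_proj W y"
    using orth_proj[OF assms] assms
    by (intro orth_proj_eqI) (simp_all only: subspace_add subspace_orthogonal_comp)
next
  fix c x
  have "c *\<^sub>R x - c *\<^sub>R orth_proj W x = c *\<^sub>R (x - orth_proj W x)"
    by (simp add: scaleR_diff_right)
  then show "orth_proj W (c *\<^sub>R x) = c *\<^sub>R orth_proj W x"
    using orth_proj[OF assms] assms
    by (intro orth_proj_eqI) (simp_all only: subspace_scale subspace_orthogonal_comp)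
qed

lemma orth_proj_eq_0_iff:
  assumes "subspace W"
  shows "orth_proj W x = 0 \<longleftrightarrow> x \<in> W\<^sup>\<bottom>"
  using orth_proj(2)[OF assms, of x] orth_proj_eqI[OF assms subspace_0[OF assms], of x] by auto


section \<open>Two-dimensional faces and their parallelism classes\<close>

definition two_faces :: "'a::euclidean_space set \<Rightarrow> 'a set set" where
  "two_faces P = {F. F face_of P \<and> aff_dim F = 2}"

definition direction_space :: "'a::euclidean_space set \<Rightarrow> 'a set" where
  "direction_space S = span {x - y | x y. x \<in> S \<and> y \<in> S}"

definition parallel_rel :: "'a::euclidean_space set \<Rightarrow> ('a set \<times> 'a set) set" where
  "parallel_rel P =
     {(F, G). F \<in> two_faces P \<and> G \<in> two_faces P \<and> direction_space F = direction_space G}"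

lemma equiv_parallel_rel: "equiv (two_faces P) (parallel_rel P)"
  by (auto simp: equiv_def refl_on_def sym_def trans_def parallel_rel_def)

definition face_classes :: "'a::euclidean_space set \<Rightarrow> 'a set set set" where
  "face_classes P = two_faces P // parallel_rel P"

definition face_class :: "'a::euclidean_space set \<Rightarrow> 'a set \<Rightarrow> 'a set set" where
  "face_class P F = parallel_rel P `` {F}"

definition degenerating :: "'a::euclidean_space set \<Rightarrow> 'a set \<Rightarrow> bool" where
  "degenerating W F \<longleftrightarrow> collinear (orth_proj W ` F)"

definition class_degenerating :: "'a::euclidean_space set \<Rightarrow> 'a set set \<Rightarrow> bool" where
  "class_degenerating W C \<longleftrightarrow> (\<exists>F\<in>C. degenerating W F)"

lemma degenerating_iff_direction_space:
  assumes "subspace W"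
  shows "degenerating W F \<longleftrightarrow> (\<exists>u. \<forall>v\<in>direction_space F. \<exists>c. orth_proj W v = c *\<^sub>R u)"
proof
  assume "degenerating W F"
  then obtain u where u: "\<And>x y. x \<in> F \<Longrightarrow> y \<in> F \<Longrightarrow> \<exists>c. orth_proj W x - orth_proj W y = c *\<^sub>R u"
    unfolding degenerating_def collinear_def by blast
  have "orth_proj W v \<in> span {u}" if "v \<in> direction_space F" for v
  proof -
    have "orth_proj W ` direction_space F =
          span (orth_proj W ` {x - y | x y. x \<in> F \<and> y \<in> F})"
      unfolding direction_space_def by (rule linear_span_image[symmetric, OF linear_orth_proj[OF assms]])
    moreover have "orth_proj W ` {x - y | x y. x \<in> F \<and> y \<in> F} \<subseteq> span {u}"
    proof
      fix z assume "z \<in> orth_proj W ` {x - y | x y. x \<in> F \<and> y \<in> F}"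
      then obtain x y where "x \<in> F" "y \<in> F" and "z = orth_proj W (x - y)" by blast
      then obtain c where "z = c *\<^sub>R u"
        using u[of x y] linear_diff[OF linear_orth_proj[OF assms], of x y] by auto
      then show "z \<in> span {u}" by (simp add: span_base span_scale)
    qed
    ultimately show ?thesis
      using that span_minimal[OF _ subspace_span] by blast
  qed
  then show "\<exists>u. \<forall>v\<in>direction_space F. \<exists>c. orth_proj W v = c *\<^sub>R u"
    unfolding span_singleton by (intro exI[of _ u]) blast
next
  assume "\<exists>u. \<forall>v\<in>direction_space F. \<exists>c. orth_proj W v = c *\<^sub>R u"
  then obtain u where u: "\<And>v. v \<in> direction_space F \<Longrightarrow> \<exists>c. orth_proj W v = c *\<^sub>R u" by blast
  have "\<exists>c. orth_proj W x - orth_proj W y = c *\<^sub>R u" if "x \<in> F" "y \<in> F" for x y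
  proof -
    have "x - y \<in> direction_space F"
      unfolding direction_space_def using that by (intro span_base) blast
    then show ?thesis
      using u[of "x - y"] linear_diff[OF linear_orth_proj[OF assms], of x y] by simp
  qed
  then show "degenerating W F"
    unfolding degenerating_def collinear_def by blast
qed

lemma class_degenerating_face_class:
  assumes "subspace W" "F \<in> two_faces P"
  shows "class_degenerating W (face_class P F) \<longleftrightarrow> degenerating W F"
proof -
  have "degenerating W G \<longleftrightarrow> degenerating W F" if "direction_space F = direction_space G" for G
    by (simp only: degenerating_iff_direction_space[OF assms(1)] that)
  then show ?thesis
    using assms(2) unfolding class_degenerating_def face_class_def parallel_rel_def by blast
qed


section \<open>Equiprojectivity\<close>

definition admissible :: "'a::euclidean_space set \<Rightarrow> 'a set \<Rightarrow> bool" where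
  "admissible P W \<longleftrightarrow> plane W \<and> (\<forall>C \<in> face_classes P. \<not> class_degenerating W C)"

definition k_gon :: "nat \<Rightarrow> 'a::euclidean_space set \<Rightarrow> bool" where
  "k_gon k S \<longleftrightarrow> polytope S \<and> aff_dim S = 2 \<and> card {v. v extreme_point_of S} = k"

definition k_equiprojective :: "nat \<Rightarrow> 'a::euclidean_space set \<Rightarrow> bool" where
  "k_equiprojective k P \<longleftrightarrow> (\<forall>W. admissible P W \<longrightarrow> k_gon k (orth_proj W ` P))"

definition equiprojective :: "'a::euclidean_space set \<Rightarrow> bool" where
  "equiprojective P \<longleftrightarrow> (\<exists>k. k_equiprojective k P)"


section \<open>Simultaneous visibility and edge-2-faces\<close>

definition only_degenerating_class :: "'a::euclidean_space set \<Rightarrow> 'a set \<Rightarrow> 'a set \<Rightarrow> bool" where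
  "only_degenerating_class P F W \<longleftrightarrow>
     plane W \<and> (\<forall>C \<in> face_classes P. class_degenerating W C \<longleftrightarrow> C = face_class P F)"

text \<open>The boundary of the projected polytope is its boundary within the plane \<open>W\<close>, hence
  \<^const>\<open>rel_frontier\<close>; its \<^const>\<open>frontier\<close> in the ambient space would be the whole projection.\<close>

definition visible :: "'a::euclidean_space set \<Rightarrow> 'a set \<Rightarrow> 'a set \<Rightarrow> bool" where
  "visible P W F \<longleftrightarrow> orth_proj W ` F \<subseteq> rel_frontier (orth_proj W ` P)"

text \<open>A missing second face is represented by \<open>{}\<close>, which is never a 2-face.\<close>

definition simultaneously_visible :: "'a::euclidean_space set \<Rightarrow> 'a set \<Rightarrow> 'a set \<Rightarrow> bool" where
  "simultaneously_visible P F F' \<longleftrightarrow>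
     ((F, F') \<in> parallel_rel P \<and> F \<noteq> F' \<and>
        (\<exists>W. only_degenerating_class P F W \<and> visible P W F \<and> visible P W F')) \<or>
     (F \<in> two_faces P \<and> F' = {} \<and>
        (\<exists>W. only_degenerating_class P F W \<and> visible P W F \<and>
             (\<forall>G. (F, G) \<in> parallel_rel P \<and> G \<noteq> F \<longrightarrow> \<not> visible P W G)))"

definition edge_two_faces :: "'a::euclidean_space set \<Rightarrow> ('a set \<times> 'a set \<times> 'a set) set" where
  "edge_two_faces P = {(e, F, F'). simultaneously_visible P F F' \<and> e edge_of F}"


section \<open>Orientations of edges\<close>

text \<open>An orientation of an edge is the ordered pair of its end points (tail, head).\<close>

definition orients :: "'a \<times> 'a \<Rightarrow> 'a::euclidean_space set \<Rightarrow> bool" where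
  "orients p e \<longleftrightarrow> fst p \<noteq> snd p \<and> e = closed_segment (fst p) (snd p)"

text \<open>An orientation of a 3-dimensional space \<open>V\<close> is represented by an ordered basis of \<open>V\<close>; a
  triple of vectors is positively oriented if its coordinate matrix has positive determinant.\<close>

definition ordered_basis :: "(3 \<Rightarrow> 'a::euclidean_space) \<Rightarrow> 'a set \<Rightarrow> bool" where
  "ordered_basis b V \<longleftrightarrow> inj b \<and> independent (range b) \<and> span (range b) = V"

definition pos_oriented :: "(3 \<Rightarrow> 'a::euclidean_space) \<Rightarrow> 'a \<Rightarrow> 'a \<Rightarrow> 'a \<Rightarrow> bool" where
  "pos_oriented b u w n \<longleftrightarrow>
     (\<exists>M::real^3^3. det M > 0 \<and>
        u = (\<Sum>j\<in>UNIV. M $ 1 $ j *\<^sub>R b j) \<and>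
        w = (\<Sum>j\<in>UNIV. M $ 2 $ j *\<^sub>R b j) \<and>
        n = (\<Sum>j\<in>UNIV. M $ 3 $ j *\<^sub>R b j))"

definition points_into :: "'a::euclidean_space set \<Rightarrow> 'a set \<Rightarrow> 'a \<Rightarrow> bool" where
  "points_into e G w \<longleftrightarrow> (\<exists>x\<in>e. \<exists>y\<in>G - e. w = y - x)"

definition outward_normal :: "'a::euclidean_space set \<Rightarrow> 'a set \<Rightarrow> 'a \<Rightarrow> bool" where
  "outward_normal Q G n \<longleftrightarrow>
     n \<in> direction_space Q \<and> n \<noteq> 0 \<and> (\<forall>g\<in>G. \<forall>x\<in>Q. n \<bullet> x \<le> n \<bullet> g)"

text \<open>\<open>t\<close> orients all edges of the facet \<open>G\<close> of the 3-polytope \<open>Q\<close> counterclockwise as seen from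
  outside \<open>Q\<close>, with respect to the orientation \<open>b\<close> of the direction space of \<open>Q\<close>.\<close>

definition counterclockwise ::
  "(3 \<Rightarrow> 'a::euclidean_space) \<Rightarrow> 'a set \<Rightarrow> 'a set \<Rightarrow> ('a set \<Rightarrow> 'a \<times> 'a) \<Rightarrow> bool" where
  "counterclockwise b Q G t \<longleftrightarrow>
     (\<forall>e. e edge_of G \<longrightarrow> orients (t e) e \<and>
        (\<forall>w n. points_into e G w \<and> outward_normal Q G n \<longrightarrow>
               pos_oriented b (snd (t e) - fst (t e)) w n))"

text \<open>\<open>t\<close> is one of the two orientations of the boundary of the polygon \<open>F\<close> as a directed cycle.\<close>

definition cyclic_orientation :: "'a::euclidean_space set \<Rightarrow> ('a set \<Rightarrow> 'a \<times> 'a) \<Rightarrow> bool" where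
  "cyclic_orientation F t \<longleftrightarrow>
     (\<forall>e. e edge_of F \<longrightarrow> orients (t e) e) \<and>
     (\<forall>v. v extreme_point_of F \<longrightarrow>
        (\<exists>!e. e edge_of F \<and> fst (t e) = v) \<and> (\<exists>!e. e edge_of F \<and> snd (t e) = v))"

text \<open>The arbitrary choices involved (an orientation of the space spanned by each simultaneously
  visible pair \<open>F\<close>, \<open>F'\<close>, shared by the two ordered pairs, and a direction of the boundary cycle for
  each pair \<open>F\<close>, \<open>{}\<close>) appear as existential quantifiers: \<open>ori\<close> is an edge orientation if it
  results from some such choices.\<close>

definition edge_orientation ::
  "'a::euclidean_space set \<Rightarrow> ('a set \<times> 'a set \<times> 'a set \<Rightarrow> 'a \<times> 'a) \<Rightarrow> bool" where
  "edge_orientation P ori \<longleftrightarrow>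
     (\<forall>F F'. simultaneously_visible P F F' \<and> F' \<noteq> {} \<longrightarrow>
        (let A = affine hull (F \<union> F'); Q = P \<inter> A in
          \<exists>b. ordered_basis b (direction_space A) \<and>
              counterclockwise b Q F (\<lambda>e. ori (e, F, F')) \<and>
              counterclockwise b Q F' (\<lambda>e. ori (e, F', F)))) \<and>
     (\<forall>F. simultaneously_visible P F {} \<longrightarrow> cyclic_orientation F (\<lambda>e. ori (e, F, {})))"

definition parallel_opposite :: "'a::euclidean_space \<times> 'a \<Rightarrow> 'a \<times> 'a \<Rightarrow> bool" where
  "parallel_opposite p q \<longleftrightarrow> (\<exists>c>0. snd p - fst p = - (c *\<^sub>R (snd q - fst q)))"

fun compensate ::
  "('a set \<times> 'a set \<times> 'a set \<Rightarrow> 'a \<times> 'a) \<Rightarrow>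
   'a::euclidean_space set \<times> 'a set \<times> 'a set \<Rightarrow> 'a set \<times> 'a set \<times> 'a set \<Rightarrow> bool" where
  "compensate ori (e, F, F') (e', G, G') \<longleftrightarrow>
     (e, F, F') \<noteq> (e', G, G') \<and>
     parallel_opposite (ori (e, F, F')) (ori (e', G, G')) \<and>
     (F = G' \<and> F' = G \<or> F = G \<and> F' = G')"

end

theory Submission
  imports Defs
begin

text \<open>
  Vertices of the projection to an admissible plane \<open>W\<close> correspond to the vertices of \<open>P\<close> exposed by
  functionals in \<open>W\<close>. If \<open>F\<close> and \<open>F'\<close> are simultaneously visible, then \<open>F\<close> and \<open>F'\<close> are exactly the faces
  exposed by \<open>n\<close> and \<open>-n\<close> for some \<open>n\<close>. For a generic direction \<open>u\<close> of \<open>F\<close> take a generic \<open>w\<close> orthogonal to \<open>u\<close>.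
  The planes spanned by \<open>n + t u\<close> and \<open>w\<close> are admissible for small \<open>t \<noteq> 0\<close>. As \<open>t\<close> passes through \<open>0\<close>, only the
  contributions of \<open>F\<close> and \<open>F'\<close> change: for \<open>t > 0\<close> one sees the vertices at which \<open>F\<close> is left in direction
  \<open>u\<close> and those at which \<open>F'\<close> is left in direction \<open>-u\<close>, and for \<open>t < 0\<close> conversely. Equiprojectivity equates the
  two counts. Rotating \<open>u\<close> through the direction \<open>q\<close> of an edge changes the counts by the number of edges
  parallel to \<open>q\<close> on one side of the polygon minus the number on the other side. Hence these differences agree
  for \<open>F\<close> and \<open>F'\<close> (and vanish if \<open>F'\<close> is missing), which says that edges with opposite orientations
  balance.
\<close>

section \<open>Faces exposed by linear functionals\<close>

text \<open>The functionals of a plane that expose \<open>F\<close> and \<open>F'\<close> are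
  opposite because independent ones would make all of \<open>W\<close> vanish on the directions of
  \<open>F\<close>, hence on an edge of \<open>F\<close>, which also lies in a non-parallel 2-face.
  Genericity is always obtained by avoiding finitely many directions: those of the edges of
  \<open>P\<close>, and in each non-parallel 2-face the one direction killed by the exposing
  functional. A polygon has at most one edge parallel to a given direction on each side, so all
  counts are 0 or 1 and the balance leaves two possibilities: either \<open>F\<close> has the
  opposite parallel edge too, or it has only one edge in this direction and then \<open>F'\<close>
  has exactly one, on the same side. This prescribes the pairing. Compensation itself need not be
  unique, since two parallel edges in each of \<open>F\<close> and \<open>F'\<close> compensate each
  other in several ways; a canonical partner is therefore fixed by geometry alone and then checked
  against the orientation. That check has two sources: determinants of outward oriented triples for
  a pair, and for a lone \<open>F\<close> the fact that a combinatorially cyclic orientation keeps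
  the polygon on one side.\<close>

definition max_face :: "'a::euclidean_space \<Rightarrow> 'a set \<Rightarrow> 'a set" where
  "max_face n S = {x \<in> S. \<forall>y\<in>S. n \<bullet> y \<le> n \<bullet> x}"

lemma max_faceI: "x \<in> S \<Longrightarrow> (\<And>y. y \<in> S \<Longrightarrow> n \<bullet> y \<le> n \<bullet> x) \<Longrightarrow> x \<in> max_face n S"
  by (simp add: max_face_def)

lemma max_face_subset: "max_face n S \<subseteq> S"
  by (auto simp: max_face_def)

lemma max_face_le: "x \<in> max_face n S \<Longrightarrow> y \<in> S \<Longrightarrow> n \<bullet> y \<le> n \<bullet> x"
  by (simp add: max_face_def)

lemma max_face_eq: "x \<in> max_face n S \<Longrightarrow> y \<in> max_face n S \<Longrightarrow> n \<bullet> y = n \<bullet> x"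
  by (meson antisym max_face_le max_face_subset subsetD)

lemma max_face_less: "x \<in> max_face n S \<Longrightarrow> y \<in> S \<Longrightarrow> y \<notin> max_face n S \<Longrightarrow> n \<bullet> y < n \<bullet> x"
  by (force simp: max_face_def)

lemma in_max_face_iff: "x \<in> max_face n S \<Longrightarrow> y \<in> S \<Longrightarrow> y \<in> max_face n S \<longleftrightarrow> n \<bullet> y = n \<bullet> x"
  by (force simp: max_face_def)

lemma max_face_singletonI:
  "x \<in> S \<Longrightarrow> (\<And>y. y \<in> S \<Longrightarrow> y \<noteq> x \<Longrightarrow> n \<bullet> y < n \<bullet> x) \<Longrightarrow> max_face n S = {x}"
  by (force simp: max_face_def)

lemma max_face_scaleR: "c > 0 \<Longrightarrow> max_face (c *\<^sub>R n) S = max_face n S"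
  by (simp add: max_face_def)

lemma max_face_face_of:
  assumes "convex S"
  shows "max_face n S face_of S"
proof (cases "max_face n S = {}")
  case False
  then obtain x where x: "x \<in> max_face n S" by blast
  have "max_face n S = S \<inter> {y. n \<bullet> y = n \<bullet> x}"
    using x by (force simp: max_face_def)
  then show ?thesis
    using face_of_Int_supporting_hyperplane_le[OF assms, of n "n \<bullet> x"] max_face_le[OF x] by simp
qed simp

lemma max_face_nonempty:
  assumes "compact S" "S \<noteq> {}"
  shows "max_face n S \<noteq> {}"
proof -
  have "continuous_on S (\<lambda>x. n \<bullet> x)" by (intro continuous_intros)
  then obtain x where "x \<in> S" "\<forall>y\<in>S. n \<bullet> y \<le> n \<bullet> x"
    using continuous_attains_sup[OF assms] by blast
  then show ?thesis by (auto simp: max_face_def)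
qed

lemma face_of_polytope_eq_max_face:
  assumes "polytope P" "F face_of P" "F \<noteq> {}"
  obtains n where "max_face n P = F"
proof -
  have "F exposed_face_of P"
    using assms by (simp add: exposed_face_of_polyhedron polytope_imp_polyhedron)
  then obtain a b where "P \<subseteq> {x. a \<bullet> x \<le> b}" "F = P \<inter> {x. a \<bullet> x = b}"
    by (auto simp: exposed_face_of_def)
  then have "max_face a P = F"
    using assms(3) by (force simp: max_face_def)
  then show thesis by (rule that)
qed

section \<open>Polytopes as convex hulls of their vertices\<close>

lemma polytope_eq_hull_vertices:
  fixes P :: "'a::euclidean_space set"
  shows "polytope P \<Longrightarrow> P = convex hull {x. x extreme_point_of P}"
  by (metis Krein_Milman_Minkowski polytope_imp_compact polytope_imp_convex)

lemma finite_vertices: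
  fixes P :: "'a::euclidean_space set"
  shows "polytope P \<Longrightarrow> finite {x. x extreme_point_of P}"
  by (simp add: finite_polyhedron_extreme_points polytope_imp_polyhedron)

lemma vertex_in: "x extreme_point_of S \<Longrightarrow> x \<in> S"
  by (simp add: extreme_point_of_def)

lemma vertex_in_max_face_iff:
  assumes "polytope P" "x extreme_point_of P"
  shows "x \<in> max_face f P \<longleftrightarrow> (\<forall>z. z extreme_point_of P \<longrightarrow> f \<bullet> z \<le> f \<bullet> x)"
proof
  assume *: "\<forall>z. z extreme_point_of P \<longrightarrow> f \<bullet> z \<le> f \<bullet> x"
  have "convex hull {x. x extreme_point_of P} \<subseteq> {z. f \<bullet> z \<le> f \<bullet> x}"
    using * by (intro hull_minimal) (auto simp: convex_halfspace_le)
  then show "x \<in> max_face f P"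
    using polytope_eq_hull_vertices[OF assms(1)] vertex_in[OF assms(2)] by (auto simp: max_face_def)
qed (use vertex_in in \<open>auto simp: max_face_def\<close>)

lemma polytope_eqI_vertices:
  fixes F G :: "'a::euclidean_space set"
  assumes "polytope P" "F face_of P" "G face_of P"
    and "\<And>x. x extreme_point_of P \<Longrightarrow> x \<in> F \<longleftrightarrow> x \<in> G"
  shows "F = G"
proof -
  have "{x. x extreme_point_of F} = {x. x extreme_point_of G}"
    using extreme_point_of_face[OF assms(2)] extreme_point_of_face[OF assms(3)] assms(4) by auto
  then show ?thesis
    using polytope_eq_hull_vertices[OF face_of_polytope_polytope[OF assms(1,2)]]
      polytope_eq_hull_vertices[OF face_of_polytope_polytope[OF assms(1,3)]] by simp
qed

lemma vertex_exists:
  fixes P :: "'a::euclidean_space set"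
  assumes "polytope P" "P \<noteq> {}"
  obtains x where "x extreme_point_of P"
  using polytope_eq_hull_vertices[OF assms(1)] assms(2) by fastforce

section \<open>Lexicographic perturbation of a functional\<close>

lemma eventually_less_linear:
  fixes a b c d :: real
  assumes "a < b \<or> (a = b \<and> c < d)"
  shows "\<forall>\<^sub>F t in at_right 0. a + t * c < b + t * d"
  using assms
proof
  assume "a < b"
  have "((\<lambda>t. (b + t * d) - (a + t * c)) \<longlongrightarrow> (b + 0 * d) - (a + 0 * c)) (at_right 0)"
    by (intro tendsto_intros)
  then have "\<forall>\<^sub>F t in at_right 0. (b + t * d) - (a + t * c) > 0"
    using \<open>a < b\<close> by (intro order_tendstoD(1)) auto
  then show ?thesis by eventually_elim simp
next
  assume *: "a = b \<and> c < d"
  then show ?thesis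
    using eventually_at_right_less[of "0::real"] by (auto elim: eventually_mono)
qed

text \<open>For small positive t the perturbed functional is maximised lexicographically, by
  \<open>g\<close> first and among ties by \<open>h\<close>. Only finitely many vertices compete, so
  a single threshold for t suffices.\<close>

lemma max_face_perturb:
  assumes P: "polytope P"
  shows "\<forall>\<^sub>F t in at_right 0. max_face (g + t *\<^sub>R h) P = max_face h (max_face g P)"
proof -
  define V where "V = {x. x extreme_point_of P}"
  let ?M = "max_face g P"
  have cP: "convex P" using P polytope_imp_convex by blast
  have M: "?M face_of P" using max_face_face_of cP by blast
  have N: "max_face h ?M face_of P"
    using M max_face_face_of face_of_imp_convex face_of_trans by blast
  have pM: "polytope ?M" using M P face_of_polytope_polytope by blast
  have finV: "finite V" unfolding V_def by (rule finite_vertices[OF P])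
  let ?lex = "\<lambda>x y. g \<bullet> x < g \<bullet> y \<or> (g \<bullet> x = g \<bullet> y \<and> h \<bullet> x < h \<bullet> y)"
  have "\<forall>\<^sub>F t in at_right 0. ?lex x y \<longrightarrow> (g + t *\<^sub>R h) \<bullet> x < (g + t *\<^sub>R h) \<bullet> y" for x y
  proof (cases "?lex x y")
    case True
    from eventually_less_linear[OF True] show ?thesis
      by eventually_elim (simp add: inner_add_left)
  qed auto
  then have "\<forall>\<^sub>F t in at_right 0. \<forall>x\<in>V. \<forall>y\<in>V. ?lex x y \<longrightarrow> (g + t *\<^sub>R h) \<bullet> x < (g + t *\<^sub>R h) \<bullet> y"
    using finV by (intro eventually_ball_finite ballI)
  then show ?thesis
  proof eventually_elim
    case (elim t)
    show ?case
    proof (rule polytope_eqI_vertices[OF P max_face_face_of[OF cP] N])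
      fix x assume x: "x extreme_point_of P"
      then have xV: "x \<in> V" by (simp add: V_def)
      show "x \<in> max_face (g + t *\<^sub>R h) P \<longleftrightarrow> x \<in> max_face h ?M" (is "?l \<longleftrightarrow> ?r")
      proof
        assume ?l
        then have nl: "\<not> ?lex x y" if "y \<in> V" for y
          using elim xV that max_face_le[OF \<open>?l\<close>, of y] vertex_in[of y P] V_def by fastforce
        have xM: "x \<in> ?M"
          using nl by (force simp: vertex_in_max_face_iff[OF P x] V_def)
        have xeM: "x extreme_point_of ?M"
          using extreme_point_of_face[OF M] x xM by blast
        show ?r
          unfolding vertex_in_max_face_iff[OF pM xeM]
        proof (intro allI impI)
          fix z assume z: "z extreme_point_of ?M"
          then have "z \<in> V" "z \<in> ?M" using extreme_point_of_face[OF M] V_def by auto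
          then show "h \<bullet> z \<le> h \<bullet> x" using nl[of z] max_face_eq[OF xM, of z] by force
        qed
      next
        assume r: ?r
        then have xM: "x \<in> ?M" using max_face_subset by blast
        show ?l
          unfolding vertex_in_max_face_iff[OF P x]
        proof (intro allI impI)
          fix z assume z: "z extreme_point_of P"
          have le: "g \<bullet> z \<le> g \<bullet> x" using max_face_le[OF xM] vertex_in[OF z] by blast
          have le2: "h \<bullet> z \<le> h \<bullet> x" if "g \<bullet> z = g \<bullet> x"
            using that in_max_face_iff[OF xM vertex_in[OF z]] max_face_le[OF r] by blast
          have "?lex z x \<or> (g \<bullet> z = g \<bullet> x \<and> h \<bullet> z = h \<bullet> x)" using le le2 by linarith
          moreover have "z \<in> V" using z V_def by simp
          ultimately show "(g + t *\<^sub>R h) \<bullet> z \<le> (g + t *\<^sub>R h) \<bullet> x"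
            using elim xV by (auto simp: inner_add_left less_imp_le)
        qed
      qed
    qed
  qed
qed

section \<open>Direction spaces\<close>

lemma subspace_direction_space [simp]: "subspace (direction_space S)"
  by (simp add: direction_space_def)

lemma diff_in_direction_space: "x \<in> S \<Longrightarrow> y \<in> S \<Longrightarrow> x - y \<in> direction_space S"
  unfolding direction_space_def by (rule span_base) blast

lemma direction_space_subset_iff:
  "subspace D \<Longrightarrow> direction_space S \<subseteq> D \<longleftrightarrow> (\<forall>x\<in>S. \<forall>y\<in>S. x - y \<in> D)"
proof
  assume D: "subspace D" and *: "\<forall>x\<in>S. \<forall>y\<in>S. x - y \<in> D"
  show "direction_space S \<subseteq> D"
    unfolding direction_space_def by (rule span_minimal[OF _ D]) (use * in blast)
qed (use diff_in_direction_space in blast)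

lemma direction_space_eq_span:
  assumes "a \<in> S"
  shows "direction_space S = span ((\<lambda>x. x - a) ` S)"
proof
  have "x - y \<in> span ((\<lambda>x. x - a) ` S)" if "x \<in> S" "y \<in> S" for x y
    using span_diff[OF span_base span_base, of "x - a" "(\<lambda>x. x - a) ` S" "y - a"] that by auto
  then show "direction_space S \<subseteq> span ((\<lambda>x. x - a) ` S)"
    by (simp add: direction_space_subset_iff)
  show "span ((\<lambda>x. x - a) ` S) \<subseteq> direction_space S"
    using assms by (intro span_minimal) (auto simp: diff_in_direction_space)
qed

lemma dim_direction_space:
  assumes "S \<noteq> {}"
  shows "int (dim (direction_space S)) = aff_dim S"
proof -
  obtain a where a: "a \<in> S" using assms by blast
  have "aff_dim S = int (dim ((\<lambda>x. x - a) ` S))"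
    using a by (subst aff_dim_eq_dim_subtract[of a]) (simp_all add: hull_inc)
  then show ?thesis using direction_space_eq_span[OF a] by (simp add: dim_span)
qed

lemma inner_const_iff_orthogonal_direction_space:
  "(\<forall>x\<in>S. \<forall>y\<in>S. f \<bullet> x = f \<bullet> y) \<longleftrightarrow> (\<forall>v\<in>direction_space S. f \<bullet> v = 0)"
proof -
  have "(\<forall>v\<in>direction_space S. f \<bullet> v = 0) \<longleftrightarrow> direction_space S \<subseteq> {v. f \<bullet> v = 0}"
    by (simp add: subset_eq)
  also have "\<dots> \<longleftrightarrow> (\<forall>x\<in>S. \<forall>y\<in>S. x - y \<in> {v. f \<bullet> v = 0})"
    by (rule direction_space_subset_iff) (rule subspace_hyperplane)
  finally show ?thesis by (simp only: mem_Collect_eq inner_diff_right right_minus_eq)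
qed

lemma affine_hull_eq_translated_direction_space:
  assumes "a \<in> S"
  shows "affine hull S = {x. x - a \<in> direction_space S}"
proof -
  have "affine hull S = (+) a ` span ((\<lambda>x. - a + x) ` S)"
    by (intro affine_hull_span_gen hull_inc assms)
  also have "(\<lambda>x. - a + x) ` S = (\<lambda>x. x - a) ` S" by simp
  also have "(+) a ` span ((\<lambda>x. x - a) ` S) = {x. x - a \<in> span ((\<lambda>x. x - a) ` S)}"
    by (rule set_eqI, rule iffI) (auto intro: rev_image_eqI)
  finally show ?thesis unfolding direction_space_eq_span[OF assms] .
qed

text \<open>A face is the part of \<open>P\<close> in its affine hull, and a common point together
  with a common direction space determines that hull.\<close>

lemma parallel_faces_meeting_eq:
  assumes "convex P" "F face_of P" "G face_of P" "a \<in> F" "a \<in> G"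
    "direction_space F = direction_space G"
  shows "F = G"
proof -
  have "affine hull F = affine hull G"
    using affine_hull_eq_translated_direction_space assms(4-6) by metis
  then show ?thesis
    using face_of_imp_eq_affine_Int[OF assms(1,2)] face_of_imp_eq_affine_Int[OF assms(1,3)] by simp
qed

lemma uminus_transversal:
  assumes "r \<in> direction_space F" "r \<notin> span {q}"
  shows "- r \<in> direction_space F" "- r \<notin> span {q}"
  using assms subspace_neg[OF subspace_direction_space] span_neg[of "- r" "{q}"] by auto

section \<open>Coordinates in two-dimensional spaces\<close>

lemma span_pair_eq:
  fixes D :: "'a::euclidean_space set"
  assumes "subspace D" "dim D = 2" "u \<in> D" "v \<in> D" "u \<noteq> 0" "v \<notin> span {u}"
  shows "D = span {u, v}"
proof -
  have "u \<noteq> v" using assms span_base by blast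
  have "independent {u, v}"
    using assms \<open>u \<noteq> v\<close> by (metis independent_insertI independent_empty insert_commute span_empty singletonD)
  then have "dim {u, v} = 2" using \<open>u \<noteq> v\<close> by (simp add: dim_eq_card_independent)
  moreover have "span {u, v} \<subseteq> D" using assms by (intro span_minimal) auto
  ultimately show ?thesis
    using subspace_dim_equal[of "span {u,v}" D] assms by auto
qed

lemma span_pair_coords:
  fixes D :: "'a::euclidean_space set"
  assumes "subspace D" "dim D = 2" "u \<in> D" "v \<in> D" "u \<noteq> 0" "v \<notin> span {u}" "x \<in> D"
  obtains a b where "x = a *\<^sub>R u + b *\<^sub>R v"
proof -
  have "x \<in> span {u, v}" using span_pair_eq assms by metis
  then obtain a where "x - a *\<^sub>R u \<in> span {v}" using span_breakdown_eq by blast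
  then obtain b where "x - a *\<^sub>R u = b *\<^sub>R v" by (auto simp: span_singleton)
  then show thesis using that[of a b] by (simp add: algebra_simps)
qed

lemma not_in_span_singleton_coords:
  fixes q r :: "'a::real_vector"
  assumes "q \<noteq> 0" "r \<notin> span {q}" "a *\<^sub>R q + b *\<^sub>R r = a' *\<^sub>R q + b' *\<^sub>R r"
  shows "a = a'" "b = b'"
proof -
  have *: "(b - b') *\<^sub>R r = (a' - a) *\<^sub>R q" using assms(3) by (simp add: algebra_simps)
  show "b = b'"
  proof (rule ccontr)
    assume "b \<noteq> b'"
    then have "r = ((a' - a) / (b - b')) *\<^sub>R q"
      using arg_cong[OF *, of "\<lambda>x. (1 / (b - b')) *\<^sub>R x"] by simp
    then show False using assms(2) by (metis rangeI span_singleton)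
  qed
  with * assms(1) show "a = a'" by simp
qed

section \<open>Chains of faces\<close>

text \<open>Climbing down from \<open>G\<close>: a proper face lies in a facet, and each step to a
  facet lowers the dimension by one, so the chain hits every \<open>k\<close> in between.\<close>

lemma face_of_intermediate_dim:
  assumes "polytope G" "e face_of G" "e \<noteq> {}" "aff_dim e \<le> k" "k \<le> aff_dim G"
  obtains H where "H face_of G" "e \<subseteq> H" "aff_dim H = k"
proof -
  have "\<exists>H. H face_of G \<and> e \<subseteq> H \<and> aff_dim H = k"
    using assms
  proof (induction "nat (aff_dim G - k)" arbitrary: G)
    case 0
    then have "aff_dim G = k" by simp
    then show ?case
      using 0 face_of_refl polytope_imp_convex face_of_imp_subset by blast
  next
    case (Suc m)
    then have "e \<noteq> G" by auto
    then obtain F where F: "F facet_of G" "e \<subseteq> F"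
      using face_of_polyhedron_subset_facet Suc.prems polytope_imp_polyhedron by metis
    then have Ff: "F face_of G" and d: "aff_dim F = aff_dim G - 1"
      by (auto simp: facet_of_def)
    have "\<exists>H. H face_of F \<and> e \<subseteq> H \<and> aff_dim H = k"
    proof (rule Suc.hyps(1))
      show "polytope F" using face_of_polytope_polytope Suc.prems(1) Ff by blast
      show "e face_of F"
        using face_of_subset[OF Suc.prems(2) F(2)] face_of_imp_subset[OF Ff] by blast
    qed (use Suc d in auto)
    then show ?case using face_of_trans[OF _ Ff] by blast
  qed
  then show thesis using that by blast
qed

lemma two_face_containing:
  assumes "polytope P" "aff_dim P \<ge> 2" "e face_of P" "e \<noteq> {}" "aff_dim e \<le> 2"
  obtains H where "H \<in> two_faces P" "e \<subseteq> H"
  using face_of_intermediate_dim[OF assms(1,3,4,5,2)] by (auto simp: two_faces_def)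

lemma two_face_of_face:
  assumes "polytope P" "G face_of P" "aff_dim G \<ge> 2"
  obtains H where "H \<in> two_faces P" "H \<subseteq> G"
proof -
  have pG: "polytope G" using face_of_polytope_polytope assms by blast
  have "G \<noteq> {}" using assms(3) by auto
  then obtain x where "x extreme_point_of G" using vertex_exists pG by blast
  then have "{x} face_of G" by (simp add: face_of_singleton)
  then obtain H where "H face_of G" "aff_dim H = 2"
    using face_of_intermediate_dim[OF pG, of "{x}" 2] assms(3) by auto
  then show thesis
    using that[of H] face_of_trans[OF _ assms(2), of H] face_of_imp_subset[of H G]
    by (simp add: two_faces_def)
qed

lemma face_eq_Inter_facets:
  fixes S :: "'a::euclidean_space set"
  assumes "polytope S" "c face_of S" "c \<noteq> {}" "c \<noteq> S"
  shows "c = \<Inter>{F. F facet_of S \<and> c \<subseteq> F}"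
  using face_of_polyhedron polytope_imp_polyhedron assms by blast

text \<open>A face of least dimension on which \<open>f\<close> varies turns out to be an edge.
  Minimality makes \<open>f\<close> constant on its proper faces, which is exploited at a vertex
  where \<open>f\<close> is maximal.\<close>

lemma edge_nonconst:
  fixes P :: "'a::euclidean_space set"
  assumes P: "polytope P" and nc: "x \<in> P" "y \<in> P" "f \<bullet> x \<noteq> f \<bullet> y"
  obtains e a b where "e edge_of P" "a \<in> e" "b \<in> e" "f \<bullet> a \<noteq> f \<bullet> b"
proof -
  define C where "C = (\<lambda>H. H face_of P \<and> (\<exists>a\<in>H. \<exists>b\<in>H. f \<bullet> a \<noteq> f \<bullet> b))"
  have "C P" using P nc polytope_imp_convex face_of_refl unfolding C_def by blast
  define H where "H = arg_min (\<lambda>H. nat (aff_dim H)) C"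
  have CH: "C H" unfolding H_def using \<open>C P\<close> by (rule arg_min_natI)
  have minH: "nat (aff_dim H) \<le> nat (aff_dim G)" if "C G" for G
    unfolding H_def using that by (rule arg_min_nat_le)
  have Hf: "H face_of P" using CH C_def by blast
  have pH: "polytope H" using Hf face_of_polytope_polytope P by blast
  then have cH: "convex H" using polytope_imp_convex by blast
  obtain a b where ab: "a \<in> H" "b \<in> H" "f \<bullet> a \<noteq> f \<bullet> b" using CH C_def by blast
  have const: "f \<bullet> u = f \<bullet> v" if G: "G face_of H" "G \<noteq> H" "u \<in> G" "v \<in> G" for G u v
  proof (rule ccontr)
    assume "f \<bullet> u \<noteq> f \<bullet> v"
    then have "C G" unfolding C_def using face_of_trans[OF G(1) Hf] G by blast
    then have "nat (aff_dim H) \<le> nat (aff_dim G)" by (rule minH)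
    moreover have "aff_dim G < aff_dim H" using face_of_aff_dim_lt[OF cH G(1,2)] .
    moreover have "aff_dim G \<ge> 0"
      using G(3) aff_dim_geq[of G] by (metis aff_dim_empty empty_iff linorder_not_less aff_dim_negative_iff)
    ultimately show False by linarith
  qed
  let ?M = "max_face f H"
  have Mf: "?M face_of H" using max_face_face_of cH by blast
  have "?M \<noteq> H" using max_face_eq[of a f H b] ab by auto
  have "?M \<noteq> {}" using max_face_nonempty pH ab polytope_imp_compact by (metis empty_iff)
  then obtain v where v: "v extreme_point_of ?M"
    using vertex_exists face_of_polytope_polytope pH Mf by blast
  have vM: "v \<in> ?M" using vertex_in v by blast
  have vf: "{v} face_of H" using v face_of_trans[OF _ Mf] by (simp add: face_of_singleton[symmetric])
  have "{v} \<noteq> H" using ab by blast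
  \<comment> \<open>On a facet through \<open>v\<close> the functional is constant with the maximal
    value, so the facet lies in \<open>?M\<close>, and dimensions force equality. As
    \<open>{v}\<close> is the intersection of the facets through it, \<open>{v}\<close> is itself a
    facet and \<open>H\<close> has dimension 1.\<close>
  have facets: "F = ?M" if F: "F facet_of H" "v \<in> F" for F
  proof -
    have Ff: "F face_of H" "aff_dim F = aff_dim H - 1" using F by (auto simp: facet_of_def)
    then have "F \<noteq> H" by auto
    have "F \<subseteq> ?M"
    proof
      fix z assume "z \<in> F"
      then have "f \<bullet> z = f \<bullet> v" "z \<in> H"
        using const[OF Ff(1) \<open>F \<noteq> H\<close>] F(2) face_of_imp_subset[OF Ff(1)] by blast+
      then show "z \<in> ?M" using in_max_face_iff[OF vM] by simp
    qed
    then have "F face_of ?M" using face_of_subset Ff(1) Mf face_of_imp_subset by blast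
    moreover have "aff_dim ?M < aff_dim H" using face_of_aff_dim_lt[OF cH Mf \<open>?M \<noteq> H\<close>] .
    ultimately show ?thesis
      using face_of_aff_dim_lt[of ?M F] Ff(2) face_of_imp_convex[OF Mf] by force
  qed
  have inter: "{v} = \<Inter>{F. F facet_of H \<and> {v} \<subseteq> F}"
    using face_eq_Inter_facets[OF pH vf _ \<open>{v} \<noteq> H\<close>] by blast
  obtain F where F: "F facet_of H" "{v} \<subseteq> F"
    using face_of_polyhedron_subset_facet[OF polytope_imp_polyhedron[OF pH] vf _ \<open>{v} \<noteq> H\<close>] by auto
  have "{F. F facet_of H \<and> {v} \<subseteq> F} = {?M}"
    using facets F by blast
  then have "{v} = ?M" using inter by simp
  then have "F = {v}" using facets F by blast
  then have "aff_dim H = 1" using F(1) by (simp add: facet_of_def)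
  then have "H edge_of P" using Hf by (simp add: edge_of_def)
  then show thesis using that ab by blast
qed

text \<open>The component \<open>f\<close> orthogonal to \<open>V\<close> of a suitable direction of
  \<open>P\<close> varies on \<open>P\<close>, hence along some edge; a 2-face through that edge
  cannot be parallel to \<open>V\<close>.\<close>

lemma nonparallel_two_face:
  assumes P: "polytope P" "aff_dim P \<ge> 3" and V: "subspace V" "dim V = 2"
  obtains H where "H \<in> two_faces P" "direction_space H \<noteq> V"
proof -
  have "P \<noteq> {}" using P by auto
  have "\<not> direction_space P \<subseteq> V"
    using dim_direction_space[OF \<open>P \<noteq> {}\<close>] dim_subset[of "direction_space P" V] P(2) V(2) by linarith
  then obtain x where x: "x \<in> direction_space P" "x \<notin> V" by blast
  define f where "f = x - orth_proj V x"
  have fV: "f \<bullet> v = 0" if "v \<in> V" for v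
    using orth_proj(2)[OF V(1), of x] that by (auto simp: f_def orthogonal_comp_def orthogonal_def inner_commute)
  have "f \<noteq> 0" using x orth_proj(1)[OF V(1), of x] by (auto simp: f_def)
  moreover have "f \<bullet> x = f \<bullet> f"
    using fV[OF orth_proj(1)[OF V(1), of x]] by (simp add: f_def inner_diff_right)
  ultimately have "f \<bullet> x \<noteq> 0" by simp
  then obtain y z where "y \<in> P" "z \<in> P" "f \<bullet> y \<noteq> f \<bullet> z"
    using inner_const_iff_orthogonal_direction_space[of P f] x by blast
  then obtain e a b where e: "e edge_of P" "a \<in> e" "b \<in> e" "f \<bullet> a \<noteq> f \<bullet> b"
    using edge_nonconst[OF P(1)] by metis
  then obtain H where H: "H \<in> two_faces P" "e \<subseteq> H"
    using two_face_containing[OF P(1), of e] P(2) by (force simp: edge_of_def)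
  have "direction_space H \<noteq> V"
    using inner_const_iff_orthogonal_direction_space[of H f] e H(2) fV by blast
  then show thesis using that H by blast
qed

text \<open>In a 3-face containing \<open>F\<close> the edge is the intersection of the facets
  through it, so \<open>F\<close> is not the only one; distinct faces with a common point are never
  parallel.\<close>

lemma edge_in_other_two_face:
  assumes P: "polytope P" "aff_dim P \<ge> 3" and F: "F \<in> two_faces P" and e: "e edge_of F"
  obtains H where "H \<in> two_faces P" "e \<subseteq> H" "direction_space H \<noteq> direction_space F"
proof -
  have Ff: "F face_of P" "aff_dim F = 2" using F by (auto simp: two_faces_def)
  then have "F \<noteq> {}" by auto
  obtain T where T: "T face_of P" "F \<subseteq> T" "aff_dim T = 3"
    using face_of_intermediate_dim[OF P(1) Ff(1) \<open>F \<noteq> {}\<close>, of 3] Ff(2) P(2) by auto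
  have ef: "e face_of F" "aff_dim e = 1" using e by (auto simp: edge_of_def)
  then have "e \<noteq> {}" "e \<noteq> F" "e \<noteq> T" using Ff T by auto
  have FT: "F face_of T" using face_of_subset[OF Ff(1) T(2)] T(1) face_of_imp_subset by blast
  then have eT: "e face_of T" using ef face_of_trans by blast
  have pT: "polytope T" using T face_of_polytope_polytope P by blast
  have "\<exists>H. H facet_of T \<and> e \<subseteq> H \<and> H \<noteq> F"
  proof (rule ccontr)
    assume "\<not> ?thesis"
    moreover obtain H where "H facet_of T" "e \<subseteq> H"
      using face_of_polyhedron_subset_facet[OF polytope_imp_polyhedron[OF pT] eT \<open>e \<noteq> {}\<close> \<open>e \<noteq> T\<close>] .
    ultimately have "{F. F facet_of T \<and> e \<subseteq> F} = {F}" by blast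
    then show False
      using face_eq_Inter_facets[OF pT eT \<open>e \<noteq> {}\<close> \<open>e \<noteq> T\<close>] \<open>e \<noteq> F\<close> by simp
  qed
  then obtain H where H: "H facet_of T" "e \<subseteq> H" "H \<noteq> F" by blast
  have HP: "H face_of P" "aff_dim H = 2"
    using H(1) T face_of_trans by (auto simp: facet_of_def)
  obtain a where "a \<in> e" using \<open>e \<noteq> {}\<close> by blast
  then have "direction_space H \<noteq> direction_space F"
    using parallel_faces_meeting_eq[OF polytope_imp_convex[OF P(1)] HP(1) Ff(1), of a]
      H(2,3) face_of_imp_subset[OF ef(1)] by blast
  then show thesis using that H HP by (auto simp: two_faces_def)
qed

lemma edge_eq_segment:
  fixes P :: "'a::euclidean_space set"
  assumes "polytope P" "e edge_of P"
  obtains a b where "a \<noteq> b" "e = closed_segment a b"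
proof -
  have e: "e face_of P" "aff_dim e = 1" using assms by (auto simp: edge_of_def)
  then have "polytope e" using assms face_of_polytope_polytope by blast
  then obtain a b where "e = closed_segment a b"
    using compact_convex_collinear_segment[of e] e(2) collinear_aff_dim[of e]
      polytope_imp_compact polytope_imp_convex by (metis aff_dim_empty order_refl zero_neq_neg_one one_neq_neg_one)
  moreover have "a \<noteq> b" using e(2) calculation by auto
  ultimately show thesis using that by blast
qed

lemma direction_space_segment: "direction_space (closed_segment a b) = span {b - a}"
proof
  show "direction_space (closed_segment a b) \<subseteq> span {b - a}"
  proof (subst direction_space_subset_iff, simp, intro ballI)
    fix x y assume "x \<in> closed_segment a b" "y \<in> closed_segment a b"
    then obtain s t where s: "x = (1 - s) *\<^sub>R a + s *\<^sub>R b" and t: "y = (1 - t) *\<^sub>R a + t *\<^sub>R b"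
      by (auto simp: closed_segment_def)
    have "x - y = (s - t) *\<^sub>R (b - a)" unfolding s t by (simp add: algebra_simps)
    then show "x - y \<in> span {b - a}" by (auto simp: span_singleton)
  qed
  show "span {b - a} \<subseteq> direction_space (closed_segment a b)"
    by (rule span_minimal) (auto simp: diff_in_direction_space)
qed

lemma edge_of_face: "F face_of P \<Longrightarrow> e edge_of F \<Longrightarrow> e edge_of P"
  unfolding edge_of_def using face_of_trans by blast

lemma finite_edges: "polytope (P::'a::euclidean_space set) \<Longrightarrow> finite {e. e edge_of P}"
  by (rule finite_subset[OF _ finite_polytope_faces[of P]]) (auto simp: edge_of_def)

lemma finite_two_faces: "polytope (P::'a::euclidean_space set) \<Longrightarrow> finite (two_faces P)"
  by (rule finite_subset[OF _ finite_polytope_faces[of P]]) (auto simp: two_faces_def)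

lemma two_faceD:
  assumes "F \<in> two_faces P"
  shows "F face_of P" "aff_dim F = 2" "F \<noteq> {}" "dim (direction_space F) = 2"
proof -
  show *: "F face_of P" "aff_dim F = 2" using assms by (auto simp: two_faces_def)
  then show "F \<noteq> {}" by auto
  then show "dim (direction_space F) = 2" using dim_direction_space[of F] * by simp
qed

section \<open>Projections onto planes\<close>

lemma dim_2_not_in_span_singleton:
  fixes D :: "'a::euclidean_space set"
  assumes "dim D = 2"
  obtains w where "w \<in> D" "w \<notin> span {v}"
proof -
  have "\<not> D \<subseteq> span {v}"
    using dim_le_card[of D "{v}"] assms by auto
  then show thesis using that by blast
qed

text \<open>These vertices of \<open>P\<close> stand in for the vertices of the projection, so that
  the counts for different planes can be compared inside one fixed polytope.\<close>

definition vis :: "'a::euclidean_space set \<Rightarrow> 'a set \<Rightarrow> 'a set" where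
  "vis P W = {x. \<exists>g\<in>W. max_face g P = {x}}"

lemma inner_orth_proj:
  assumes "subspace W" "g \<in> W"
  shows "g \<bullet> orth_proj W x = g \<bullet> x"
proof -
  have "g \<bullet> (x - orth_proj W x) = 0"
    using orth_proj(2)[OF assms(1), of x] assms(2) by (simp add: orthogonal_comp_def orthogonal_def)
  then show ?thesis by (simp add: inner_diff_right)
qed

lemma inner_orth_proj2:
  assumes "subspace W"
  shows "orth_proj W a \<bullet> x = a \<bullet> orth_proj W x"
  using inner_orth_proj[OF assms orth_proj(1)[OF assms, of a], of x]
    inner_orth_proj[OF assms orth_proj(1)[OF assms, of x], of a]
  by (simp add: inner_commute)

lemma orth_proj_eq_0_iff_inner:
  "subspace W \<Longrightarrow> orth_proj W v = 0 \<longleftrightarrow> (\<forall>g\<in>W. g \<bullet> v = 0)"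
  by (simp add: orth_proj_eq_0_iff orthogonal_comp_def orthogonal_def)

text \<open>Rank and nullity on a 2-dimensional space: the image lies in a line iff some nonzero
  direction is killed. Stated with the functionals in \<open>W\<close>, the criterion no longer
  mentions the projection.\<close>

lemma degenerating_iff:
  assumes W: "subspace W" and d: "dim (direction_space F) = 2"
  shows "degenerating W F \<longleftrightarrow> (\<exists>v\<in>direction_space F. v \<noteq> 0 \<and> (\<forall>g\<in>W. g \<bullet> v = 0))"
proof -
  let ?D = "direction_space F"
  have lin: "linear (orth_proj W)" by (rule linear_orth_proj[OF W])
  have "(\<exists>u. \<forall>v\<in>?D. \<exists>c. orth_proj W v = c *\<^sub>R u) \<longleftrightarrow> (\<exists>v\<in>?D. v \<noteq> 0 \<and> orth_proj W v = 0)"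
  proof
    assume "\<exists>u. \<forall>v\<in>?D. \<exists>c. orth_proj W v = c *\<^sub>R u"
    then obtain u where u: "\<And>v. v \<in> ?D \<Longrightarrow> \<exists>c. orth_proj W v = c *\<^sub>R u" by blast
    show "\<exists>v\<in>?D. v \<noteq> 0 \<and> orth_proj W v = 0"
    proof (rule ccontr)
      assume "\<not> ?thesis"
      then have "inj_on (orth_proj W) ?D"
        using linear_injective_on_subspace_0[OF lin subspace_direction_space] by blast
      then have "dim (orth_proj W ` ?D) = 2"
        using dim_image_eq[OF lin, of ?D] d by (simp add: span_eq_iff[THEN iffD2])
      moreover have "orth_proj W ` ?D \<subseteq> span {u}"
        using u by (auto simp: span_singleton)
      then have "dim (orth_proj W ` ?D) \<le> card {u}"
        by (intro dim_le_card) auto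
      ultimately show False by simp
    qed
  next
    assume "\<exists>v\<in>?D. v \<noteq> 0 \<and> orth_proj W v = 0"
    then obtain v where v: "v \<in> ?D" "v \<noteq> 0" "orth_proj W v = 0" by blast
    obtain w where w: "w \<in> ?D" "w \<notin> span {v}" using dim_2_not_in_span_singleton[OF d] .
    have "\<exists>c. orth_proj W x = c *\<^sub>R orth_proj W w" if x: "x \<in> ?D" for x
    proof -
      obtain a b where "x = a *\<^sub>R v + b *\<^sub>R w"
        using span_pair_coords[OF subspace_direction_space d v(1) w(1) v(2) w(2) x] .
      then show ?thesis using v(3) by (simp add: linear_add[OF lin] linear_scale[OF lin])
    qed
    then show "\<exists>u. \<forall>v\<in>?D. \<exists>c. orth_proj W v = c *\<^sub>R u" by blast
  qed
  then show ?thesis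
    by (simp add: degenerating_iff_direction_space[OF W] orth_proj_eq_0_iff_inner[OF W])
qed

lemma Union_face_classes: "\<Union> (face_classes P) = two_faces P"
  unfolding face_classes_def by (rule Union_quotient[OF equiv_parallel_rel])

lemma face_class_in: "F \<in> two_faces P \<Longrightarrow> face_class P F \<in> face_classes P"
  unfolding face_classes_def face_class_def by (rule quotientI)

lemma admissible_iff:
  "admissible P W \<longleftrightarrow> plane W \<and> (\<forall>F\<in>two_faces P. \<not> degenerating W F)"
  unfolding admissible_def class_degenerating_def Union_face_classes[symmetric] by blast

lemma only_degenerating_class_iff:
  assumes "only_degenerating_class P F W" "F \<in> two_faces P" "H \<in> two_faces P"
  shows "degenerating W H \<longleftrightarrow> direction_space H = direction_space F"
proof -
  have W: "subspace W" using assms by (simp add: only_degenerating_class_def plane_def)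
  have "degenerating W H \<longleftrightarrow> class_degenerating W (face_class P H)"
    using class_degenerating_face_class[OF W assms(3)] by simp
  also have "\<dots> \<longleftrightarrow> face_class P H = face_class P F"
    using assms(1) face_class_in[OF assms(3)] by (simp add: only_degenerating_class_def)
  also have "\<dots> \<longleftrightarrow> (H, F) \<in> parallel_rel P"
    unfolding face_class_def using eq_equiv_class_iff[OF equiv_parallel_rel assms(3,2)] .
  also have "\<dots> \<longleftrightarrow> direction_space H = direction_space F"
    using assms by (simp add: parallel_rel_def)
  finally show ?thesis .
qed

text \<open>The projection restricts to a bijection. A functional of \<open>W\<close> sees only the
  projection, whence injectivity. Conversely, the face of \<open>P\<close> over a vertex is a single
  point: an edge in it would be killed and would make a 2-face through it degenerate.\<close>

lemma card_vis:
  assumes P: "polytope P" "aff_dim P \<ge> 2" and W: "subspace W"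
    and nd: "\<And>H. H \<in> two_faces P \<Longrightarrow> \<not> degenerating W H"
  shows "card {v. v extreme_point_of orth_proj W ` P} = card (vis P W)"
proof -
  let ?\<pi> = "orth_proj W"
  have lin: "linear ?\<pi>" by (rule linear_orth_proj[OF W])
  have pP: "polytope (?\<pi> ` P)" using polytope_linear_image[OF lin P(1)] .
  have pi_ext: "?\<pi> x extreme_point_of ?\<pi> ` P" if g: "g \<in> W" "max_face g P = {x}" for x g
  proof -
    have x: "x \<in> max_face g P" using g by simp
    have "max_face g (?\<pi> ` P) = {?\<pi> x}"
    proof (rule max_face_singletonI)
      show "?\<pi> x \<in> ?\<pi> ` P" using x max_face_subset by blast
      fix y assume "y \<in> ?\<pi> ` P" "y \<noteq> ?\<pi> x"
      then obtain z where z: "z \<in> P" "y = ?\<pi> z" "z \<noteq> x" by blast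
      then have "g \<bullet> z < g \<bullet> x" using max_face_less[OF x] g by blast
      then show "g \<bullet> y < g \<bullet> ?\<pi> x" using inner_orth_proj[OF W g(1)] z by simp
    qed
    then have "{?\<pi> x} face_of ?\<pi> ` P"
      using max_face_face_of polytope_imp_convex[OF pP] by metis
    then show ?thesis by (simp add: face_of_singleton)
  qed
  have "bij_betw ?\<pi> (vis P W) {v. v extreme_point_of ?\<pi> ` P}"
    unfolding bij_betw_def
  proof
    show "inj_on ?\<pi> (vis P W)"
    proof (rule inj_onI)
      fix x y assume "x \<in> vis P W" "y \<in> vis P W" and eq: "?\<pi> x = ?\<pi> y"
      then obtain g h where g: "g \<in> W" "max_face g P = {x}" and "max_face h P = {y}"
        by (auto simp: vis_def)
      then have "x \<in> max_face g P" "y \<in> P" using max_face_subset by blast+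
      moreover have "g \<bullet> x = g \<bullet> y" using inner_orth_proj[OF W g(1)] eq by metis
      ultimately show "x = y" using in_max_face_iff g by force
    qed
    show "?\<pi> ` vis P W = {v. v extreme_point_of ?\<pi> ` P}"
    proof
      show "?\<pi> ` vis P W \<subseteq> {v. v extreme_point_of ?\<pi> ` P}"
        using pi_ext by (auto simp: vis_def)
      show "{v. v extreme_point_of ?\<pi> ` P} \<subseteq> ?\<pi> ` vis P W"
      proof
        fix v assume "v \<in> {v. v extreme_point_of ?\<pi> ` P}"
        then have "{v} face_of ?\<pi> ` P" by (simp add: face_of_singleton)
        then obtain c where c: "max_face c (?\<pi> ` P) = {v}"
          using face_of_polytope_eq_max_face[OF pP] by blast
        \<comment> \<open>The functional \<open>c\<close> may be any vector of the ambient space;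
          its projection \<open>g\<close> lies in \<open>W\<close> and takes on \<open>P\<close> the
          values of \<open>c\<close> on the image.\<close>
        define g where "g = ?\<pi> c"
        have gW: "g \<in> W" unfolding g_def by (rule orth_proj(1)[OF W])
        have gx: "g \<bullet> x = c \<bullet> ?\<pi> x" for x unfolding g_def by (rule inner_orth_proj2[OF W])
        let ?M = "max_face g P"
        have Mpi: "?\<pi> x = v" if "x \<in> ?M" for x
        proof -
          have "?\<pi> x \<in> max_face c (?\<pi> ` P)" using that by (auto simp: max_face_def gx)
          then show ?thesis using c by simp
        qed
        have Mf: "?M face_of P" using max_face_face_of P polytope_imp_convex by blast
        have "v \<in> ?\<pi> ` P" using c max_face_subset by blast
        then have "?M \<noteq> {}" using max_face_nonempty P polytope_imp_compact by (metis empty_iff image_empty)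
        then obtain x where x: "x \<in> ?M" by blast
        have "?M = {x}"
        proof (rule ccontr)
          assume "?M \<noteq> {x}"
          then have "\<not> (\<exists>a. ?M = {a})" using x by (metis singletonD)
          then have "aff_dim ?M \<noteq> 0" by (simp add: aff_dim_eq_0)
          moreover have "aff_dim ?M \<ge> 0"
            using \<open>?M \<noteq> {}\<close> aff_dim_negative_iff[of ?M] by linarith
          ultimately have d: "aff_dim ?M \<ge> 1" by linarith
          have pM: "polytope ?M" using Mf P face_of_polytope_polytope by blast
          obtain a where "a extreme_point_of ?M" using vertex_exists[OF pM] x by blast
          then obtain e where e: "e face_of ?M" "aff_dim e = 1"
            using face_of_intermediate_dim[OF pM, of "{a}" 1] d by (auto simp: face_of_singleton)
          have eP: "e face_of P" using e Mf face_of_trans by blast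
          have "e edge_of P" using eP e by (simp add: edge_of_def)
          then obtain p q where pq: "p \<noteq> q" "e = closed_segment p q"
            using edge_eq_segment[OF P(1)] by blast
          obtain H where H: "H \<in> two_faces P" "e \<subseteq> H"
            using two_face_containing[OF P eP] e(2) by force
          have "p \<in> e" "q \<in> e" using pq by auto
          then have pq': "p \<in> ?M" "q \<in> ?M" "p \<in> H" "q \<in> H"
            using face_of_imp_subset[OF e(1)] H(2) by auto
          have "p - q \<in> direction_space H" using diff_in_direction_space pq' by blast
          moreover have "?\<pi> (p - q) = 0" using Mpi pq' linear_diff[OF lin] by simp
          ultimately have "degenerating W H"
            unfolding degenerating_iff[OF W two_faceD(4)[OF H(1)]]
            using pq(1) orth_proj_eq_0_iff_inner[OF W] by (metis right_minus_eq)
          then show False using nd H(1) by blast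
        qed
        then have "x \<in> vis P W" using gW by (auto simp: vis_def)
        then show "v \<in> ?\<pi> ` vis P W" using Mpi x by blast
      qed
    qed
  qed
  then show ?thesis using bij_betw_same_card by metis
qed

lemma equiprojective_card_vis:
  assumes "polytope P" "aff_dim P \<ge> 2" "equiprojective P"
  obtains k where "\<And>W. admissible P W \<Longrightarrow> card (vis P W) = k"
proof -
  obtain k where k: "k_equiprojective k P" using assms by (auto simp: equiprojective_def)
  have "card (vis P W) = k" if "admissible P W" for W
    using k that card_vis[OF assms(1,2), of W]
    by (auto simp: k_equiprojective_def k_gon_def admissible_iff plane_def)
  then show thesis by (rule that)
qed

section \<open>Visible faces and the functionals that expose them\<close>

lemma visible_max_face:
  assumes "convex P" "convex F" "F \<noteq> {}" "F \<subseteq> P" "subspace W" "visible P W F"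
  obtains n where "n \<in> W" "F \<subseteq> max_face n P" "max_face n P \<noteq> P"
proof -
  note W = assms(5)
  let ?\<pi> = "orth_proj W"
  have lin: "linear ?\<pi>" by (rule linear_orth_proj[OF W])
  let ?S = "?\<pi> ` P"
  have cS: "convex ?S" "convex (?\<pi> ` F)"
    using assms(1,2) convex_linear_image[OF lin] by blast+
  have "rel_interior (?\<pi> ` F) \<noteq> {}" using cS(2) assms(3) by (simp add: rel_interior_eq_empty)
  then obtain z where z: "z \<in> rel_interior (?\<pi> ` F)" by blast
  then have zF: "z \<in> ?\<pi> ` F" using rel_interior_subset by blast
  then have zS: "z \<in> ?S" using assms(4) by blast
  have "z \<notin> rel_interior ?S"
    using assms(6) zF by (auto simp: visible_def rel_frontier_def)
  then obtain a where a: "\<And>y. y \<in> ?S \<Longrightarrow> a \<bullet> z \<le> a \<bullet> y"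
    "\<And>y. y \<in> rel_interior ?S \<Longrightarrow> a \<bullet> z < a \<bullet> y"
    using supporting_hyperplane_rel_boundary[OF cS(1) zS] by metis
  let ?T = "max_face (-a) ?S"
  have zT: "z \<in> ?T" using zS a(1) by (auto simp: max_face_def)
  \<comment> \<open>Support is known only at the one point \<open>z\<close>; as a relative interior
    point of the image of \<open>F\<close> it drags the whole image into the supporting
    face.\<close>
  have sub: "?\<pi> ` F \<subseteq> ?T"
    by (rule subset_of_face_of[OF max_face_face_of[OF cS(1)]]) (use assms(4) z zT in auto)
  define n where "n = ?\<pi> (- a)"
  have nx: "n \<bullet> x = - a \<bullet> ?\<pi> x" for x unfolding n_def by (rule inner_orth_proj2[OF W])
  have iff: "x \<in> max_face n P \<longleftrightarrow> ?\<pi> x \<in> ?T" if "x \<in> P" for x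
    using that by (auto simp: max_face_def nx)
  have "rel_interior ?S \<noteq> {}" using cS(1) zS by (auto simp: rel_interior_eq_empty)
  then obtain y where y: "y \<in> rel_interior ?S" by blast
  then have "y \<in> ?S" using rel_interior_subset by blast
  moreover have "y \<notin> ?T" using a(2)[OF y] max_face_eq[OF zT, of y] by auto
  ultimately have "max_face n P \<noteq> P" using iff by blast
  moreover have "F \<subseteq> max_face n P" using sub iff assms(4) by blast
  moreover have "n \<in> W" unfolding n_def by (rule orth_proj(1)[OF W])
  ultimately show thesis using that by blast
qed

lemma visible_of_max_face:
  assumes "convex P" "subspace W" "n \<in> W" "max_face n P \<noteq> P" "F \<subseteq> max_face n P"
  shows "visible P W F"
proof -
  let ?\<pi> = "orth_proj W"
  let ?S = "?\<pi> ` P"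
  have cS: "convex ?S" using assms(1) convex_linear_image[OF linear_orth_proj[OF assms(2)]] by blast
  have iff: "x \<in> max_face n P \<longleftrightarrow> ?\<pi> x \<in> max_face n ?S" if "x \<in> P" for x
    using that by (auto simp: max_face_def inner_orth_proj[OF assms(2,3)])
  have "max_face n ?S \<noteq> ?S" using assms(4) iff max_face_subset[of n P] by blast
  then have "max_face n ?S \<subseteq> rel_frontier ?S"
    using face_of_subset_rel_frontier max_face_face_of[OF cS] by blast
  moreover have "?\<pi> ` F \<subseteq> max_face n ?S" using iff assms(5) max_face_subset[of n P] by blast
  ultimately show ?thesis unfolding visible_def by blast
qed

text \<open>If \<open>n\<close> vanishes on all directions of \<open>H\<close>, the plane imposes
  only one further linear condition on them, and one condition has a nonzero solution on a
  2-dimensional space.\<close>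

lemma plane_degenerating:
  assumes W: "plane W" and n: "n \<in> W" "n \<noteq> 0" and H: "H \<in> two_faces P"
    and *: "\<And>v. v \<in> direction_space H \<Longrightarrow> n \<bullet> v = 0"
  shows "degenerating W H"
proof -
  have sW: "subspace W" "dim W = 2" using W by (auto simp: plane_def)
  obtain w where w: "w \<in> W" "w \<notin> span {n}" using dim_2_not_in_span_singleton[OF sW(2)] .
  let ?D = "direction_space H"
  have dD: "dim ?D = 2" using two_faceD[OF H] by blast
  obtain v1 where v1: "v1 \<in> ?D" "v1 \<noteq> 0"
    using dim_2_not_in_span_singleton[OF dD, of 0] by (metis span_0)
  obtain v2 where v2: "v2 \<in> ?D" "v2 \<notin> span {v1}" using dim_2_not_in_span_singleton[OF dD] .
  define v where "v = (if w \<bullet> v1 = 0 then v1 else v2 - ((w \<bullet> v2) / (w \<bullet> v1)) *\<^sub>R v1)"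
  have v: "v \<in> ?D"
    using v1(1) v2(1) subspace_diff[OF subspace_direction_space v2(1) subspace_scale[OF subspace_direction_space v1(1)]]
    by (simp add: v_def)
  have "v2 \<noteq> c *\<^sub>R v1" for c using v2(2) by (metis rangeI span_singleton)
  then have "v \<noteq> 0" using v1(2) by (simp add: v_def)
  have "w \<bullet> v = 0" unfolding v_def by (simp add: inner_diff_right)
  have "g \<bullet> v = 0" if g: "g \<in> W" for g
  proof -
    obtain a b where "g = a *\<^sub>R n + b *\<^sub>R w"
      using span_pair_coords[OF sW n(1) w(1) n(2) w(2) g] .
    then show ?thesis using *[OF v] \<open>w \<bullet> v = 0\<close> by (simp add: inner_add_left)
  qed
  then show ?thesis
    using v \<open>v \<noteq> 0\<close> degenerating_iff[OF sW(1) dD] by blast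
qed

lemma only_degenerating_transversal:
  assumes "only_degenerating_class P F W" "F \<in> two_faces P" "H \<in> two_faces P"
    "direction_space H \<noteq> direction_space F" "n \<in> W" "n \<noteq> 0"
  obtains v where "v \<in> direction_space H" "n \<bullet> v \<noteq> 0"
proof -
  have "\<not> degenerating W H" using only_degenerating_class_iff[OF assms(1-3)] assms(4) by simp
  moreover have "plane W" using assms(1) by (simp add: only_degenerating_class_def)
  ultimately show thesis using plane_degenerating[OF _ assms(5,6,3)] that by blast
qed

text \<open>Every 2-face inside the exposed face is annihilated by \<open>n\<close> and hence
  parallel to \<open>F\<close>. A face of dimension at least 3 would contain 2-faces in other
  directions, so nothing larger than \<open>H\<close> is exposed.\<close>

lemma only_degenerating_max_face:
  assumes P: "polytope P" and o: "only_degenerating_class P F W" and F: "F \<in> two_faces P"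
    and n: "n \<in> W" "max_face n P \<noteq> P"
    and H: "H \<in> two_faces P" "H \<subseteq> max_face n P"
  shows "max_face n P = H" "direction_space H = direction_space F"
proof -
  let ?M = "max_face n P"
  have cP: "convex P" using P polytope_imp_convex by blast
  have Mf: "?M face_of P" using max_face_face_of[OF cP] .
  have "n \<noteq> 0" using n(2) by (auto simp: max_face_def)
  have par: "direction_space G = direction_space F" if G: "G \<in> two_faces P" "G \<subseteq> ?M" for G
  proof (rule ccontr)
    assume "direction_space G \<noteq> direction_space F"
    then obtain v where v: "v \<in> direction_space G" "n \<bullet> v \<noteq> 0"
      using only_degenerating_transversal[OF o F G(1) _ n(1) \<open>n \<noteq> 0\<close>] by metis
    have "\<forall>x\<in>G. \<forall>y\<in>G. n \<bullet> x = n \<bullet> y" using max_face_eq G(2) by blast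
    then show False using inner_const_iff_orthogonal_direction_space[of G n] v by blast
  qed
  then show "direction_space H = direction_space F" using H by blast
  have pM: "polytope ?M" using Mf P face_of_polytope_polytope by blast
  have "aff_dim ?M < 3"
  proof (rule ccontr)
    assume "\<not> ?thesis"
    then obtain G where G: "G \<in> two_faces ?M" "direction_space G \<noteq> direction_space F"
      using nonparallel_two_face[OF pM _ subspace_direction_space two_faceD(4)[OF F]] by force
    have "G \<in> two_faces P" "G \<subseteq> ?M"
      using G(1) face_of_trans[OF _ Mf] face_of_imp_subset by (auto simp: two_faces_def)
    then show False using par G(2) by blast
  qed
  moreover have "H face_of ?M"
    using face_of_subset[OF two_faceD(1)[OF H(1)] H(2) max_face_subset] .
  ultimately show "?M = H"
    using face_of_aff_dim_lt[OF polytope_imp_convex[OF pM], of H] two_faceD(2)[OF H(1)] by force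
qed

lemma simultaneously_visible_pair:
  assumes P: "polytope P" "aff_dim P \<ge> 3" and sv: "simultaneously_visible P F F'" and ne: "F' \<noteq> {}"
  obtains n where "max_face n P = F" "max_face (- n) P = F'"
    "\<And>H. H \<in> two_faces P \<Longrightarrow> direction_space H \<noteq> direction_space F \<Longrightarrow>
       \<exists>v\<in>direction_space H. n \<bullet> v \<noteq> 0"
proof -
  obtain W where par: "(F, F') \<in> parallel_rel P" and neq: "F \<noteq> F'"
    and o: "only_degenerating_class P F W" and vis: "visible P W F" "visible P W F'"
    using sv ne by (auto simp: simultaneously_visible_def)
  have F: "F \<in> two_faces P" and F': "F' \<in> two_faces P"
    and d: "direction_space F' = direction_space F" using par by (auto simp: parallel_rel_def)
  have pW: "plane W" and W: "subspace W" "dim W = 2"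
    using o by (auto simp: only_degenerating_class_def plane_def)
  have cP: "convex P" using P polytope_imp_convex by blast
  have ex: "\<exists>n\<in>W. n \<noteq> 0 \<and> max_face n P = G" if G: "G \<in> two_faces P" "visible P W G" for G
  proof -
    have Gf: "convex G" "G \<subseteq> P" "G \<noteq> {}"
      using two_faceD[OF G(1)] face_of_imp_convex face_of_imp_subset by blast+
    obtain n where n: "n \<in> W" "G \<subseteq> max_face n P" "max_face n P \<noteq> P"
      using visible_max_face[OF cP Gf(1,3,2) W(1) G(2)] by blast
    then have "n \<noteq> 0" by (auto simp: max_face_def)
    then show ?thesis
      using only_degenerating_max_face(1)[OF P(1) o F n(1,3) G(1) n(2)] n by blast
  qed
  obtain n where n: "n \<in> W" "n \<noteq> 0" "max_face n P = F" using ex F vis by blast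
  obtain n' where n': "n' \<in> W" "n' \<noteq> 0" "max_face n' P = F'" using ex F' vis by blast
  have orth: "n \<bullet> v = 0" "n' \<bullet> v = 0" if "v \<in> direction_space F" for v
    using that n(3) n'(3) d inner_const_iff_orthogonal_direction_space max_face_eq by metis+
  have "n' \<in> span {n}"
  proof (rule ccontr)
    assume "n' \<notin> span {n}"
    then have gv: "g \<bullet> v = 0" if "g \<in> W" "v \<in> direction_space F" for g v
      using span_pair_coords[OF W n(1) n'(1) n(2) _ that(1)] orth[OF that(2)]
      by (metis add_0 inner_add_left inner_scaleR_left mult_zero_right)
    have pF: "polytope F" using two_faceD(1)[OF F] P face_of_polytope_polytope by blast
    obtain a where "a extreme_point_of F" using vertex_exists[OF pF two_faceD(3)[OF F]] by blast
    then obtain e where e: "e face_of F" "aff_dim e = 1"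
      using face_of_intermediate_dim[OF pF, of "{a}" 1] two_faceD(2)[OF F] by (auto simp: face_of_singleton)
    then have ee: "e edge_of F" by (simp add: edge_of_def)
    then obtain p q where pq: "p \<noteq> q" "e = closed_segment p q" using edge_eq_segment[OF pF] by blast
    obtain H where H: "H \<in> two_faces P" "e \<subseteq> H" "direction_space H \<noteq> direction_space F"
      using edge_in_other_two_face[OF P F ee] .
    have "p \<in> e" "q \<in> e" using pq by auto
    then have "p - q \<in> direction_space H" "p - q \<in> direction_space F"
      using diff_in_direction_space H(2) face_of_imp_subset[OF e(1)] by blast+
    then have "degenerating W H"
      unfolding degenerating_iff[OF W(1) two_faceD(4)[OF H(1)]] using gv pq(1) by (metis right_minus_eq)
    then show False using only_degenerating_class_iff[OF o F H(1)] H(3) by blast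
  qed
  then obtain c where c: "n' = c *\<^sub>R n" by (auto simp: span_singleton)
  have "c < 0"
  proof (rule ccontr)
    assume "\<not> c < 0"
    then have "c > 0" using c n'(2) by (metis linorder_neqE_linordered_idom scaleR_zero_left)
    then show False using c n(3) n'(3) neq max_face_scaleR by metis
  qed
  then have "max_face (- n) P = F'"
    using c n'(3) max_face_scaleR[of "- c" "- n" P] by simp
  then show thesis
    using that[OF n(3)] only_degenerating_transversal[OF o F _ _ n(1,2)] by metis
qed

lemma simultaneously_visible_single:
  assumes P: "polytope P" "aff_dim P \<ge> 3" and sv: "simultaneously_visible P F {}"
  obtains n where "max_face n P = F" "aff_dim (max_face (- n) P) \<le> 1"
    "\<And>H. H \<in> two_faces P \<Longrightarrow> direction_space H \<noteq> direction_space F \<Longrightarrow>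
       \<exists>v\<in>direction_space H. n \<bullet> v \<noteq> 0"
proof -
  have "{} \<notin> two_faces P" by (auto simp: two_faces_def)
  then obtain W where F: "F \<in> two_faces P" and o: "only_degenerating_class P F W"
    and vis: "visible P W F"
    and only: "\<And>G. (F, G) \<in> parallel_rel P \<Longrightarrow> G \<noteq> F \<Longrightarrow> \<not> visible P W G"
    using sv by (auto simp: simultaneously_visible_def parallel_rel_def)
  have W: "subspace W"
    using o by (auto simp: only_degenerating_class_def plane_def)
  have cP: "convex P" using P polytope_imp_convex by blast
  have Ff: "convex F" "F \<subseteq> P" "F \<noteq> {}"
    using two_faceD[OF F] face_of_imp_convex face_of_imp_subset by blast+
  obtain n where n: "n \<in> W" "F \<subseteq> max_face n P" "max_face n P \<noteq> P"
    using visible_max_face[OF cP Ff(1,3,2) W vis] by blast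
  then have "n \<noteq> 0" by (auto simp: max_face_def)
  have nF: "max_face n P = F" 
    using only_degenerating_max_face(1)[OF P(1) o F n(1,3) F n(2)] .
  have mn: "- n \<in> W" using n(1) W by (rule subspace_neg[rotated])
  have disj: "F \<inter> max_face (- n) P = {}"
  proof (rule ccontr)
    assume "F \<inter> max_face (- n) P \<noteq> {}"
    then obtain x where "x \<in> max_face n P" "x \<in> max_face (-n) P" using nF by blast
    then have "\<forall>y\<in>P. n \<bullet> y = n \<bullet> x" by (force simp: max_face_def)
    then have "max_face n P = P" by (auto simp: max_face_def)
    then show False using n(3) by blast
  qed
  have mne: "max_face (- n) P \<noteq> P" using disj Ff by blast
  \<comment> \<open>A 2-face here would be parallel to \<open>F\<close> and visible in the same
    plane, contrary to \<open>F\<close> being seen alone.\<close>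
  have "aff_dim (max_face (- n) P) \<le> 1"
  proof (rule ccontr)
    assume "\<not> ?thesis"
    then have "aff_dim (max_face (- n) P) \<ge> 2" by simp
    then obtain H where H: "H \<in> two_faces P" "H \<subseteq> max_face (- n) P"
      using two_face_of_face[OF P(1) max_face_face_of[OF cP]] by blast
    have "direction_space H = direction_space F"
      using only_degenerating_max_face(2)[OF P(1) o F mn mne H] .
    then have "(F, H) \<in> parallel_rel P" using F H by (simp add: parallel_rel_def)
    moreover have "H \<noteq> F" using disj H(2) Ff by blast
    ultimately show False using only visible_of_max_face[OF cP W mn mne H(2)] by blast
  qed
  then show thesis
    using that[OF nF] only_degenerating_transversal[OF o F _ _ n(1) \<open>n \<noteq> 0\<close>] by metis
qed

section \<open>Visible vertices under a perturbation of the plane\<close>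

lemma aff_dim_nonneg: "x \<in> S \<Longrightarrow> aff_dim S \<ge> 0"
  by (metis aff_dim_negative_iff empty_iff not_less)

lemma max_face_singleton_subset:
  assumes "max_face f S = {x}" "x \<in> T" "T \<subseteq> S"
  shows "max_face f T = {x}"
proof (rule max_face_singletonI[OF assms(2)])
  fix y assume "y \<in> T" "y \<noteq> x"
  then show "f \<bullet> y < f \<bullet> x" using max_face_less[of x f S y] assms by auto
qed

lemma eventually_affine_nonzero:
  fixes a b :: real
  assumes "a \<noteq> 0 \<or> b \<noteq> 0"
  shows "\<forall>\<^sub>F t in at_right 0. a + t * b \<noteq> 0"
proof -
  consider "a < 0 \<or> a = 0 \<and> b < 0" | "0 < a \<or> 0 = a \<and> 0 < b"
    using assms by linarith
  then show ?thesis
  proof cases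
    case 1
    then have "\<forall>\<^sub>F t in at_right 0. a + t * b < 0 + t * 0" by (rule eventually_less_linear)
    then show ?thesis by eventually_elim auto
  next
    case 2
    then have "\<forall>\<^sub>F t in at_right 0. 0 + t * 0 < a + t * b" by (rule eventually_less_linear)
    then show ?thesis by eventually_elim auto
  qed
qed

lemma eventually_at_right_ex:
  assumes "\<forall>\<^sub>F t in at_right (0::real). P t"
  obtains t where "t > 0" "P t"
proof -
  have "\<forall>\<^sub>F t in at_right (0::real). t > 0 \<and> P t"
    using eventually_conj[OF eventually_at_right_less[of 0] assms] .
  then show thesis using that eventually_happens'[OF trivial_limit_at_right_real] by blast
qed

text \<open>Induction over \<open>S\<close>: a small multiple of the component of the new vector
  orthogonal to \<open>u\<close> repairs that vector without spoiling the finitely many old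
  ones.\<close>

lemma exists_orthogonal_nonvanishing:
  fixes u :: "'a::euclidean_space"
  assumes "finite S" "\<And>v. v \<in> S \<Longrightarrow> v \<notin> span {u}"
  obtains w where "w \<bullet> u = 0" "\<And>v. v \<in> S \<Longrightarrow> w \<bullet> v \<noteq> 0"
proof -
  have "\<exists>w. w \<bullet> u = 0 \<and> (\<forall>v\<in>S. w \<bullet> v \<noteq> 0)"
    using assms
  proof (induction S)
    case empty
    show ?case by (intro exI[of _ 0]) simp
  next
    case (insert v S)
    then obtain w where w: "w \<bullet> u = 0" "\<forall>v\<in>S. w \<bullet> v \<noteq> 0" by auto
    define p where "p = v - ((v \<bullet> u) / (u \<bullet> u)) *\<^sub>R u"
    have pu: "p \<bullet> u = 0" by (simp add: p_def inner_diff_left)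
    have "p \<noteq> 0" using insert.prems[of v] by (auto simp: p_def span_singleton)
    moreover have "p \<bullet> v = p \<bullet> p"
      using pu by (simp add: p_def inner_diff_right)
    ultimately have pv: "p \<bullet> v \<noteq> 0" by simp
    have "\<forall>\<^sub>F t in at_right 0. \<forall>v'\<in>insert v S. w \<bullet> v' + t * (p \<bullet> v') \<noteq> 0"
      using insert.hyps w pv
      by (intro eventually_ball_finite ballI eventually_affine_nonzero) auto
    then obtain t where "\<forall>v'\<in>insert v S. w \<bullet> v' + t * (p \<bullet> v') \<noteq> 0"
      by (rule eventually_at_right_ex)
    then show ?case
      using w(1) pu by (intro exI[of _ "w + t *\<^sub>R p"]) (simp add: inner_add_left)
  qed
  then show thesis using that by blast
qed

text \<open>Farkas' lemma at the point \<open>x\<close>. The hypothesis places \<open>u\<close>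
  outside the tangent cone, which is closed because finitely many vectors generate it, so a
  hyperplane separates \<open>u\<close> from the cone.\<close>

lemma exists_functional_not_in_cone:
  assumes F: "polytope F" "x \<in> F" and u: "\<not> (\<exists>s>0. x + s *\<^sub>R u \<in> F)"
  obtains f where "f \<bullet> u > 0" "x \<in> max_face f F"
proof -
  define V where "V = {y. y extreme_point_of F}"
  let ?V = "(+) (- x) ` V"
  let ?K = "convex_cone hull ?V"
  have FV: "F = convex hull V" unfolding V_def using polytope_eq_hull_vertices[OF F(1)] .
  have hull: "convex hull ?V = (+) (- x) ` F"
    using convex_hull_translation[of "- x" V] FV by simp
  have "V \<noteq> {}" using FV F(2) by auto
  have "u \<notin> ?K"
  proof
    assume "u \<in> ?K"
    then obtain z c where z: "z \<in> convex hull ?V" "c \<ge> 0" "u = c *\<^sub>R z"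
      using convex_cone_hull_convex_hull_nonempty[of ?V] \<open>V \<noteq> {}\<close> by auto
    then obtain y where y: "y \<in> F" "z = - x + y" using hull by auto
    show False
    proof (cases "c = 0")
      case True
      then have "x + 1 *\<^sub>R u \<in> F" using z F by simp
      then show False using u zero_less_one by blast
    next
      case False
      then have "x + (1 / c) *\<^sub>R u = y" using z y by simp
      then show False using u y z(2) False by (metis zero_less_divide_1_iff order_le_less)
    qed
  qed
  moreover have "closed ?K"
    using finite_vertices[OF F(1)] by (simp add: closed_convex_cone_hull V_def)
  ultimately obtain a b where ab: "a \<bullet> u < b" "\<And>z. z \<in> ?K \<Longrightarrow> a \<bullet> z > b"
    using separating_hyperplane_closed_point[OF convex_convex_cone_hull] by metis
  have "b < 0" using ab(2)[OF convex_cone_hull_contains_0] by simp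
  \<comment> \<open>A separating functional is nonnegative on the cone: a negative value could be
    rescaled to exactly \<open>b\<close>, which the separation forbids.\<close>
  have pos: "a \<bullet> z \<ge> 0" if z: "z \<in> ?K" for z
  proof (rule ccontr)
    assume neg: "\<not> a \<bullet> z \<ge> 0"
    then have "b / (a \<bullet> z) \<ge> 0" using \<open>b < 0\<close> by (simp add: divide_nonpos_nonpos)
    then have "a \<bullet> ((b / (a \<bullet> z)) *\<^sub>R z) > b"
      using ab(2) convex_cone_hull_mul[OF z] by blast
    then show False using neg by simp
  qed
  have "x \<in> max_face (- a) F"
  proof (rule max_faceI[OF F(2)])
    fix y assume "y \<in> F"
    then have "- x + y \<in> ?K" using hull convex_hull_subset_convex_cone_hull[of ?V] by blast
    then have "a \<bullet> (- x + y) \<ge> 0" by (rule pos)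
    then show "- a \<bullet> y \<le> - a \<bullet> x" by (simp add: inner_diff_right)
  qed
  moreover have "- a \<bullet> u > 0" using ab(1) \<open>b < 0\<close> by simp
  ultimately show thesis using that by blast
qed

lemma vertex_eq_max_face:
  assumes "polytope F" "x extreme_point_of F"
  obtains f where "max_face f F = {x}"
  using face_of_polytope_eq_max_face[OF assms(1), of "{x}"] assms(2) by (auto simp: face_of_singleton)

lemma span_pairE:
  assumes "g \<in> span {a, b}"
  obtains \<alpha> \<beta> where "g = \<alpha> *\<^sub>R a + \<beta> *\<^sub>R b"
proof -
  obtain \<alpha> where "g - \<alpha> *\<^sub>R a \<in> span {b}" using assms span_breakdown_eq by blast
  then obtain \<beta> where "g - \<alpha> *\<^sub>R a = \<beta> *\<^sub>R b" by (auto simp: span_singleton)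
  then show thesis using that[of \<alpha> \<beta>] by (simp add: algebra_simps)
qed

lemma span_pairI: "\<alpha> *\<^sub>R a + \<beta> *\<^sub>R b \<in> span {a, b}"
  by (intro span_add span_scale span_base) auto

text \<open>For small \<open>t > 0\<close> a functional of the turned plane exposing a vertex \<open>x\<close> of \<open>F\<close> is essentially
  \<open>n + t h\<close> with \<open>h \<bullet> u > 0\<close>, where \<open>h\<close> exposes \<open>x\<close> in \<open>F\<close>; by Farkas such an \<open>h\<close> exists iff \<open>u\<close> is not
  in the tangent cone of \<open>F\<close> at \<open>x\<close>.\<close>

lemma vis_exposed_face:
  assumes P: "polytope P" and nF: "max_face n P = F" "F \<noteq> P" and d: "dim (direction_space F) = 2"
    and u: "u \<in> direction_space F" "u \<noteq> 0" "w \<bullet> u = 0"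
    and v0: "v0 \<in> direction_space F" "w \<bullet> v0 \<noteq> 0"
    and edges: "\<And>e. e edge_of F \<Longrightarrow> u \<notin> direction_space e"
    and x: "x extreme_point_of F"
  shows "\<forall>\<^sub>F t in at_right 0. x \<in> vis P (span {n + t *\<^sub>R u, w}) \<longleftrightarrow> \<not> (\<exists>s>0. x + s *\<^sub>R u \<in> F)"
proof (cases "\<exists>s>0. x + s *\<^sub>R u \<in> F")
  case False
  have Ff: "F face_of P" using max_face_face_of nF P polytope_imp_convex by blast
  have pF: "polytope F" using Ff P face_of_polytope_polytope by blast
  have xF: "x \<in> F" using x vertex_in by blast
  have "v0 \<notin> span {u}" using v0 u by (auto simp: span_singleton)
  obtain f where f: "f \<bullet> u > 0" "x \<in> max_face f F"
    using exists_functional_not_in_cone[OF pF xF False] by blast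
  obtain f0 where f0: "max_face f0 F = {x}" using vertex_eq_max_face[OF pF x] .
  have "max_face f0 (max_face f F) = {x}"
    using max_face_singleton_subset[OF f0 f(2) max_face_subset] .
  then have "\<forall>\<^sub>F t in at_right 0. max_face (f + t *\<^sub>R f0) F = {x}"
    using max_face_perturb[OF pF, of f f0] by simp
  moreover have "\<forall>\<^sub>F t in at_right 0. 0 + t * 0 < f \<bullet> u + t * (f0 \<bullet> u)"
    using f(1) by (intro eventually_less_linear) auto
  ultimately have "\<forall>\<^sub>F t in at_right 0. max_face (f + t *\<^sub>R f0) F = {x} \<and> (f + t *\<^sub>R f0) \<bullet> u > 0"
    by eventually_elim (simp add: inner_add_left)
  then obtain t where "max_face (f + t *\<^sub>R f0) F = {x} \<and> (f + t *\<^sub>R f0) \<bullet> u > 0"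
    by (rule eventually_at_right_ex)
  then obtain h where h: "max_face h F = {x}" "h \<bullet> u > 0" by blast
  \<comment> \<open>The constants are solved from the values of \<open>h\<close> at \<open>u\<close>
    and at \<open>v0\<close>, so that \<open>c\<close> times \<open>g\<close> agrees with
    \<open>h\<close> on the directions of \<open>F\<close>; orthogonality of \<open>w\<close> and
    \<open>u\<close> decouples the two equations.\<close>
  define c where "c = (h \<bullet> u) / (u \<bullet> u)"
  have c: "c > 0" using h(2) u(2) by (simp add: c_def)
  define \<beta> where "\<beta> = ((h - c *\<^sub>R u) \<bullet> v0) / (c * (w \<bullet> v0))"
  define g where "g = u + \<beta> *\<^sub>R w"
  have gh: "h \<bullet> v = c * (g \<bullet> v)" if v: "v \<in> direction_space F" for v
  proof -
    obtain a b where ab: "v = a *\<^sub>R u + b *\<^sub>R v0"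
      using span_pair_coords[OF subspace_direction_space d u(1) v0(1) u(2) \<open>v0 \<notin> span {u}\<close> v] .
    have "h \<bullet> u = c * (g \<bullet> u)" using u by (simp add: g_def c_def inner_add_left)
    moreover have "h \<bullet> v0 = c * (g \<bullet> v0)"
      using c v0(2) by (simp add: g_def \<beta>_def inner_add_left inner_diff_left field_simps)
    ultimately show ?thesis by (simp add: ab inner_add_right algebra_simps)
  qed
  have "max_face g F = {x}"
  proof (rule max_face_singletonI[OF xF])
    fix y assume y: "y \<in> F" "y \<noteq> x"
    then have "h \<bullet> y < h \<bullet> x" using max_face_less[of x h F y] h by simp
    then have "h \<bullet> (y - x) < 0" by (simp add: inner_diff_right)
    then have "g \<bullet> (y - x) < 0"
      using gh[OF diff_in_direction_space[OF y(1) xF]] c by (simp add: mult_less_0_iff)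
    then show "g \<bullet> y < g \<bullet> x" by (simp add: inner_diff_right)
  qed
  then have "\<forall>\<^sub>F t in at_right 0. max_face (n + t *\<^sub>R g) P = {x}"
    using max_face_perturb[OF P, of n g] nF by simp
  then show ?thesis
  proof eventually_elim
    case (elim t)
    have "n + t *\<^sub>R g = 1 *\<^sub>R (n + t *\<^sub>R u) + (t * \<beta>) *\<^sub>R w"
      by (simp add: g_def algebra_simps)
    then have "n + t *\<^sub>R g \<in> span {n + t *\<^sub>R u, w}" using span_pairI by metis
    then show ?case using elim False by (auto simp: vis_def)
  qed
next
  case True
  then obtain s where s: "s > 0" "x + s *\<^sub>R u \<in> F" by blast
  have cP: "convex P" using P polytope_imp_convex by blast
  have Ff: "F face_of P" using max_face_face_of nF cP by blast
  then have cF: "convex F" using face_of_imp_convex by blast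
  have FP: "F \<subseteq> P" using Ff face_of_imp_subset by blast
  have xF: "x \<in> F" using x vertex_in by blast
  have "F \<noteq> {}" using xF by blast
  then have aF: "aff_dim F = 2" using dim_direction_space[of F] d by simp
  \<comment> \<open>If \<open>x\<close> maximised \<open>w'\<close> over \<open>F\<close>, so would
    the point reached along \<open>u\<close>, and the maximal face would be an edge in direction
    \<open>u\<close>, which is excluded. Used for \<open>w\<close> and \<open>- w\<close>, this
    gives points of \<open>F\<close> strictly on both sides of \<open>x\<close>.\<close>
  have beyond: "\<exists>y\<in>F. w' \<bullet> x < w' \<bullet> y" if w': "w' \<bullet> u = 0" "w' \<bullet> v0 \<noteq> 0" for w'
  proof (rule ccontr)
    assume "\<not> ?thesis"
    then have xM: "x \<in> max_face w' F" (is "_ \<in> ?M") using xF by (auto simp: max_face_def)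
    then have yM: "x + s *\<^sub>R u \<in> ?M" using in_max_face_iff[OF xM s(2)] w' by (simp add: inner_add_right)
    have Mf: "?M face_of F" using max_face_face_of[OF cF] .
    have "?M \<noteq> F"
    proof
      assume "?M = F"
      then have "\<forall>x\<in>F. \<forall>y\<in>F. w' \<bullet> x = w' \<bullet> y" using max_face_eq by metis
      then show False using inner_const_iff_orthogonal_direction_space[of F w'] v0 w' by blast
    qed
    then have "aff_dim ?M < 2" using face_of_aff_dim_lt[OF cF Mf] aF by simp
    moreover have "aff_dim ?M \<ge> 0" using xM by (rule aff_dim_nonneg)
    moreover have "aff_dim ?M \<noteq> 0"
    proof
      assume "aff_dim ?M = 0"
      then obtain a where "?M = {a}" by (auto simp: aff_dim_eq_0)
      then have "x = x + s *\<^sub>R u" using xM yM by auto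
      then show False using s u by simp
    qed
    ultimately have "?M edge_of F" using Mf by (simp add: edge_of_def)
    moreover have "(1 / s) *\<^sub>R ((x + s *\<^sub>R u) - x) \<in> direction_space ?M"
      by (intro subspace_scale subspace_direction_space diff_in_direction_space xM yM)
    ultimately show False using edges[of ?M] s(1) by simp
  qed
  obtain y2 where y2: "y2 \<in> F" "w \<bullet> x < w \<bullet> y2" using beyond[of w] u v0 by blast
  obtain y1 where y1: "y1 \<in> F" "w \<bullet> y1 < w \<bullet> x" using beyond[of "- w"] u v0 by auto
  obtain z where z: "z \<in> P" "z \<notin> F" using FP nF(2) by blast
  have nz: "n \<bullet> z < n \<bullet> x" using max_face_less[of x n P z] xF z nF by blast
  \<comment> \<open>A functional exposing \<open>x\<close> would have a negative coefficient
    \<alpha> at \<open>n\<close>. After division by \<open>- \<alpha>\<close>, the points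
    \<open>y1\<close> and \<open>y2\<close> bound the coefficient of \<open>w\<close> by
    \<open>t * B\<close>, while \<open>z\<close> lies at depth \<delta> below \<open>F\<close>; for
    small \<open>t\<close> these facts contradict each other.\<close>
  define B where "B = \<bar>(u \<bullet> (y1 - x)) / (w \<bullet> (y1 - x))\<bar> + \<bar>(u \<bullet> (y2 - x)) / (w \<bullet> (y2 - x))\<bar>"
  define \<delta> where "\<delta> = n \<bullet> x - n \<bullet> z"
  have "\<forall>\<^sub>F t in at_right 0. 0 + t * (\<bar>u \<bullet> (z - x)\<bar> + \<bar>w \<bullet> (z - x)\<bar> * B) < \<delta> + t * 0"
    using nz by (intro eventually_less_linear) (simp add: \<delta>_def)
  moreover have "\<forall>\<^sub>F t in at_right (0::real). 0 < t" by (rule eventually_at_right_less)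
  ultimately show ?thesis
  proof eventually_elim
    case (elim t)
    have "x \<notin> vis P (span {n + t *\<^sub>R u, w})"
    proof
      assume "x \<in> vis P (span {n + t *\<^sub>R u, w})"
      then obtain g where g: "g \<in> span {n + t *\<^sub>R u, w}" "max_face g P = {x}" by (auto simp: vis_def)
      from g(1) obtain \<alpha> \<beta> where gab: "g = \<alpha> *\<^sub>R (n + t *\<^sub>R u) + \<beta> *\<^sub>R w"
        by (rule span_pairE)
      have less: "\<alpha> * (n \<bullet> (y - x)) + \<alpha> * (t * (u \<bullet> (y - x))) + \<beta> * (w \<bullet> (y - x)) < 0"
        if "y \<in> P" "y \<noteq> x" for y
      proof -
        have "g \<bullet> y < g \<bullet> x" using max_face_less[of x g P y] g that by simp
        then have "g \<bullet> (y - x) < 0" by (simp add: inner_diff_right)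
        then show ?thesis by (simp add: gab inner_add_left algebra_simps)
      qed
      have nF0: "n \<bullet> (y - x) = 0" if "y \<in> F" for y
        using that xF nF max_face_eq[of x n P y] by (simp add: inner_diff_right)
      have "s *\<^sub>R u \<noteq> 0" using s u by simp
      then have "\<alpha> * (t * (s * (u \<bullet> u))) < 0"
        using less[of "x + s *\<^sub>R u"] s FP nF0[OF s(2)] u by (auto simp: subset_eq)
      moreover have "t * (s * (u \<bullet> u)) > 0" using elim(2) s u by simp
      ultimately have \<alpha>: "\<alpha> < 0" using mult_less_0_iff order_less_asym by metis
      define b where "b = \<beta> / (- \<alpha>)"
      have less': "b * (w \<bullet> (y - x)) < n \<bullet> (y - x) + t * (u \<bullet> (y - x))" if "y \<in> P" "y \<noteq> x" for y
        using less[OF that] \<alpha> by (simp add: b_def field_simps)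
      have b2: "b < t * ((u \<bullet> (y2 - x)) / (w \<bullet> (y2 - x)))"
      proof -
        have "w \<bullet> (y2 - x) > 0" using y2 by (simp add: inner_diff_right)
        moreover have "b * (w \<bullet> (y2 - x)) < t * (u \<bullet> (y2 - x))"
          using less'[of y2] y2 nF0[OF y2(1)] FP by auto
        ultimately show ?thesis by (simp add: field_simps)
      qed
      have b1: "t * ((u \<bullet> (y1 - x)) / (w \<bullet> (y1 - x))) < b"
      proof -
        have "w \<bullet> (y1 - x) < 0" using y1 by (simp add: inner_diff_right)
        moreover have "b * (w \<bullet> (y1 - x)) < t * (u \<bullet> (y1 - x))"
          using less'[of y1] y1 nF0[OF y1(1)] FP by auto
        ultimately show ?thesis by (simp add: field_simps)
      qed
      have "\<bar>b\<bar> \<le> t * B"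
      proof -
        let ?p1 = "(u \<bullet> (y1 - x)) / (w \<bullet> (y1 - x))" and ?p2 = "(u \<bullet> (y2 - x)) / (w \<bullet> (y2 - x))"
        have "?p2 \<le> B" "- ?p1 \<le> B" unfolding B_def by linarith+
        then have "t * ?p2 \<le> t * B" "t * (- ?p1) \<le> t * B"
          using mult_left_mono[OF _ less_imp_le[OF elim(2)]] by blast+
        then show ?thesis using b1 b2 by (auto simp: abs_le_iff)
      qed
      then have "\<bar>b * (w \<bullet> (z - x))\<bar> \<le> t * B * \<bar>w \<bullet> (z - x)\<bar>"
        by (simp add: abs_mult mult_right_mono)
      moreover have "t * (u \<bullet> (z - x)) \<le> t * \<bar>u \<bullet> (z - x)\<bar>"
        using elim(2) by (intro mult_left_mono) auto
      moreover have "b * (w \<bullet> (z - x)) < - \<delta> + t * (u \<bullet> (z - x))"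
        using less'[of z] z xF by (auto simp: \<delta>_def inner_diff_right)
      ultimately have "\<delta> < t * \<bar>u \<bullet> (z - x)\<bar> + t * B * \<bar>w \<bullet> (z - x)\<bar>" by linarith
      then show False using elim(1) by (simp add: algebra_simps)
    qed
    then show ?case using True by blast
  qed
qed

text \<open>Visibility of \<open>x\<close> is delicate only if the unperturbed plane supports
  \<open>P\<close> at \<open>x\<close> without exposing it. By the hypotheses the supporting face
  would then be an edge not orthogonal to the plane, and tilting inside the plane would expose
  \<open>x\<close> after all. So either \<open>x\<close> is exposed, which survives small changes,
  or no nontrivial combination of \<open>n\<close> and \<open>w\<close> is maximal at
  \<open>x\<close>, which survives by compactness.\<close>

lemma vis_perturb_cong:
  assumes P: "polytope P" and x: "x extreme_point_of P"
    and dim1: "\<And>\<alpha> \<beta>. (\<alpha>, \<beta>) \<noteq> (0, 0) \<Longrightarrow> x \<in> max_face (\<alpha> *\<^sub>R n + \<beta> *\<^sub>R w) P \<Longrightarrow>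
        aff_dim (max_face (\<alpha> *\<^sub>R n + \<beta> *\<^sub>R w) P) \<le> 1"
    and edges: "\<And>e. e edge_of P \<Longrightarrow> \<exists>v\<in>direction_space e. n \<bullet> v \<noteq> 0 \<or> w \<bullet> v \<noteq> 0"
  shows "\<forall>\<^sub>F t in at_right 0. x \<in> vis P (span {n + t *\<^sub>R u, w}) \<longleftrightarrow> x \<in> vis P (span {n + t *\<^sub>R (- u), w})"
proof (cases "x \<in> vis P (span {n, w})")
  case True
  then obtain g where gs: "g \<in> span {n, w}" and g: "max_face g P = {x}" by (auto simp: vis_def)
  from gs obtain \<alpha> \<beta> where gab: "g = \<alpha> *\<^sub>R n + \<beta> *\<^sub>R w" by (rule span_pairE)
  have *: "\<forall>\<^sub>F t in at_right 0. x \<in> vis P (span {n + t *\<^sub>R u', w})" for u'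
  proof -
    have "max_face (\<alpha> *\<^sub>R u') (max_face g P) = {x}" unfolding g by (auto simp: max_face_def)
    then have "\<forall>\<^sub>F t in at_right 0. max_face (g + t *\<^sub>R (\<alpha> *\<^sub>R u')) P = {x}"
      using max_face_perturb[OF P, of g "\<alpha> *\<^sub>R u'"] by metis
    then show ?thesis
    proof eventually_elim
      case (elim t)
      have "g + t *\<^sub>R (\<alpha> *\<^sub>R u') = \<alpha> *\<^sub>R (n + t *\<^sub>R u') + \<beta> *\<^sub>R w"
        by (simp add: gab algebra_simps)
      then have "g + t *\<^sub>R (\<alpha> *\<^sub>R u') \<in> span {n + t *\<^sub>R u', w}" using span_pairI by metis
      then show ?case using elim by (auto simp: vis_def)
    qed
  qed
  from *[of u] *[of "- u"] show ?thesis by eventually_elim simp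
next
  case False
  have cP: "convex P" using P polytope_imp_convex by blast
  define V where "V = {y. y extreme_point_of P}"
  have finV: "finite V" unfolding V_def by (rule finite_vertices[OF P])
  have xP: "x \<in> P" using x vertex_in by blast
  have notmax: "x \<notin> max_face (\<alpha> *\<^sub>R n + \<beta> *\<^sub>R w) P" (is "_ \<notin> ?M") if ab: "(\<alpha>, \<beta>) \<noteq> (0, 0)" for \<alpha> \<beta>
  proof
    assume xM: "x \<in> ?M"
    have Mf: "?M face_of P" using max_face_face_of[OF cP] .
    have "aff_dim ?M \<le> 1" using dim1[OF ab xM] .
    moreover have "aff_dim ?M \<ge> 0" using xM by (rule aff_dim_nonneg)
    moreover have "aff_dim ?M \<noteq> 0"
    proof
      assume "aff_dim ?M = 0"
      then have "?M = {x}" using xM by (auto simp: aff_dim_eq_0)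
      then show False using False span_pairI[of \<alpha> n \<beta> w] by (auto simp: vis_def)
    qed
    ultimately have "?M edge_of P" using Mf by (simp add: edge_of_def)
    then obtain v where v: "v \<in> direction_space ?M" "n \<bullet> v \<noteq> 0 \<or> w \<bullet> v \<noteq> 0" using edges by blast
    obtain p q where pq: "?M = closed_segment p q"
      using edge_eq_segment[OF P \<open>?M edge_of P\<close>] by blast
    have "x extreme_point_of ?M" using extreme_point_of_face[OF Mf] x xM by blast
    then have "x = p \<or> x = q" using pq extreme_point_of_segment by metis
    then obtain y where My: "?M = closed_segment x y" using pq closed_segment_commute by metis
    then have "v \<in> span {y - x}" using v(1) direction_space_segment by metis
    then obtain c where "v = c *\<^sub>R (y - x)" by (auto simp: span_singleton)
    \<comment> \<open>One of the four signed generators decreases along the edge away from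
      \<open>x\<close>; adding a little of it cuts the edge down to \<open>x\<close>.\<close>
    then obtain g where g: "g \<in> {n, w, - n, - w}" "g \<bullet> (y - x) < 0"
      using v(2) by (metis insertCI inner_minus_left inner_scaleR_right linorder_less_linear mult_zero_right neg_less_0_iff_less)
    have "max_face g ?M = {x}"
    proof (rule max_face_singletonI[OF xM])
      fix z assume "z \<in> ?M" "z \<noteq> x"
      then obtain r where r: "0 \<le> r" "z = x + r *\<^sub>R (y - x)"
        unfolding My closed_segment_def by (auto simp: algebra_simps)
      then have "r > 0" using \<open>z \<noteq> x\<close> by (cases "r = 0") auto
      then show "g \<bullet> z < g \<bullet> x" using g(2) r by (simp add: inner_add_right mult_pos_neg)
    qed
    then have "\<forall>\<^sub>F t in at_right 0. max_face ((\<alpha> *\<^sub>R n + \<beta> *\<^sub>R w) + t *\<^sub>R g) P = {x}"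
      using max_face_perturb[OF P, of "\<alpha> *\<^sub>R n + \<beta> *\<^sub>R w" g] by simp
    then obtain t where t: "max_face ((\<alpha> *\<^sub>R n + \<beta> *\<^sub>R w) + t *\<^sub>R g) P = {x}"
      by (rule eventually_at_right_ex)
    have "g \<in> span {n, w}" using g(1) by (auto intro: span_base span_neg)
    then have "(\<alpha> *\<^sub>R n + \<beta> *\<^sub>R w) + t *\<^sub>R g \<in> span {n, w}"
      by (intro span_add[OF span_pairI] span_scale)
    then show False using False t by (auto simp: vis_def)
  qed
  \<comment> \<open>The total amount by which vertices beat \<open>x\<close>, as a function of the
    coefficients. It is positive on the unit circle, and its minimum divided by the number of
    vertices is a margin \<epsilon> that some single vertex always attains.\<close>
  define \<phi> where "\<phi> = (\<lambda>a::real \<times> real. \<Sum>z\<in>V. max 0 (fst a * (n \<bullet> (z - x)) + snd a * (w \<bullet> (z - x))))"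
  have "continuous_on (sphere 0 1) \<phi>" unfolding \<phi>_def by (intro continuous_intros)
  moreover have "sphere (0 :: real \<times> real) 1 \<noteq> {}" by simp
  ultimately obtain a0 where a0: "a0 \<in> sphere 0 1" "\<And>a. a \<in> sphere 0 1 \<Longrightarrow> \<phi> a0 \<le> \<phi> a"
    using continuous_attains_inf[OF compact_sphere] by metis
  have ex: "\<exists>z\<in>V. 0 < fst a * (n \<bullet> (z - x)) + snd a * (w \<bullet> (z - x))" if "a \<noteq> 0" for a
  proof -
    have "(fst a, snd a) \<noteq> (0, 0)" using that by (simp add: zero_prod_def)
    note nm = notmax[OF this]
    have "\<not> (\<forall>z\<in>V. (fst a *\<^sub>R n + snd a *\<^sub>R w) \<bullet> z \<le> (fst a *\<^sub>R n + snd a *\<^sub>R w) \<bullet> x)"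
      using nm unfolding vertex_in_max_face_iff[OF P x] V_def by simp
    then obtain z where "z \<in> V" "(fst a *\<^sub>R n + snd a *\<^sub>R w) \<bullet> (z - x) > 0"
      by (auto simp: inner_diff_right not_le)
    then show ?thesis by (auto simp: inner_add_left)
  qed
  have "a0 \<noteq> 0" using a0(1) by auto
  then obtain z0 where z0: "z0 \<in> V" "0 < fst a0 * (n \<bullet> (z0 - x)) + snd a0 * (w \<bullet> (z0 - x))"
    using ex by blast
  have "\<phi> a0 > 0"
    unfolding \<phi>_def using z0 finV by (intro sum_pos2[of V z0]) auto
  define \<epsilon> where "\<epsilon> = \<phi> a0 / card V"
  have "card V > 0" using z0(1) finV card_gt_0_iff by blast
  then have "\<epsilon> > 0" using \<open>\<phi> a0 > 0\<close> by (simp add: \<epsilon>_def)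
  have big: "\<exists>z\<in>V. \<epsilon> * norm a \<le> fst a * (n \<bullet> (z - x)) + snd a * (w \<bullet> (z - x))" if "a \<noteq> 0" for a
  proof (rule ccontr)
    assume *: "\<not> ?thesis"
    define r where "r = norm a"
    have r: "r > 0" using that by (simp add: r_def)
    define a' where "a' = (1 / r) *\<^sub>R a"
    have "a' \<in> sphere 0 1" using r by (simp add: a'_def r_def)
    have lt: "max 0 (fst a' * (n \<bullet> (z - x)) + snd a' * (w \<bullet> (z - x))) < \<epsilon>" if "z \<in> V" for z
    proof -
      have "fst a * (n \<bullet> (z - x)) + snd a * (w \<bullet> (z - x)) < \<epsilon> * r"
        using * that r_def by (meson not_le)
      then have "(fst a * (n \<bullet> (z - x)) + snd a * (w \<bullet> (z - x))) / r < \<epsilon>"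
        using r by (simp add: divide_less_eq)
      then show ?thesis using \<open>\<epsilon> > 0\<close> by (simp add: a'_def add_divide_distrib)
    qed
    have "\<phi> a' < (\<Sum>z\<in>V. \<epsilon>)"
      unfolding \<phi>_def using lt finV z0(1) by (intro sum_strict_mono) auto
    also have "\<dots> = \<phi> a0" using \<open>card V > 0\<close> by (simp add: \<epsilon>_def)
    finally show False using a0(2)[OF \<open>a' \<in> sphere 0 1\<close>] by simp
  qed
  \<comment> \<open>Replacing \<open>n\<close> by its perturbation alters each comparison with
    \<open>x\<close> by at most \<bar>\<tau>\<bar> times \<open>C\<close> times the norm of the
    coefficients, which is below the margin. Both signs of \<tau> are needed later.\<close>
  define C where "C = (\<Sum>z\<in>V. \<bar>u \<bullet> (z - x)\<bar>)"
  have Cz: "\<bar>u \<bullet> (z - x)\<bar> \<le> C" if "z \<in> V" for z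
    unfolding C_def using finV that by (intro member_le_sum) auto
  have none: "x \<notin> vis P (span {n + \<tau> *\<^sub>R u, w})" if \<tau>: "\<bar>\<tau>\<bar> * C < \<epsilon>" for \<tau>
  proof
    assume "x \<in> vis P (span {n + \<tau> *\<^sub>R u, w})"
    then obtain g where g: "g \<in> span {n + \<tau> *\<^sub>R u, w}" "max_face g P = {x}" by (auto simp: vis_def)
    from g(1) obtain \<alpha> \<beta> where gab: "g = \<alpha> *\<^sub>R (n + \<tau> *\<^sub>R u) + \<beta> *\<^sub>R w"
      by (rule span_pairE)
    have "(\<alpha>, \<beta>) \<noteq> 0"
    proof
      assume "(\<alpha>, \<beta>) = 0"
      then have "max_face (0 *\<^sub>R n + 0 *\<^sub>R w) P = {x}" using g(2) gab by (simp add: zero_prod_def)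
      then show False using False span_pairI[of 0 n 0 w] by (auto simp: vis_def)
    qed
    then obtain z where z: "z \<in> V" "\<epsilon> * norm (\<alpha>, \<beta>) \<le> \<alpha> * (n \<bullet> (z - x)) + \<beta> * (w \<bullet> (z - x))"
      using big by force
    have np: "norm (\<alpha>, \<beta>) > 0" using \<open>(\<alpha>, \<beta>) \<noteq> 0\<close> by simp
    have "g \<bullet> z \<le> g \<bullet> x" using max_face_le[of x g P z] g(2) z(1) vertex_in V_def by blast
    then have "g \<bullet> (z - x) \<le> 0" by (simp add: inner_diff_right)
    then have "\<alpha> * (n \<bullet> (z - x)) + \<beta> * (w \<bullet> (z - x)) \<le> - (\<alpha> * (\<tau> * (u \<bullet> (z - x))))"
      by (simp add: gab inner_add_left algebra_simps)
    also have "\<dots> \<le> \<bar>\<alpha>\<bar> * (\<bar>\<tau>\<bar> * \<bar>u \<bullet> (z - x)\<bar>)" by (metis abs_ge_minus_self abs_mult)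
    also have "\<dots> \<le> norm (\<alpha>, \<beta>) * (\<bar>\<tau>\<bar> * C)"
      using norm_fst_le[of \<alpha> \<beta>] Cz[OF z(1)] by (intro mult_mono) auto
    also have "\<dots> < norm (\<alpha>, \<beta>) * \<epsilon>" using np \<tau> by simp
    finally show False using z(2) by (simp add: mult.commute)
  qed
  have "\<forall>\<^sub>F t in at_right 0. 0 + t * C < \<epsilon> + t * 0"
    using \<open>\<epsilon> > 0\<close> by (intro eventually_less_linear) simp
  moreover have "\<forall>\<^sub>F t in at_right (0::real). 0 < t" by (rule eventually_at_right_less)
  ultimately show ?thesis
  proof eventually_elim
    case (elim t)
    then show ?case using none[of t] none[of "- t"] by simp
  qed
qed

text \<open>Vertices whose tangent cone misses \<open>u\<close>. For a polygon and a
  \<open>u\<close> not parallel to an edge, this is the far chain of the boundary as seen in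
  direction \<open>u\<close>, with both its ends.\<close>

definition exits :: "'a::euclidean_space set \<Rightarrow> 'a \<Rightarrow> 'a set" where
  "exits F u = {x. x extreme_point_of F \<and> \<not> (\<exists>s>0. x + s *\<^sub>R u \<in> F)}"

lemma span_singleton_sym:
  assumes "v \<in> span {u}" "v \<noteq> (0::'a::real_vector)"
  shows "u \<in> span {v}"
proof -
  obtain c where c: "v = c *\<^sub>R u" using assms(1) by (auto simp: span_singleton)
  then have "u = (1 / c) *\<^sub>R v" using assms(2) by auto
  then show ?thesis by (metis rangeI span_singleton)
qed

lemma span_minus_pair: "span {- a, b} = span {a, b::'a::real_vector}"
proof
  show "span {- a, b} \<subseteq> span {a, b}"
    by (rule span_minimal) (auto intro: span_neg span_base)
  have "- (- a) \<in> span {- a, b}" by (intro span_neg span_base) simp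
  then show "span {a, b} \<subseteq> span {- a, b}"
    by (intro span_minimal) (auto intro: span_base)
qed

section \<open>Transversality of planes close to the exposing functional\<close>

lemma two_face_normal_section:
  assumes H: "H \<in> two_faces P" and ex: "\<exists>v\<in>direction_space H. n \<bullet> v \<noteq> 0"
  obtains v v1 where "v \<noteq> 0" "v \<in> direction_space H" "n \<bullet> v = 0" "v1 \<in> direction_space H" "n \<bullet> v1 \<noteq> 0"
    "\<And>x. x \<in> direction_space H \<Longrightarrow> \<exists>a b. x = a *\<^sub>R v1 + b *\<^sub>R v"
proof -
  let ?D = "direction_space H"
  have d: "dim ?D = 2" using two_faceD[OF H] by blast
  obtain v1 where v1: "v1 \<in> ?D" "n \<bullet> v1 \<noteq> 0" using ex by blast
  then have "v1 \<noteq> 0" by auto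
  obtain v2 where v2: "v2 \<in> ?D" "v2 \<notin> span {v1}" using dim_2_not_in_span_singleton[OF d] .
  define v where "v = v2 - ((n \<bullet> v2) / (n \<bullet> v1)) *\<^sub>R v1"
  have v: "v \<in> ?D"
    unfolding v_def by (intro subspace_diff subspace_scale subspace_direction_space v1 v2)
  have "v \<notin> span {v1}"
  proof
    assume "v \<in> span {v1}"
    then have "v + ((n \<bullet> v2) / (n \<bullet> v1)) *\<^sub>R v1 \<in> span {v1}"
      by (rule span_add) (simp add: span_scale span_base)
    then show False using v2(2) by (simp add: v_def)
  qed
  then have "v \<noteq> 0" using span_zero by metis
  moreover have "n \<bullet> v = 0" using v1(2) by (simp add: v_def inner_diff_right)
  moreover have "\<exists>a b. x = a *\<^sub>R v1 + b *\<^sub>R v" if "x \<in> ?D" for x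
    using span_pair_coords[OF subspace_direction_space d v1(1) v \<open>v1 \<noteq> 0\<close> \<open>v \<notin> span {v1}\<close> that] by metis
  ultimately show thesis using that v v1 by blast
qed

text \<open>On the directions of \<open>H\<close> the kernel of \<open>w\<close> is the line through
  \<open>v'\<close>. There \<open>n\<close> has the same nonzero value as at \<open>v1\<close>, and
  this persists for small t.\<close>

lemma transversal_perturb:
  assumes H: "H \<in> two_faces P" and ex: "\<exists>v\<in>direction_space H. n \<bullet> v \<noteq> 0"
    and w: "\<And>v. v \<in> direction_space H \<Longrightarrow> v \<noteq> 0 \<Longrightarrow> n \<bullet> v = 0 \<Longrightarrow> w \<bullet> v \<noteq> 0"
  shows "\<forall>\<^sub>F t in at_right 0. \<forall>v\<in>direction_space H. w \<bullet> v = 0 \<longrightarrow> (n + t *\<^sub>R u) \<bullet> v = 0 \<longrightarrow> v = 0"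
proof -
  obtain v v1 where v: "v \<noteq> 0" "v \<in> direction_space H" "n \<bullet> v = 0" and v1: "n \<bullet> v1 \<noteq> 0"
    and coords: "\<And>x. x \<in> direction_space H \<Longrightarrow> \<exists>a b. x = a *\<^sub>R v1 + b *\<^sub>R v"
    using two_face_normal_section[OF H ex] by metis
  have wv: "w \<bullet> v \<noteq> 0" using w v by blast
  define v' where "v' = v1 - ((w \<bullet> v1) / (w \<bullet> v)) *\<^sub>R v"
  have "n \<bullet> v' \<noteq> 0" using v v1 by (simp add: v'_def inner_diff_right)
  then have "\<forall>\<^sub>F t in at_right 0. n \<bullet> v' + t * (u \<bullet> v') \<noteq> 0"
    by (intro eventually_affine_nonzero) simp
  then show ?thesis
  proof eventually_elim
    case (elim t)
    show ?case
    proof (intro ballI impI)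
      fix x assume x: "x \<in> direction_space H" "w \<bullet> x = 0" "(n + t *\<^sub>R u) \<bullet> x = 0"
      obtain a b where ab: "x = a *\<^sub>R v1 + b *\<^sub>R v" using coords[OF x(1)] by blast
      have "b = - a * ((w \<bullet> v1) / (w \<bullet> v))"
        using x(2) wv by (simp add: ab inner_add_right field_simps add_eq_0_iff)
      then have xa: "x = a *\<^sub>R v'" by (simp add: ab v'_def algebra_simps)
      then have "a * (n \<bullet> v' + t * (u \<bullet> v')) = 0"
        using x(3) by (simp add: inner_add_left algebra_simps)
      then have "a = 0" using elim by simp
      then show "x = 0" using xa by simp
    qed
  qed
qed

text \<open>The conclusion splits according to whether the face exposed by \<open>- n\<close> is a
  2-face: if its dimension is at most 1, its vertices behave like all vertices off \<open>F\<close>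
  and contribute equally on both sides of t = 0.\<close>

lemma exits_balance:
  assumes P: "polytope P" "aff_dim P \<ge> 3" "equiprojective P"
    and F: "F \<in> two_faces P" "max_face n P = F"
    and F': "max_face (- n) P = F'"
      "F' \<in> two_faces P \<and> direction_space F' = direction_space F \<or> aff_dim F' \<le> 1"
    and tr: "\<And>H. H \<in> two_faces P \<Longrightarrow> direction_space H \<noteq> direction_space F \<Longrightarrow>
       \<exists>v\<in>direction_space H. n \<bullet> v \<noteq> 0"
  obtains S where "finite S"
    "\<And>u. u \<in> direction_space F \<Longrightarrow> u \<noteq> 0 \<Longrightarrow> (\<And>v. v \<in> S \<Longrightarrow> u \<notin> span {v}) \<Longrightarrow>
      (if F' \<in> two_faces P then card (exits F u) + card (exits F' (- u)) = card (exits F (- u)) + card (exits F' u)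
       else card (exits F u) = card (exits F (- u)))"
proof -
  obtain k where k: "\<And>W. admissible P W \<Longrightarrow> card (vis P W) = k"
    using equiprojective_card_vis[OF P(1) _ P(3)] P(2) by force
  have cP: "convex P" using P polytope_imp_convex by blast
  define D where "D = direction_space F"
  have sD: "subspace D" by (simp add: D_def)
  have dD: "dim D = 2" using two_faceD(4)[OF F(1)] by (simp add: D_def)
  have Ff: "F face_of P" "aff_dim F = 2" using two_faceD[OF F(1)] by blast+
  have FnP: "F \<noteq> P" using Ff P(2) by auto
  have nD: "n \<bullet> v = 0" if "v \<in> D" for v
    using that inner_const_iff_orthogonal_direction_space[of F n] max_face_eq F(2) unfolding D_def by metis
  have F'f: "F' face_of P" using max_face_face_of[OF cP] F'(1) by blast
  have disj: "F \<inter> F' = {}"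
  proof (rule ccontr)
    assume "F \<inter> F' \<noteq> {}"
    then obtain x where x: "x \<in> max_face n P" "x \<in> max_face (- n) P" using F F' by blast
    have "P \<subseteq> F"
    proof
      fix y assume y: "y \<in> P"
      have "n \<bullet> y = n \<bullet> x" using max_face_le[OF x(1) y] max_face_le[OF x(2) y] by simp
      then show "y \<in> F" using in_max_face_iff[OF x(1) y] F(2) by simp
    qed
    then show False using FnP Ff(1) face_of_imp_subset by blast
  qed
  define E where "E = {e. e edge_of P}"
  have "\<forall>e\<in>E. \<exists>v. v \<noteq> 0 \<and> direction_space e = span {v}"
  proof
    fix e assume "e \<in> E"
    then obtain a b where "a \<noteq> b" "e = closed_segment a b" using edge_eq_segment[OF P(1)] E_def by blast
    then show "\<exists>v. v \<noteq> 0 \<and> direction_space e = span {v}"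
      using direction_space_segment by (metis right_minus_eq)
  qed
  then obtain de where de: "\<And>e. e edge_of P \<Longrightarrow> de e \<noteq> 0 \<and> direction_space e = span {de e}"
    unfolding E_def by (metis mem_Collect_eq)
  define T where "T = {H \<in> two_faces P. direction_space H \<noteq> D}"
  have trT: "H \<in> two_faces P" "\<exists>v\<in>direction_space H. n \<bullet> v \<noteq> 0" if "H \<in> T" for H
    using that tr by (simp_all add: T_def D_def)
  have "\<forall>H\<in>T. \<exists>v. v \<noteq> 0 \<and> v \<in> direction_space H \<and> n \<bullet> v = 0 \<and>
      (\<forall>x\<in>direction_space H. n \<bullet> x = 0 \<longrightarrow> x \<in> span {v})"
  proof
    fix H assume H: "H \<in> T"
    obtain v v1 where v: "v \<noteq> 0" "v \<in> direction_space H" "n \<bullet> v = 0" and v1: "n \<bullet> v1 \<noteq> 0"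
      and coords: "\<And>x. x \<in> direction_space H \<Longrightarrow> \<exists>a b. x = a *\<^sub>R v1 + b *\<^sub>R v"
      using two_face_normal_section[OF trT[OF H]] by metis
    have "x \<in> span {v}" if x: "x \<in> direction_space H" "n \<bullet> x = 0" for x
    proof -
      obtain a b where ab: "x = a *\<^sub>R v1 + b *\<^sub>R v" using coords x by blast
      then have "a = 0" using x(2) v v1 by (simp add: inner_add_right)
      then show ?thesis using ab by (auto simp: span_singleton)
    qed
    then show "\<exists>v. v \<noteq> 0 \<and> v \<in> direction_space H \<and> n \<bullet> v = 0 \<and>
      (\<forall>x\<in>direction_space H. n \<bullet> x = 0 \<longrightarrow> x \<in> span {v})" using v by blast
  qed
  then obtain dh where dh: "\<And>H. H \<in> T \<Longrightarrow> dh H \<noteq> 0 \<and> dh H \<in> direction_space H \<and> n \<bullet> dh H = 0 \<and>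
      (\<forall>x\<in>direction_space H. n \<bullet> x = 0 \<longrightarrow> x \<in> span {dh H})" by metis
  \<comment> \<open>The directions on which \<open>w\<close> must not vanish: those of the edges,
    and in each non-parallel 2-face the line killed by \<open>n\<close>. As \<open>w\<close> has to
    be orthogonal to \<open>u\<close>, the vector \<open>u\<close> must not be parallel to any of
    them.\<close>
  define S where "S = de ` E \<union> dh ` T"
  have finT: "finite T" using finite_two_faces[OF P(1)] by (auto simp: T_def)
  have finS: "finite S" using finite_edges[OF P(1)] finT by (simp add: S_def E_def)
  have S0: "v \<noteq> 0" if "v \<in> S" for v using that de dh by (auto simp: S_def E_def)
  have main: "if F' \<in> two_faces P then card (exits F u) + card (exits F' (- u)) = card (exits F (- u)) + card (exits F' u)
       else card (exits F u) = card (exits F (- u))"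
    if u: "u \<in> D" "u \<noteq> 0" and uS: "\<And>v. v \<in> S \<Longrightarrow> u \<notin> span {v}" for u
  proof -
    obtain v0 where v0: "v0 \<in> D" "v0 \<notin> span {u}" using dim_2_not_in_span_singleton[OF dD] .
    have "v \<notin> span {u}" if "v \<in> insert v0 S" for v
      using that v0 uS S0 span_singleton_sym by blast
    then obtain w where w: "w \<bullet> u = 0" "\<And>v. v \<in> insert v0 S \<Longrightarrow> w \<bullet> v \<noteq> 0"
      using exists_orthogonal_nonvanishing[of "insert v0 S" u] finS by blast
    have wv0: "w \<bullet> v0 \<noteq> 0" using w by simp
    have wT: "w \<bullet> v \<noteq> 0" if "H \<in> T" "v \<in> direction_space H" "v \<noteq> 0" "n \<bullet> v = 0" for H v
    proof -
      have "v \<in> span {dh H}" using dh[OF that(1)] that by blast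
      then obtain c where c: "v = c *\<^sub>R dh H" by (auto simp: span_singleton)
      have "dh H \<in> insert v0 S" using that(1) by (simp add: S_def)
      then show ?thesis using c that(3) w(2) by simp
    qed
    define W where "W = (\<lambda>u' t. span {n + t *\<^sub>R u', w})"
    have adm: "\<forall>\<^sub>F t in at_right 0. admissible P (W u' t)" if u': "u' = u \<or> u' = - u" for u'
    proof -
      have u'D: "u' \<in> D" "u' \<noteq> 0" "w \<bullet> u' = 0" using u' u w(1) by (auto simp: subspace_neg sD)
      have "u' \<in> span {u}" using u' by (auto intro: span_base span_neg)
      then have "span {u'} \<subseteq> span {u}" by (intro span_minimal) auto
      then have v0u: "v0 \<notin> span {u'}" using v0(2) by blast
      have "\<forall>\<^sub>F t in at_right 0. \<forall>H\<in>T. \<forall>v\<in>direction_space H.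
          w \<bullet> v = 0 \<longrightarrow> (n + t *\<^sub>R u') \<bullet> v = 0 \<longrightarrow> v = 0"
        by (intro eventually_ball_finite[OF finT] ballI transversal_perturb[OF trT] wT)
      moreover have "\<forall>\<^sub>F t in at_right (0::real). 0 < t" by (rule eventually_at_right_less)
      ultimately show ?thesis
      proof eventually_elim
        case (elim t)
        have sW: "subspace (W u' t)" by (simp add: W_def)
        have gens: "n + t *\<^sub>R u' \<in> W u' t" "w \<in> W u' t" by (auto simp: W_def intro: span_base)
        \<comment> \<open>On the directions of \<open>F\<close> the functional \<open>n\<close>
          vanishes, so the perturbation alone provides transversality: \<open>w\<close> and
          \<open>u'\<close> already separate these directions.\<close>
        have D0: "v = 0" if v: "v \<in> D" "w \<bullet> v = 0" "(n + t *\<^sub>R u') \<bullet> v = 0" for v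
        proof -
          obtain a b where ab: "v = a *\<^sub>R u' + b *\<^sub>R v0"
            using span_pair_coords[OF sD dD u'D(1) v0(1) u'D(2) v0u v(1)] .
          have "b = 0" using v(2) wv0 u'D(3) by (simp add: ab inner_add_right)
          moreover have "u' \<bullet> v = 0" using v(3) nD[OF v(1)] elim(2) by (simp add: inner_add_left)
          ultimately show ?thesis using ab u'D(2) by simp
        qed
        have nd: "\<not> degenerating (W u' t) H" if H: "H \<in> two_faces P" for H
        proof
          assume "degenerating (W u' t) H"
          then obtain v where v: "v \<in> direction_space H" "v \<noteq> 0" "\<forall>g\<in>W u' t. g \<bullet> v = 0"
            using degenerating_iff[OF sW two_faceD(4)[OF H]] by blast
          then have "w \<bullet> v = 0" "(n + t *\<^sub>R u') \<bullet> v = 0" using gens by blast+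
          then show False using v D0 elim(1) H unfolding T_def by blast
        qed
        have "w \<noteq> 0" using wv0 by auto
        have "n + t *\<^sub>R u' \<notin> span {w}"
        proof
          assume "n + t *\<^sub>R u' \<in> span {w}"
          then obtain c where "n + t *\<^sub>R u' = c *\<^sub>R w" by (auto simp: span_singleton)
          then have "(n + t *\<^sub>R u') \<bullet> u' = 0" using u'D(3) by simp
          then show False using nD[OF u'D(1)] elim(2) u'D(2) by (simp add: inner_add_left)
        qed
        moreover have "independent {w}" using \<open>w \<noteq> 0\<close> by simp
        ultimately have "independent {n + t *\<^sub>R u', w}" by (rule independent_insertI)
        moreover have "n + t *\<^sub>R u' \<noteq> w"
          using \<open>n + t *\<^sub>R u' \<notin> span {w}\<close> span_base[of w "{w}"] by auto
        ultimately have "dim (W u' t) = 2" unfolding W_def by (simp add: dim_eq_card_independent)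
        then show ?case using nd sW by (simp add: admissible_iff plane_def)
      qed
    qed
    define V where "V = {x. x extreme_point_of P}"
    have finV: "finite V" unfolding V_def by (rule finite_vertices[OF P(1)])
    have visV: "vis P W' \<subseteq> V" for W'
      using max_face_face_of[OF cP] by (auto simp: vis_def V_def simp flip: face_of_singleton) metis
    have onF: "\<forall>\<^sub>F t in at_right 0. x \<in> vis P (W u' t) \<longleftrightarrow> x \<in> exits F u'"
      if "x extreme_point_of F" and u': "u' = u \<or> u' = - u" for x u'
    proof -
      have "\<forall>\<^sub>F t in at_right 0. x \<in> vis P (span {n + t *\<^sub>R u', w}) \<longleftrightarrow> \<not> (\<exists>s>0. x + s *\<^sub>R u' \<in> F)"
      proof (rule vis_exposed_face[OF P(1) F(2) FnP, where ?v0.0 = v0])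
        show "u' \<notin> direction_space e" if "e edge_of F" for e
        proof -
          have eP: "e edge_of P" using edge_of_face[OF Ff(1) that] .
          then have "u \<notin> span {de e}" using uS[of "de e"] by (simp add: S_def E_def)
          then have "u \<notin> direction_space e" using de[OF eP] by simp
          then show ?thesis using u' subspace_neg[OF subspace_direction_space, of u' e] by auto
        qed
      qed (use that u w(1) wv0 v0 dD subspace_neg[OF sD u(1)] in \<open>auto simp: D_def\<close>)
      then show ?thesis using that by (auto simp: exits_def W_def elim: eventually_mono)
    qed
    have onF': "\<forall>\<^sub>F t in at_right 0. x \<in> vis P (W u' t) \<longleftrightarrow> x \<in> exits F' (- u')"
      if "x extreme_point_of F'" and u': "u' = u \<or> u' = - u" and F'2: "F' \<in> two_faces P" for x u'
    proof -
      have dF': "direction_space F' = D"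
        using F'(2) two_faceD(2)[OF F'2] by (auto simp: D_def)
      have F'nP: "F' \<noteq> P" using two_faceD(2)[OF F'2] P(2) by auto
      have "\<forall>\<^sub>F t in at_right 0. x \<in> vis P (span {- n + t *\<^sub>R (- u'), w}) \<longleftrightarrow> \<not> (\<exists>s>0. x + s *\<^sub>R (- u') \<in> F')"
      proof (rule vis_exposed_face[OF P(1) F'(1) F'nP, where ?v0.0 = v0])
        show "- u' \<notin> direction_space e" if "e edge_of F'" for e
        proof -
          have eP: "e edge_of P" using edge_of_face[OF F'f that] .
          then have "u \<notin> span {de e}" using uS[of "de e"] by (simp add: S_def E_def)
          then have "u \<notin> direction_space e" using de[OF eP] by simp
          then show ?thesis using u' subspace_neg[OF subspace_direction_space, of "- u'" e] by auto
        qed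
      qed (use that u w(1) wv0 v0 dD subspace_neg[OF sD u(1)] in \<open>auto simp: dF'\<close>)
      \<comment> \<open>Seen from \<open>F'\<close>, the same plane is generated by the negated
        functional, which tilts \<open>- n\<close> by \<open>- u'\<close>; this is the origin of the
        reversed directions in the counts for \<open>F'\<close>.\<close>
      moreover have "span {- n + t *\<^sub>R (- u'), w} = W u' t" for t
        using span_minus_pair[of "n + t *\<^sub>R u'" w] by (simp add: W_def)
      ultimately show ?thesis using that by (auto simp: exits_def elim: eventually_mono)
    qed
    have off: "\<forall>\<^sub>F t in at_right 0. x \<in> vis P (W u t) \<longleftrightarrow> x \<in> vis P (W (- u) t)"
      if x: "x extreme_point_of P" and xF: "x \<notin> F" and xF': "x \<notin> F' \<or> F' \<notin> two_faces P" for x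
      unfolding W_def
    proof (rule vis_perturb_cong[OF P(1) x])
      \<comment> \<open>A supporting face of dimension at least 2 contains a 2-face. If that is not
        parallel to \<open>F\<close>, transversality makes both coefficients vanish; if it is, then
        \<beta> = 0 and the supporting face is \<open>F\<close> or \<open>F'\<close>.\<close>
      fix \<alpha> \<beta> assume ab: "(\<alpha>, \<beta>) \<noteq> (0::real, 0::real)" and xM: "x \<in> max_face (\<alpha> *\<^sub>R n + \<beta> *\<^sub>R w) P" (is "_ \<in> ?M")
      show "aff_dim ?M \<le> 1"
      proof (rule ccontr)
        assume "\<not> aff_dim ?M \<le> 1"
        then have a2: "aff_dim ?M \<ge> 2" by simp
        then obtain H where H: "H \<in> two_faces P" "H \<subseteq> ?M"
          using two_face_of_face[OF P(1) max_face_face_of[OF cP]] by blast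
        have const: "(\<alpha> *\<^sub>R n + \<beta> *\<^sub>R w) \<bullet> v = 0" if "v \<in> direction_space H" for v
          using inner_const_iff_orthogonal_direction_space[of H "\<alpha> *\<^sub>R n + \<beta> *\<^sub>R w"] max_face_eq H(2) that
          by (meson subsetD)
        show False
        proof (cases "H \<in> T")
          case True
          have "\<beta> * (w \<bullet> dh H) = 0" using const[of "dh H"] dh[OF True] by (simp add: inner_add_left)
          moreover have "w \<bullet> dh H \<noteq> 0" using wT[OF True] dh[OF True] by blast
          ultimately have "\<beta> = 0" by simp
          then have "\<alpha> \<noteq> 0" using ab by simp
          moreover obtain v where "v \<in> direction_space H" "n \<bullet> v \<noteq> 0" using trT(2)[OF True] by blast
          ultimately show False using const[of v] \<open>\<beta> = 0\<close> by simp
        next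
          case False
          then have "direction_space H = D" using H(1) by (simp add: T_def)
          then have "\<beta> * (w \<bullet> v0) = 0" using const[of v0] v0(1) nD[OF v0(1)] by (simp add: inner_add_left)
          then have "\<beta> = 0" using wv0 by simp
          then have M: "?M = max_face (\<alpha> *\<^sub>R n) P" by simp
          consider "\<alpha> > 0" | "- \<alpha> > 0" using ab \<open>\<beta> = 0\<close> by force
          then show False
          proof cases
            case 1
            then show False using M xM xF F(2) max_face_scaleR by blast
          next
            case 2
            have "?M = F'" using M max_face_scaleR[OF 2, of "- n" P] F'(1) by simp
            then show False using xM xF' F'(2) a2 by auto
          qed
        qed
      qed
    next
      fix e assume e: "e edge_of P"
      have "de e \<in> insert v0 S" using e by (simp add: S_def E_def)
      then have "w \<bullet> de e \<noteq> 0" using w(2) by blast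
      moreover have "de e \<in> direction_space e" using de[OF e] by (auto intro: span_base)
      ultimately show "\<exists>v\<in>direction_space e. n \<bullet> v \<noteq> 0 \<or> w \<bullet> v \<noteq> 0" by blast
    qed
    define VF where "VF = {x. x extreme_point_of F}"
    define VF' where "VF' = (if F' \<in> two_faces P then {x. x extreme_point_of F'} else {})"
    have VF: "VF = V \<inter> F"
      using extreme_point_of_face[OF Ff(1)] by (auto simp: VF_def V_def)
    have VF': "VF' = (if F' \<in> two_faces P then V \<inter> F' else {})"
      using extreme_point_of_face[OF F'f] by (auto simp: VF'_def V_def)
    have "\<forall>\<^sub>F t in at_right 0. \<forall>x\<in>VF. (x \<in> vis P (W u t) \<longleftrightarrow> x \<in> exits F u) \<and>
        (x \<in> vis P (W (- u) t) \<longleftrightarrow> x \<in> exits F (- u))"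
      using finV VF onF by (intro eventually_ball_finite ballI eventually_conj) (auto simp: VF_def)
    moreover have "\<forall>\<^sub>F t in at_right 0. \<forall>x\<in>VF'. (x \<in> vis P (W u t) \<longleftrightarrow> x \<in> exits F' (- u)) \<and>
        (x \<in> vis P (W (- u) t) \<longleftrightarrow> x \<in> exits F' u)"
      using finV VF' onF'[where u' = u] onF'[where u' = "- u"]
      by (intro eventually_ball_finite ballI eventually_conj) (auto simp: VF'_def split: if_splits)
    moreover have "\<forall>\<^sub>F t in at_right 0. \<forall>x\<in>V - VF - VF'. x \<in> vis P (W u t) \<longleftrightarrow> x \<in> vis P (W (- u) t)"
      using finV off by (intro eventually_ball_finite ballI) (auto simp: V_def VF VF' split: if_splits)
    ultimately have "\<forall>\<^sub>F t in at_right 0.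
       (\<forall>x\<in>VF. (x \<in> vis P (W u t) \<longleftrightarrow> x \<in> exits F u) \<and> (x \<in> vis P (W (- u) t) \<longleftrightarrow> x \<in> exits F (- u))) \<and>
       (\<forall>x\<in>VF'. (x \<in> vis P (W u t) \<longleftrightarrow> x \<in> exits F' (- u)) \<and> (x \<in> vis P (W (- u) t) \<longleftrightarrow> x \<in> exits F' u)) \<and>
       (\<forall>x\<in>V - VF - VF'. x \<in> vis P (W u t) \<longleftrightarrow> x \<in> vis P (W (- u) t)) \<and>
       admissible P (W u t) \<and> admissible P (W (- u) t)"
      (is "\<forall>\<^sub>F t in _. ?seen t")
      using adm[of u] adm[of "- u"] by (intro eventually_conj) auto
    then obtain t where t: "?seen t"
      by (rule eventually_at_right_ex)
    note t1 = t[THEN conjunct1] and t2 = t[THEN conjunct2, THEN conjunct1]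
      and t3 = t[THEN conjunct2, THEN conjunct2, THEN conjunct1]
      and t4 = t[THEN conjunct2, THEN conjunct2, THEN conjunct2]
    have sub: "exits F u' \<subseteq> VF" "F' \<in> two_faces P \<Longrightarrow> exits F' u' \<subseteq> VF'" for u'
      by (auto simp: exits_def VF_def VF'_def)
    have dVF: "VF \<inter> VF' = {}" using disj by (auto simp: VF VF')
    have VFV: "VF \<subseteq> V" "VF' \<subseteq> V" by (auto simp: VF VF' split: if_splits)
    have split: "card X = card (X \<inter> VF) + card (X \<inter> VF') + card (X \<inter> (V - VF - VF'))" if X: "X \<subseteq> V" for X
    proof -
      have fX: "finite X" using X finV finite_subset by blast
      have "X = (X \<inter> VF \<union> X \<inter> VF') \<union> X \<inter> (V - VF - VF')" using X by blast
      then have "card X = card ((X \<inter> VF \<union> X \<inter> VF') \<union> X \<inter> (V - VF - VF'))" by simp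
      also have "\<dots> = card (X \<inter> VF \<union> X \<inter> VF') + card (X \<inter> (V - VF - VF'))"
        using fX by (intro card_Un_disjoint) auto
      also have "card (X \<inter> VF \<union> X \<inter> VF') = card (X \<inter> VF) + card (X \<inter> VF')"
        using fX dVF by (intro card_Un_disjoint) auto
      finally show ?thesis .
    qed
    have rest: "vis P (W u t) \<inter> (V - VF - VF') = vis P (W (- u) t) \<inter> (V - VF - VF')" using t3 by blast
    have i1: "vis P (W u t) \<inter> VF = exits F u" "vis P (W (- u) t) \<inter> VF = exits F (- u)"
      using t1 sub(1) by blast+
    have eqk: "card (vis P (W u t)) = card (vis P (W (- u) t))" using k t4 by simp
    show ?thesis
    proof (cases "F' \<in> two_faces P")
      case True
      have "vis P (W u t) \<inter> VF' = exits F' (- u)" "vis P (W (- u) t) \<inter> VF' = exits F' u"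
        using t2 sub(2)[OF True] by blast+
      then show ?thesis using True eqk split[OF visV] i1 rest by simp
    next
      case False
      then have "VF' = {}" by (simp add: VF'_def)
      then show ?thesis using False eqk split[OF visV] i1 rest by simp
    qed
  qed
  show thesis using that[OF finS] main unfolding D_def by blast
qed

section \<open>Edges of a polygon and its exit points\<close>

text \<open>For a polygon and independent \<open>q\<close> and \<open>r\<close> at most one edge
  qualifies, so the cardinality is an indicator with values 0 and 1. Reversing \<open>q\<close>
  changes nothing; the sign of \<open>r\<close> selects the side.\<close>

definition side_edges :: "'a::euclidean_space set \<Rightarrow> 'a \<Rightarrow> 'a \<Rightarrow> 'a set set" where
  "side_edges F q r = {e. e edge_of F \<and> direction_space e = span {q} \<and>
     (\<forall>x\<in>e. \<forall>y\<in>F - e. \<exists>\<alpha> \<beta>. \<beta> > 0 \<and> y - x = \<alpha> *\<^sub>R q + \<beta> *\<^sub>R r)}"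

text \<open>The tail of the side edge when it is run through along \<open>q\<close>. It is the
  vertex whose exit status flips as the direction turns through \<open>q\<close>.\<close>

definition start_points :: "'a::euclidean_space set \<Rightarrow> 'a \<Rightarrow> 'a \<Rightarrow> 'a set" where
  "start_points F q r = {x. \<exists>e\<in>side_edges F q r. x \<in> e \<and> (\<forall>y\<in>e. \<exists>c\<ge>0. y - x = c *\<^sub>R q)}"

lemma edge_max_face:
  assumes F: "polytope F" "dim (direction_space F) = 2" and e: "e edge_of F"
  obtains f where "max_face f F = e" "\<And>v. v \<in> direction_space e \<Longrightarrow> f \<bullet> v = 0"
    "\<exists>v\<in>direction_space F. f \<bullet> v \<noteq> 0"
proof -
  have ef: "e face_of F" "aff_dim e = 1" using e by (auto simp: edge_of_def)
  then have "e \<noteq> {}" by auto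
  then have "F \<noteq> {}" using ef face_of_imp_subset by blast
  then have "aff_dim F = 2" using dim_direction_space[of F] F by simp
  then have "e \<noteq> F" using ef by auto
  obtain f where f: "max_face f F = e" using face_of_polytope_eq_max_face[OF F(1) ef(1) \<open>e \<noteq> {}\<close>] .
  have "f \<bullet> v = 0" if "v \<in> direction_space e" for v
    using that inner_const_iff_orthogonal_direction_space[of e f] max_face_eq f by metis
  moreover have "\<exists>v\<in>direction_space F. f \<bullet> v \<noteq> 0"
  proof (rule ccontr)
    assume "\<not> ?thesis"
    then have *: "\<forall>x\<in>F. \<forall>y\<in>F. f \<bullet> x = f \<bullet> y" using inner_const_iff_orthogonal_direction_space by blast
    obtain x where x: "x \<in> max_face f F" using f \<open>e \<noteq> {}\<close> by blast
    then have "x \<in> F" using max_face_subset by blast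
    then have "F \<subseteq> max_face f F" using in_max_face_iff[OF x] * by blast
    then show False using f \<open>e \<noteq> F\<close> max_face_subset by blast
  qed
  ultimately show thesis using that f by blast
qed

lemma edge_proper:
  assumes F: "dim (direction_space F) = 2" and e: "e edge_of F"
  obtains y where "y \<in> F" "y \<notin> e"
proof -
  have ef: "e face_of F" "aff_dim e = 1" using e by (auto simp: edge_of_def)
  then have "F \<noteq> {}" using face_of_imp_subset by fastforce
  then have "aff_dim F = 2" using dim_direction_space[of F] F by simp
  then have "e \<noteq> F" using ef by auto
  then show thesis using that face_of_imp_subset[OF ef(1)] by blast
qed

lemma edge_subset_imp_eq:
  fixes F :: "'a::euclidean_space set"
  assumes "convex F" "e edge_of F" "e' edge_of F" "e \<subseteq> e'"
  shows "e = e'"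
proof (rule ccontr)
  assume "e \<noteq> e'"
  have ef: "e face_of F" "aff_dim e = 1" "e' face_of F" "aff_dim e' = 1"
    using assms by (auto simp: edge_of_def)
  have "e face_of e'" using face_of_subset[OF ef(1) assms(4) face_of_imp_subset[OF ef(3)]] .
  then have "aff_dim e < aff_dim e'"
    using face_of_aff_dim_lt[OF face_of_imp_convex[OF ef(3)]] \<open>e \<noteq> e'\<close> by blast
  then show False using ef by simp
qed

context
  fixes F :: "'a::euclidean_space set" and q r :: 'a
  assumes F: "polytope F" "dim (direction_space F) = 2"
    and q: "q \<in> direction_space F" "q \<noteq> 0" and r: "r \<in> direction_space F" "r \<notin> span {q}"
begin

lemma polygon_coords:
  assumes "v \<in> direction_space F"
  obtains a b where "v = a *\<^sub>R q + b *\<^sub>R r"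
  using span_pair_coords[OF subspace_direction_space F(2) q(1) r(1) q(2) r(2) assms] .

text \<open>A functional exposing the edge vanishes on \<open>q\<close>, hence not on
  \<open>r\<close>; the sign of its value at \<open>r\<close> decides the side.\<close>

lemma side_edges_cases:
  assumes e: "e edge_of F" "direction_space e = span {q}"
  shows "e \<in> side_edges F q r \<or> e \<in> side_edges F q (- r)"
proof -
  obtain f where f: "max_face f F = e" "\<And>v. v \<in> direction_space e \<Longrightarrow> f \<bullet> v = 0"
    "\<exists>v\<in>direction_space F. f \<bullet> v \<noteq> 0"
    using edge_max_face[OF F e(1)] by metis
  have fq: "f \<bullet> q = 0" using f(2) e(2) span_base[of q "{q}"] by simp
  obtain v where v: "v \<in> direction_space F" "f \<bullet> v \<noteq> 0" using f(3) by blast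
  obtain a b where "v = a *\<^sub>R q + b *\<^sub>R r" using polygon_coords[OF v(1)] .
  then have fr: "f \<bullet> r \<noteq> 0" using v(2) fq by (auto simp: inner_add_right)
  have coords: "\<exists>\<alpha> \<beta>. y - x = \<alpha> *\<^sub>R q + \<beta> *\<^sub>R r \<and> \<beta> * (f \<bullet> r) < 0" if xy: "x \<in> e" "y \<in> F - e" for x y
  proof -
    have "x \<in> F" using xy(1) f(1) max_face_subset by blast
    then obtain a b where ab: "y - x = a *\<^sub>R q + b *\<^sub>R r"
      using polygon_coords[OF diff_in_direction_space] xy(2) by blast
    have "f \<bullet> y < f \<bullet> x" using max_face_less[of x f F y] xy f(1) by blast
    then have "f \<bullet> (y - x) < 0" by (simp add: inner_diff_right)
    then show ?thesis using ab fq by (auto simp: inner_add_right)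
  qed
  show ?thesis
  proof (cases "f \<bullet> r < 0")
    case True
    have "\<exists>\<alpha> \<beta>. \<beta> > 0 \<and> y - x = \<alpha> *\<^sub>R q + \<beta> *\<^sub>R r" if "x \<in> e" "y \<in> F - e" for x y
      using coords[OF that] True by (metis mult_less_0_iff order_less_asym)
    then show ?thesis using e by (simp add: side_edges_def)
  next
    case False
    have "\<exists>\<alpha> \<beta>. \<beta> > 0 \<and> y - x = \<alpha> *\<^sub>R q + \<beta> *\<^sub>R (- r)" if xy: "x \<in> e" "y \<in> F - e" for x y
    proof -
      obtain \<alpha> \<beta> where ab: "y - x = \<alpha> *\<^sub>R q + \<beta> *\<^sub>R r" "\<beta> * (f \<bullet> r) < 0" using coords[OF xy] by blast
      then have "- \<beta> > 0" using False by (simp add: mult_less_0_iff)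
      moreover have "y - x = \<alpha> *\<^sub>R q + (- \<beta>) *\<^sub>R (- r)" using ab(1) by simp
      ultimately show ?thesis by blast
    qed
    then show ?thesis using e by (simp add: side_edges_def)
  qed
qed

lemma side_edges_disjoint: "side_edges F q r \<inter> side_edges F q (- r) = {}"
proof (rule ccontr)
  assume "side_edges F q r \<inter> side_edges F q (- r) \<noteq> {}"
  then obtain e where e: "e \<in> side_edges F q r" "e \<in> side_edges F q (- r)" by blast
  then have ee: "e edge_of F" by (simp add: side_edges_def)
  obtain y where y: "y \<in> F - e" using edge_proper[OF F(2) ee] by blast
  obtain x where x: "x \<in> e" using ee by (force simp: edge_of_def)
  obtain a b where ab: "b > 0" "y - x = a *\<^sub>R q + b *\<^sub>R r"
    using e(1) x y by (auto simp: side_edges_def) blast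
  obtain a' b' where ab': "b' > 0" "y - x = a' *\<^sub>R q + b' *\<^sub>R (- r)"
    using e(2) x y unfolding side_edges_def by blast
  have "b = - b'" using not_in_span_singleton_coords(2)[OF q(2) r(2), of a b a' "- b'"] ab ab' by simp
  then show False using ab ab' by simp
qed

text \<open>For a point on each of two candidates, outside the other one, both differences of the
  points would have a positive \<open>r\<close>-coordinate, although they are negatives of each
  other.\<close>

lemma side_edges_unique:
  assumes "e \<in> side_edges F q r" "e' \<in> side_edges F q r"
  shows "e = e'"
proof (rule ccontr)
  assume "e \<noteq> e'"
  have ee: "e edge_of F" "e' edge_of F" "direction_space e = span {q}" "direction_space e' = span {q}"
    using assms by (auto simp: side_edges_def)
  have cF: "convex F" using F polytope_imp_convex by blast
  have sub: "e \<subseteq> F" "e' \<subseteq> F" using ee edge_of_imp_subset by blast+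
  obtain x where x: "x \<in> e" "x \<notin> e'" using edge_subset_imp_eq[OF cF ee(1,2)] \<open>e \<noteq> e'\<close> by blast
  obtain y where y: "y \<in> e'" "y \<notin> e" using edge_subset_imp_eq[OF cF ee(2,1)] \<open>e \<noteq> e'\<close> by blast
  obtain a b where ab: "b > 0" "y - x = a *\<^sub>R q + b *\<^sub>R r"
    using assms(1) x y sub unfolding side_edges_def by blast
  obtain a' b' where ab': "b' > 0" "x - y = a' *\<^sub>R q + b' *\<^sub>R r"
    using assms(2) x y sub unfolding side_edges_def by blast
  have "(y - x) + (x - y) = (a + a') *\<^sub>R q + (b + b') *\<^sub>R r"
    unfolding ab(2) ab'(2) by (simp add: algebra_simps)
  then have "0 *\<^sub>R q + 0 *\<^sub>R r = (a + a') *\<^sub>R q + (b + b') *\<^sub>R r" by simp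
  then have "0 = b + b'" using not_in_span_singleton_coords(2)[OF q(2) r(2)] by blast
  then show False using ab ab' by simp
qed

lemma side_edge_segment:
  assumes "e \<in> side_edges F q r"
  obtains a c where "c > 0" "e = closed_segment a (a + c *\<^sub>R q)" "a \<in> start_points F q r"
proof -
  note obt = that
  have e: "e edge_of F" "direction_space e = span {q}" using assms by (auto simp: side_edges_def)
  obtain a b where ab: "a \<noteq> b" "e = closed_segment a b" using edge_eq_segment[OF F(1) e(1)] .
  have "b - a \<in> span {q}" using e(2) ab direction_space_segment[of a b] span_base[of "b - a" "{b - a}"] by simp
  then obtain c where c: "b - a = c *\<^sub>R q" by (auto simp: span_singleton)
  then have "c \<noteq> 0" using ab by auto
  have start: "\<exists>k\<ge>0. y - p = k *\<^sub>R q" if y: "y \<in> closed_segment p (p + d *\<^sub>R q)" and d: "d > 0" for y p d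
  proof -
    obtain u where "0 \<le> u" "y = (1 - u) *\<^sub>R p + u *\<^sub>R (p + d *\<^sub>R q)"
      using y by (auto simp: closed_segment_def)
    then have "y - p = (u * d) *\<^sub>R q" "u * d \<ge> 0" using d by (auto simp: algebra_simps)
    then show ?thesis by blast
  qed
  have main: thesis if d: "d > 0" and seg: "e = closed_segment p (p + d *\<^sub>R q)" for p d
  proof -
    have "p \<in> start_points F q r"
      unfolding start_points_def using assms start[OF _ d] seg by auto
    then show thesis using obt d seg by blast
  qed
  show thesis
  proof (cases "c > 0")
    case True
    have "b = a + c *\<^sub>R q" using c by (simp add: algebra_simps)
    then show thesis using main[OF True, of a] ab by simp
  next
    case False
    then have "- c > 0" using \<open>c \<noteq> 0\<close> by simp
    moreover have "a = b + (- c) *\<^sub>R q" using c by (simp add: algebra_simps)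
    ultimately show thesis using main[of "- c" b] ab(2) closed_segment_commute by metis
  qed
qed

lemma card_start_points: "card (start_points F q r) = card (side_edges F q r)"
proof (cases "side_edges F q r = {}")
  case True
  then show ?thesis by (simp add: start_points_def)
next
  case False
  then obtain e where e: "e \<in> side_edges F q r" by blast
  then have E: "side_edges F q r = {e}" using side_edges_unique by blast
  obtain a where a: "a \<in> start_points F q r" using side_edge_segment[OF e] by metis
  have "x = a" if "x \<in> start_points F q r" for x
  proof -
    have xa: "x \<in> e" "a \<in> e" "\<forall>y\<in>e. \<exists>c\<ge>0. y - x = c *\<^sub>R q" "\<forall>y\<in>e. \<exists>c\<ge>0. y - a = c *\<^sub>R q"
      using that a E by (auto simp: start_points_def)
    obtain c where c: "c \<ge> 0" "a - x = c *\<^sub>R q" using xa by blast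
    obtain c' where c': "c' \<ge> 0" "x - a = c' *\<^sub>R q" using xa by blast
    have "(c + c') *\<^sub>R q = 0" using c(2) c'(2) by (simp add: scaleR_add_left flip: c(2) c'(2))
    then have "c' = 0" using q(2) c c' by simp
    then show ?thesis using c' by simp
  qed
  then have "start_points F q r = {a}" using a by blast
  then show ?thesis using E by simp
qed

end

section \<open>Exit points when the direction turns through an edge\<close>

lemma convex_cone_point:
  assumes F: "convex F" "x \<in> F" "y \<in> F" "z \<in> F"
    and v: "v = a *\<^sub>R (y - x) + b *\<^sub>R (z - x)" "a \<ge> 0" "b \<ge> 0"
  shows "\<exists>s>0. x + s *\<^sub>R v \<in> F"
proof -
  \<comment> \<open>Normalised so that the weights \<open>s\<close>, \<open>s * a\<close> and
    \<open>s * b\<close> of \<open>x\<close>, \<open>y\<close> and \<open>z\<close> add up to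
    1.\<close>
  define s where "s = 1 / (a + b + 1)"
  have s: "s > 0" "s * a + s * b + s = 1"
    using v by (auto simp: s_def divide_simps)
  have "x + s *\<^sub>R v = s *\<^sub>R x + (s * a) *\<^sub>R y + (s * b) *\<^sub>R z + (1 - s * a - s * b - s) *\<^sub>R x"
    unfolding v(1) by (simp add: algebra_simps)
  also have "\<dots> = s *\<^sub>R x + (s * a) *\<^sub>R y + (s * b) *\<^sub>R z" using s by simp
  also have "\<dots> \<in> F" 
  proof -
    have "s *\<^sub>R x + (s * a) *\<^sub>R y + (s * b) *\<^sub>R z \<in> convex hull {x, y, z}"
      unfolding convex_hull_3 using s v
      by (intro CollectI exI[of _ s] exI[of _ "s * a"] exI[of _ "s * b"]) simp
    then show ?thesis using hull_minimal[of "{x,y,z}" F convex] F by blast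
  qed
  finally show ?thesis using s by blast
qed

text \<open>At the tail of the edge the tangent cone has \<open>q\<close> on its border and opens
  towards \<open>r\<close>: turning \<open>q\<close> slightly towards \<open>r\<close> stays in the
  cone, turning it away leaves it.\<close>

lemma start_point_exits:
  assumes F: "polytope F" "dim (direction_space F) = 2"
    and q: "q \<in> direction_space F" "q \<noteq> 0" and r: "r \<in> direction_space F" "r \<notin> span {q}"
    and x: "x extreme_point_of F" "x \<in> start_points F q r"
  shows "\<forall>\<^sub>F \<epsilon> in at_right 0. x \<notin> exits F (q + \<epsilon> *\<^sub>R r) \<and> x \<in> exits F (q - \<epsilon> *\<^sub>R r)"
proof -
  obtain e where e: "e \<in> side_edges F q r" "x \<in> e" "\<forall>y\<in>e. \<exists>c\<ge>0. y - x = c *\<^sub>R q"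
    using x(2) by (auto simp: start_points_def)
  have ee: "e edge_of F" using e by (simp add: side_edges_def)
  have cF: "convex F" using F polytope_imp_convex by blast
  have eF: "e \<subseteq> F" using ee edge_of_imp_subset by blast
  obtain z where z: "z \<in> F" "z \<notin> e" using edge_proper[OF F(2) ee] .
  have side: "\<exists>\<alpha> \<beta>. \<beta> > 0 \<and> y - x = \<alpha> *\<^sub>R q + \<beta> *\<^sub>R r" if "y \<in> F" "y \<notin> e" for y
    using e(1,2) that unfolding side_edges_def by blast
  obtain \<alpha> \<beta> where ab: "\<beta> > 0" "z - x = \<alpha> *\<^sub>R q + \<beta> *\<^sub>R r" using side z by blast
  obtain y where y: "y \<in> e" "y \<noteq> x"
  proof -
    obtain a b where "a \<noteq> b" "e = closed_segment a b" using edge_eq_segment[OF F(1) ee] .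
    then have "a \<in> e" "b \<in> e" "a \<noteq> b" by auto
    then show thesis using that by metis
  qed
  obtain c where c: "c \<ge> 0" "y - x = c *\<^sub>R q" using e(3) y(1) by blast
  then have c0: "c > 0" using y(2) by (cases "c = 0") auto
  have out: "x \<in> exits F (q - \<epsilon> *\<^sub>R r)" if \<epsilon>: "\<epsilon> > 0" for \<epsilon>
  proof -
    have False if s: "s > 0" "x + s *\<^sub>R (q - \<epsilon> *\<^sub>R r) \<in> F" for s
    proof -
      let ?y = "x + s *\<^sub>R (q - \<epsilon> *\<^sub>R r)"
      have yx: "?y - x = s *\<^sub>R q + (- (s * \<epsilon>)) *\<^sub>R r" by (simp add: algebra_simps)
      show False
      proof (cases "?y \<in> e")
        case True
        then obtain k where "?y - x = k *\<^sub>R q" using e(3) by blast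
        then have "s *\<^sub>R q + (- (s * \<epsilon>)) *\<^sub>R r = k *\<^sub>R q + 0 *\<^sub>R r" using yx by simp
        then have "- (s * \<epsilon>) = 0" by (rule not_in_span_singleton_coords(2)[OF q(2) r(2)])
        then show False using s(1) \<epsilon> by simp
      next
        case False
        then obtain a b where b: "b > 0" "?y - x = a *\<^sub>R q + b *\<^sub>R r" using side s(2) by blast
        then have "s *\<^sub>R q + (- (s * \<epsilon>)) *\<^sub>R r = a *\<^sub>R q + b *\<^sub>R r" using yx by simp
        then have "- (s * \<epsilon>) = b" by (rule not_in_span_singleton_coords(2)[OF q(2) r(2)])
        then show False using s(1) \<epsilon> b(1) by (smt (verit) mult_pos_pos)
      qed
    qed
    then show ?thesis using x(1) by (auto simp: exits_def)
  qed
  have "\<forall>\<^sub>F \<epsilon> in at_right 0. 0 + \<epsilon> * (\<alpha> / \<beta>) < 1 + \<epsilon> * 0" by (intro eventually_less_linear) simp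
  moreover have "\<forall>\<^sub>F \<epsilon> in at_right (0::real). 0 < \<epsilon>" by (rule eventually_at_right_less)
  ultimately show ?thesis
  proof eventually_elim
    case (elim \<epsilon>)
    \<comment> \<open>A combination of the edge direction \<open>y - x\<close> and the direction
      \<open>z - x\<close> into the polygon; the smallness of \<epsilon> keeps the first weight
      nonnegative.\<close>
    have "q + \<epsilon> *\<^sub>R r = ((1 - \<epsilon> * (\<alpha> / \<beta>)) / c) *\<^sub>R (y - x) + (\<epsilon> / \<beta>) *\<^sub>R (z - x)"
    proof -
      have "((1 - \<epsilon> * (\<alpha> / \<beta>)) / c) *\<^sub>R (y - x) = (1 - \<epsilon> * (\<alpha> / \<beta>)) *\<^sub>R q"
        using c0 unfolding c(2) by simp
      moreover have "(\<epsilon> / \<beta>) *\<^sub>R (z - x) = (\<epsilon> * (\<alpha> / \<beta>)) *\<^sub>R q + \<epsilon> *\<^sub>R r"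
        using ab(1) unfolding ab(2) by (simp add: scaleR_add_right)
      ultimately show ?thesis by (simp add: scaleR_diff_left)
    qed
    then have "\<exists>s>0. x + s *\<^sub>R (q + \<epsilon> *\<^sub>R r) \<in> F"
      using convex_cone_point[OF cF _ _ z(1), of x y "q + \<epsilon> *\<^sub>R r" "(1 - \<epsilon> * (\<alpha> / \<beta>)) / c" "\<epsilon> / \<beta>"]
        elim c0 ab(1) e(2) y(1) eF by (auto simp: subset_eq)
    then show ?case using out[of \<epsilon>] elim(2) by (auto simp: exits_def)
  qed
qed

text \<open>Both alternatives for \<open>q\<close> are stable here. If \<open>q\<close> is outside
  the tangent cone, a separating functional also separates nearby directions. If it is inside, the
  segment from \<open>x\<close> along \<open>q\<close> reaches the relative interior of
  \<open>F\<close>, since otherwise \<open>x\<close> would be the start of an edge in direction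
  \<open>q\<close>.\<close>

lemma not_start_point_exits:
  assumes F: "polytope F" "dim (direction_space F) = 2"
    and q: "q \<in> direction_space F" "q \<noteq> 0" and r: "r \<in> direction_space F" "r \<notin> span {q}"
    and x: "x extreme_point_of F" "x \<notin> start_points F q r" "x \<notin> start_points F q (- r)"
  shows "\<forall>\<^sub>F \<epsilon> in at_right 0. x \<in> exits F (q + \<epsilon> *\<^sub>R r) \<longleftrightarrow> x \<in> exits F (q - \<epsilon> *\<^sub>R r)"
proof (cases "\<exists>s>0. x + s *\<^sub>R q \<in> F")
  case False
  have xF: "x \<in> F" using x(1) vertex_in by blast
  obtain f where f: "f \<bullet> q > 0" "x \<in> max_face f F"
    using exists_functional_not_in_cone[OF F(1) xF False] .
  have ex: "x \<in> exits F u" if u: "f \<bullet> u > 0" for u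
  proof -
    have "x + s *\<^sub>R u \<notin> F" if "s > 0" for s
      using max_face_le[OF f(2), of "x + s *\<^sub>R u"] u that by (auto simp: inner_add_right mult_le_0_iff)
    then show ?thesis using x(1) by (auto simp: exits_def)
  qed
  have "\<forall>\<^sub>F \<epsilon> in at_right 0. 0 + \<epsilon> * 0 < f \<bullet> q + \<epsilon> * (f \<bullet> r)"
    "\<forall>\<^sub>F \<epsilon> in at_right 0. 0 + \<epsilon> * 0 < f \<bullet> q + \<epsilon> * (f \<bullet> (- r))"
    using f(1) by (intro eventually_less_linear, simp)+
  then show ?thesis
  proof eventually_elim
    case (elim \<epsilon>)
    then show ?case using ex[of "q + \<epsilon> *\<^sub>R r"] ex[of "q - \<epsilon> *\<^sub>R r"]
      by (simp add: inner_add_right inner_diff_right)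
  qed
next
  case True
  then obtain s where s: "s > 0" "x + s *\<^sub>R q \<in> F" by blast
  have cF: "convex F" using F polytope_imp_convex by blast
  have xF: "x \<in> F" using x(1) vertex_in by blast
  then have "F \<noteq> {}" by blast
  then have aF: "aff_dim F = 2" using dim_direction_space[of F] F by simp
  let ?y = "x + s *\<^sub>R q" and ?z = "x + (s / 2) *\<^sub>R q"
  have z: "?z = (1 - 1 / 2) *\<^sub>R x + (1 / 2) *\<^sub>R ?y" by (simp add: algebra_simps flip: scaleR_add_left)
  have "x \<noteq> ?y" using s q by simp
  then have zo: "?z \<in> open_segment x ?y"
    unfolding in_segment by (intro conjI exI[of _ "1/2"] z) auto
  have zF: "?z \<in> F" using zo cF xF s(2) by (meson closed_segment_subset open_closed_segment subsetD)
  have zr: "?z \<in> rel_interior F"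
  proof (rule ccontr)
    assume "?z \<notin> rel_interior F"
    then obtain e where e: "e facet_of F" "?z \<in> e"
      using rel_boundary_of_polyhedron[OF polytope_imp_polyhedron[OF F(1)]] zF by blast
    then have ef: "e face_of F" "aff_dim e = 1" using aF by (auto simp: facet_of_def)
    then have ee: "e edge_of F" by (simp add: edge_of_def)
    have xye: "x \<in> e" "?y \<in> e" using face_ofD[OF ef(1) zo xF s(2) e(2)] by blast+
    obtain a b where "e = closed_segment a b" "a \<noteq> b" using edge_eq_segment[OF F(1) ee] by metis
    then have de: "direction_space e = span {b - a}" using direction_space_segment by metis
    have "(1 / s) *\<^sub>R (?y - x) \<in> direction_space e"
      by (intro subspace_scale subspace_direction_space diff_in_direction_space xye)
    then have qe: "q \<in> span {b - a}" using s(1) de by simp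
    then have "span {q} \<subseteq> span {b - a}" by (intro span_minimal) auto
    moreover have "span {b - a} \<subseteq> span {q}"
      using span_singleton_sym[OF qe q(2)] by (intro span_minimal) auto
    ultimately have deq: "direction_space e = span {q}" using de by blast
    have "\<exists>c\<ge>0. y - x = c *\<^sub>R q" if y: "y \<in> e" for y
    proof -
      have "y - x \<in> span {q}" using diff_in_direction_space[OF y xye(1)] deq by simp
      then obtain c where c: "y - x = c *\<^sub>R q" by (auto simp: span_singleton)
      have "c \<ge> 0"
      proof (rule ccontr)
        assume "\<not> c \<ge> 0"
        then have "c < 0" by simp
        \<comment> \<open>If part of the edge lay behind \<open>x\<close>, then \<open>x\<close>
          would be strictly between \<open>y\<close> and \<open>?y\<close>, at the parameter
          \<open>- c / (s - c)\<close>, and so not extreme.\<close>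
        have "x = (1 - (- c / (s - c))) *\<^sub>R y + (- c / (s - c)) *\<^sub>R ?y"
        proof -
          have yx: "y = x + c *\<^sub>R q" using c by (simp add: algebra_simps)
          have "(1 - (- c / (s - c))) * c + (- c / (s - c)) * s = 0"
            using \<open>c < 0\<close> s(1) by (simp add: divide_simps)
          then have "((1 - (- c / (s - c))) * c + (- c / (s - c)) * s) *\<^sub>R q = 0" by simp
          then show ?thesis unfolding yx by (simp add: algebra_simps)
        qed
        moreover have "0 < - c / (s - c)" "- c / (s - c) < 1"
          using \<open>c < 0\<close> s(1) by (auto simp: divide_simps)
        moreover have "y \<noteq> ?y"
        proof
          assume "y = ?y"
          then have "(s - c) *\<^sub>R q = 0" using c by (simp add: algebra_simps)
          then show False using q(2) \<open>c < 0\<close> s(1) by simp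
        qed
        ultimately have "x \<in> open_segment y ?y" unfolding in_segment by blast
        moreover have "y \<in> F" using y face_of_imp_subset[OF ef(1)] by blast
        ultimately show False using x(1) s(2) by (auto simp: extreme_point_of_def)
      qed
      then show ?thesis using c by blast
    qed
    then show False
      using side_edges_cases[OF F q r ee deq] x(2,3) xye(1) unfolding start_points_def by blast
  qed
  then obtain \<delta> where \<delta>: "\<delta> > 0" "ball ?z \<delta> \<inter> affine hull F \<subseteq> F"
    using mem_rel_interior_ball by metis
  have "\<forall>\<^sub>F \<epsilon> in at_right 0. 0 + \<epsilon> * (s / 2 * norm r) < \<delta> + \<epsilon> * 0"
    using \<delta> by (intro eventually_less_linear) simp
  moreover have "\<forall>\<^sub>F \<epsilon> in at_right (0::real). 0 < \<epsilon>" by (rule eventually_at_right_less)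
  ultimately show ?thesis
  proof eventually_elim
    case (elim \<epsilon>)
    have "x + (s / 2) *\<^sub>R (q + \<sigma> *\<^sub>R r) \<in> F" if \<sigma>: "\<bar>\<sigma>\<bar> = \<epsilon>" for \<sigma>
    proof -
      have eq: "x + (s / 2) *\<^sub>R (q + \<sigma> *\<^sub>R r) = ?z + (s / 2 * \<sigma>) *\<^sub>R r" by (simp add: algebra_simps)
      have "dist ?z (?z + (s / 2 * \<sigma>) *\<^sub>R r) < \<delta>"
        using elim \<sigma> s(1) by (simp add: dist_norm abs_mult algebra_simps)
      moreover have "?z + (s / 2 * \<sigma>) *\<^sub>R r \<in> affine hull F"
        unfolding affine_hull_eq_translated_direction_space[OF zF]
        using subspace_scale[OF subspace_direction_space r(1)] by simp
      ultimately show ?thesis unfolding eq using \<delta>(2) by (meson IntI mem_ball subsetD)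
    qed
    from this[of \<epsilon>] this[of "- \<epsilon>"] have "x \<notin> exits F (q + \<epsilon> *\<^sub>R r)" "x \<notin> exits F (q - \<epsilon> *\<^sub>R r)"
      using elim s(1) by (auto simp: exits_def intro: exI[of _ "s / 2"])
    then show ?case by blast
  qed
qed

text \<open>The exit sets on the two sides of \<open>q\<close> differ in start points alone: the
  direction turned away from \<open>r\<close> gains the start of the edge on the side of
  \<open>r\<close>, the direction turned towards \<open>r\<close> gains the start of the edge on the
  other side.\<close>

lemma card_exits_jump:
  assumes F: "polytope F" "dim (direction_space F) = 2"
    and q: "q \<in> direction_space F" "q \<noteq> 0" and r: "r \<in> direction_space F" "r \<notin> span {q}"
  shows "\<forall>\<^sub>F \<epsilon> in at_right 0. card (exits F (q - \<epsilon> *\<^sub>R r)) + card (side_edges F q (- r)) =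
    card (exits F (q + \<epsilon> *\<^sub>R r)) + card (side_edges F q r)"
proof -
  define V where "V = {x. x extreme_point_of F}"
  have finV: "finite V" unfolding V_def by (rule finite_vertices[OF F(1)])
  have r': "- r \<in> direction_space F" "- r \<notin> span {q}"
    using uminus_transversal[OF r] by blast+
  have startV: "start_points F q r' \<subseteq> V" if r': "r' \<in> direction_space F" "r' \<notin> span {q}" for r'
  proof
    fix x assume x: "x \<in> start_points F q r'"
    then obtain e where e: "e \<in> side_edges F q r'" by (auto simp: start_points_def)
    obtain a c where ac: "c > 0" "e = closed_segment a (a + c *\<^sub>R q)" "a \<in> start_points F q r'"
      using side_edge_segment[OF F q r' e] by blast
    have fin: "card (start_points F q r') = 1"
      using card_start_points[OF F q r'] side_edges_unique[OF F q r' e] e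
      by (metis card_1_singleton_iff One_nat_def insertI1 singletonI subsetI subset_antisym singletonD)
    then have "x = a" using x ac(3) by (metis card_1_singletonE singletonD)
    moreover have "a extreme_point_of e" unfolding ac(2) by (simp add: extreme_point_of_segment)
    moreover have "e face_of F" using e by (simp add: side_edges_def edge_of_def)
    ultimately show "x \<in> V" using extreme_point_of_face unfolding V_def by blast
  qed
  have "\<forall>\<^sub>F \<epsilon> in at_right 0. \<forall>x\<in>V.
      (x \<in> exits F (q - \<epsilon> *\<^sub>R r) - exits F (q + \<epsilon> *\<^sub>R r) \<longleftrightarrow> x \<in> start_points F q r) \<and>
      (x \<in> exits F (q + \<epsilon> *\<^sub>R r) - exits F (q - \<epsilon> *\<^sub>R r) \<longleftrightarrow> x \<in> start_points F q (- r))"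
  proof (intro eventually_ball_finite[OF finV] ballI)
    fix x assume "x \<in> V"
    then have x: "x extreme_point_of F" by (simp add: V_def)
    consider "x \<in> start_points F q r" "x \<in> start_points F q (- r)"
      | "x \<in> start_points F q r" "x \<notin> start_points F q (- r)"
      | "x \<notin> start_points F q r" "x \<in> start_points F q (- r)"
      | "x \<notin> start_points F q r" "x \<notin> start_points F q (- r)" by blast
    then show "\<forall>\<^sub>F \<epsilon> in at_right 0.
      (x \<in> exits F (q - \<epsilon> *\<^sub>R r) - exits F (q + \<epsilon> *\<^sub>R r) \<longleftrightarrow> x \<in> start_points F q r) \<and>
      (x \<in> exits F (q + \<epsilon> *\<^sub>R r) - exits F (q - \<epsilon> *\<^sub>R r) \<longleftrightarrow> x \<in> start_points F q (- r))"
    proof cases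
      \<comment> \<open>The edges on the two sides cannot share a start point: its exit status would
        be contradictory.\<close>
      case 1
      from start_point_exits[OF F q r x 1(1)] start_point_exits[OF F q r' x 1(2)]
      have "\<forall>\<^sub>F \<epsilon>::real in at_right 0. False" by eventually_elim simp
      then show ?thesis by simp
    next
      case 2
      from start_point_exits[OF F q r x 2(1)] show ?thesis by eventually_elim (use 2 in simp)
    next
      case 3
      from start_point_exits[OF F q r' x 3(2)] show ?thesis by eventually_elim (use 3 in simp)
    next
      case 4
      from not_start_point_exits[OF F q r x 4] show ?thesis by eventually_elim (use 4 in simp)
    qed
  qed
  then show ?thesis
  proof eventually_elim
    case (elim \<epsilon>)
    let ?A = "exits F (q - \<epsilon> *\<^sub>R r)" and ?B = "exits F (q + \<epsilon> *\<^sub>R r)"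
    have AB: "?A \<subseteq> V" "?B \<subseteq> V" by (auto simp: exits_def V_def)
    have A: "?A - ?B = start_points F q r" using elim AB startV[OF r] by blast
    have B: "?B - ?A = start_points F q (- r)" using elim AB startV[OF r'] by blast
    have fin: "finite ?A" "finite ?B" using AB finV finite_subset by blast+
    have "card ?A + card (?B - ?A) = card (?A \<union> ?B)"
      using card_Un_disjoint[of ?A "?B - ?A"] fin by simp
    also have "\<dots> = card ?B + card (?A - ?B)"
      using card_Un_disjoint[of ?B "?A - ?B"] fin by (simp add: Un_commute)
    finally show ?case
      unfolding A B by (simp only: card_start_points[OF F q r] card_start_points[OF F q r'])
  qed
qed

section \<open>Balance of parallel edges\<close>

lemma span_singleton_uminus: "span {- q} = span {q::'a::real_vector}"
proof -
  have "span {- q} \<subseteq> span {q}" for q :: 'a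
    by (rule span_minimal) (auto intro: span_neg span_base)
  from this[of q] this[of "- q"] show ?thesis by simp
qed

lemma side_edges_uminus: "side_edges F (- q) r = side_edges F q (r::'a::euclidean_space)"
proof -
  have sub: "side_edges F q r \<subseteq> side_edges F (- q) r" for q :: 'a
  proof
    fix e assume e: "e \<in> side_edges F q r"
    have "\<exists>\<alpha> \<beta>. \<beta> > 0 \<and> y - x = \<alpha> *\<^sub>R (- q) + \<beta> *\<^sub>R r" if xy: "x \<in> e" "y \<in> F - e" for x y
    proof -
      obtain \<alpha> \<beta> where "\<beta> > 0" "y - x = \<alpha> *\<^sub>R q + \<beta> *\<^sub>R r"
        using e xy unfolding side_edges_def by blast
      then have "y - x = (- \<alpha>) *\<^sub>R (- q) + \<beta> *\<^sub>R r" "\<beta> > 0" by auto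
      then show ?thesis by blast
    qed
    then show "e \<in> side_edges F (- q) r"
      using e unfolding side_edges_def span_singleton_uminus by blast
  qed
  from sub[of q] sub[of "- q"] show ?thesis by auto
qed

text \<open>Some functional vanishes at \<open>v\<close> but not at both \<open>q\<close> and
  \<open>r\<close>; along the moving direction it is a nonzero affine function of
  \<epsilon>.\<close>

lemma eventually_not_in_span:
  fixes q r :: "'a::euclidean_space"
  assumes q: "q \<noteq> 0" and r: "r \<notin> span {q}"
  shows "\<forall>\<^sub>F \<epsilon> in at_right 0. q + \<epsilon> *\<^sub>R r \<notin> span {v}"
proof -
  obtain h where h: "h \<bullet> v = 0" "h \<bullet> q \<noteq> 0 \<or> h \<bullet> r \<noteq> 0"
  proof (cases "q \<in> span {v}")
    case False
    then show thesis using that exists_orthogonal_nonvanishing[of "{q}" v] by auto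
  next
    case True
    then have "v \<in> span {q}" using span_singleton_sym q by blast
    then have "span {v} \<subseteq> span {q}" by (intro span_minimal) auto
    then have "r \<notin> span {v}" using r by blast
    then show thesis using that exists_orthogonal_nonvanishing[of "{r}" v] by auto
  qed
  have zero: "h \<bullet> x = 0" if "x \<in> span {v}" for x
    using that h(1) by (auto simp: span_singleton)
  from eventually_affine_nonzero[OF h(2)] show ?thesis
    by eventually_elim (metis zero inner_add_right inner_scaleR_right)
qed

text \<open>Let D(u) be the number of exits in direction u minus the number in direction -u. The
  exit balance says that D agrees for \<open>F\<close> and \<open>F'\<close> at generic u. As u
  turns through \<open>q\<close>, D changes by twice the difference of the two side-edge counts,
  because -u turns through \<open>- q\<close> at the same time. So these differences agree as well.
  If the face exposed by \<open>- n\<close> is not a 2-face, D is 0 for \<open>F\<close> and the two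
  counts are equal.\<close>

lemma edge_balance:
  assumes P: "polytope P" "aff_dim P \<ge> 3" "equiprojective P"
    and F: "F \<in> two_faces P" "max_face n P = F"
    and F': "max_face (- n) P = F'"
      "F' \<in> two_faces P \<and> direction_space F' = direction_space F \<or> aff_dim F' \<le> 1"
    and tr: "\<And>H. H \<in> two_faces P \<Longrightarrow> direction_space H \<noteq> direction_space F \<Longrightarrow>
       \<exists>v\<in>direction_space H. n \<bullet> v \<noteq> 0"
    and q: "q \<in> direction_space F" "q \<noteq> 0" and r: "r \<in> direction_space F" "r \<notin> span {q}"
  shows "if F' \<in> two_faces P
    then card (side_edges F q r) + card (side_edges F' q (- r)) =
      card (side_edges F q (- r)) + card (side_edges F' q r)
    else card (side_edges F q r) = card (side_edges F q (- r))"
proof -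
  let ?bal = "\<lambda>u. if F' \<in> two_faces P
    then card (exits F u) + card (exits F' (- u)) = card (exits F (- u)) + card (exits F' u)
    else card (exits F u) = card (exits F (- u))"
  obtain S where S: "finite S"
    "\<And>u. u \<in> direction_space F \<Longrightarrow> u \<noteq> 0 \<Longrightarrow> (\<And>v. v \<in> S \<Longrightarrow> u \<notin> span {v}) \<Longrightarrow> ?bal u"
    using exits_balance[OF P F F' tr] by blast
  have gen: "\<forall>\<^sub>F \<epsilon> in at_right 0. ?bal (q + \<epsilon> *\<^sub>R r')"
    if r': "r' \<in> direction_space F" "r' \<notin> span {q}" for r'
  proof -
    have "\<forall>\<^sub>F \<epsilon> in at_right 0. \<forall>v\<in>insert 0 S. q + \<epsilon> *\<^sub>R r' \<notin> span {v}"
      using S(1) eventually_not_in_span[OF q(2) r'(2)] by (intro eventually_ball_finite ballI) auto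
    then show ?thesis
    proof eventually_elim
      case (elim \<epsilon>)
      have "q + \<epsilon> *\<^sub>R r' \<in> direction_space F"
        by (intro subspace_add subspace_scale subspace_direction_space q r')
      moreover have "q + \<epsilon> *\<^sub>R r' \<noteq> 0" using elim span_zero[of "{0}"] by (metis insertI1)
      moreover have "q + \<epsilon> *\<^sub>R r' \<notin> span {v}" if "v \<in> S" for v using elim that by blast
      ultimately show ?case by (rule S(2))
    qed
  qed
  have mq: "- q \<in> direction_space F" "- q \<noteq> 0" using q subspace_neg[OF subspace_direction_space] by auto
  have mr: "- r \<in> direction_space F" "- r \<notin> span {q}"
    using uminus_transversal[OF r] by blast+
  have rmq: "r \<notin> span {- q}" using r by (simp add: span_singleton_uminus)
  have jump: "\<forall>\<^sub>F \<epsilon> in at_right 0.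
      card (exits G (q - \<epsilon> *\<^sub>R r)) + card (side_edges G q (- r)) =
        card (exits G (q + \<epsilon> *\<^sub>R r)) + card (side_edges G q r) \<and>
      card (exits G (- (q + \<epsilon> *\<^sub>R r))) + card (side_edges G q (- r)) =
        card (exits G (- (q - \<epsilon> *\<^sub>R r))) + card (side_edges G q r)"
    if G: "G \<in> two_faces P" "direction_space G = direction_space F" for G
  proof -
    have pG: "polytope G" "dim (direction_space G) = 2"
      using two_faceD[OF G(1)] P(1) face_of_polytope_polytope by blast+
    have j1: "\<forall>\<^sub>F \<epsilon> in at_right 0. card (exits G (q - \<epsilon> *\<^sub>R r)) + card (side_edges G q (- r)) =
        card (exits G (q + \<epsilon> *\<^sub>R r)) + card (side_edges G q r)"
      using card_exits_jump[OF pG, of q r] q r G(2) by simp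
    have j2: "\<forall>\<^sub>F \<epsilon> in at_right 0. card (exits G (- q - \<epsilon> *\<^sub>R r)) + card (side_edges G (- q) (- r)) =
        card (exits G (- q + \<epsilon> *\<^sub>R r)) + card (side_edges G (- q) r)"
      using card_exits_jump[OF pG, of "- q" r] mq r(1) rmq G(2) by simp
    have neg: "- (q + \<epsilon> *\<^sub>R r) = - q - \<epsilon> *\<^sub>R r" "- (q - \<epsilon> *\<^sub>R r) = - q + \<epsilon> *\<^sub>R r" for \<epsilon>
      by simp_all
    from j1 j2 show ?thesis
      unfolding neg side_edges_uminus by (rule eventually_conj)
  qed
  show ?thesis
  proof (cases "F' \<in> two_faces P")
    case True
    then have dF': "direction_space F' = direction_space F" using F'(2) two_faceD(2) by force
    from gen[OF r] gen[OF mr] jump[OF F(1) refl] jump[OF True dF']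
    have "\<forall>\<^sub>F \<epsilon>::real in at_right 0. card (side_edges F q r) + card (side_edges F' q (- r)) =
      card (side_edges F q (- r)) + card (side_edges F' q r)"
      by eventually_elim (use True in simp)
    then show ?thesis using True by (simp add: eventually_const_iff)
  next
    case False
    from gen[OF r] gen[OF mr] jump[OF F(1) refl]
    have "\<forall>\<^sub>F \<epsilon>::real in at_right 0. card (side_edges F q r) = card (side_edges F q (- r))"
      by eventually_elim (use False in simp)
    then show ?thesis using False by (simp add: eventually_const_iff)
  qed
qed

lemma edge_balance_pair:
  assumes P: "polytope P" "aff_dim P \<ge> 3" "equiprojective P"
    and sv: "simultaneously_visible P F F'" "F' \<noteq> {}"
    and q: "q \<in> direction_space F" "q \<noteq> 0" and r: "r \<in> direction_space F" "r \<notin> span {q}"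
  shows "card (side_edges F q r) + card (side_edges F' q (- r)) =
    card (side_edges F q (- r)) + card (side_edges F' q r)"
proof -
  have F: "F \<in> two_faces P" "F' \<in> two_faces P" "direction_space F' = direction_space F"
    using sv by (auto simp: simultaneously_visible_def parallel_rel_def)
  obtain n where n: "max_face n P = F" "max_face (- n) P = F'"
    "\<And>H. H \<in> two_faces P \<Longrightarrow> direction_space H \<noteq> direction_space F \<Longrightarrow>
       \<exists>v\<in>direction_space H. n \<bullet> v \<noteq> 0"
    using simultaneously_visible_pair[OF P(1,2) sv] by blast
  show ?thesis
    using edge_balance[OF P F(1) n(1,2) _ n(3) q r] F by simp
qed

lemma edge_balance_single:
  assumes P: "polytope P" "aff_dim P \<ge> 3" "equiprojective P"
    and sv: "simultaneously_visible P F {}"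
    and q: "q \<in> direction_space F" "q \<noteq> 0" and r: "r \<in> direction_space F" "r \<notin> span {q}"
  shows "card (side_edges F q r) = card (side_edges F q (- r))"
proof -
  have "{} \<notin> two_faces P" by (auto simp: two_faces_def)
  then have F: "F \<in> two_faces P"
    using sv by (auto simp: simultaneously_visible_def parallel_rel_def)
  obtain n where n: "max_face n P = F" "aff_dim (max_face (- n) P) \<le> 1"
    "\<And>H. H \<in> two_faces P \<Longrightarrow> direction_space H \<noteq> direction_space F \<Longrightarrow>
       \<exists>v\<in>direction_space H. n \<bullet> v \<noteq> 0"
    using simultaneously_visible_single[OF P(1,2) sv] by blast
  have "max_face (- n) P \<notin> two_faces P" using n(2) two_faceD(2) by force
  then show ?thesis
    using edge_balance[OF P F n(1) refl _ n(3) q r] n(2) by simp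
qed

section \<open>Orientations\<close>

text \<open>The second triple arises from the first by a triangular matrix with diagonal
  \<open>c\<close>, \<beta>, \<sigma>, which multiplies the determinant by their product. Uniqueness
  of coordinates lets the two coordinate matrices be compared entry by entry.\<close>

lemma pos_oriented_sign:
  fixes b :: "3 \<Rightarrow> 'a::euclidean_space"
  assumes b: "inj b" "independent (range b)"
    and 1: "pos_oriented b u w n" and 2: "pos_oriented b (c *\<^sub>R u) (\<alpha> *\<^sub>R u + \<beta> *\<^sub>R w) (\<sigma> *\<^sub>R n)"
  shows "c * \<beta> * \<sigma> > 0"
proof -
  have uniq: "x j = y j" if eq: "(\<Sum>j\<in>UNIV. x j *\<^sub>R b j) = (\<Sum>j\<in>UNIV. y j *\<^sub>R b j)" for x y :: "3 \<Rightarrow> real" and j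
  proof -
    let ?z = "\<lambda>v. x (inv b v) - y (inv b v)"
    have "(\<Sum>v\<in>range b. ?z v *\<^sub>R v) = (\<Sum>j\<in>UNIV. (x j - y j) *\<^sub>R b j)"
      using b(1) by (simp add: sum.reindex inv_f_f)
    also have "\<dots> = 0" using eq by (simp add: scaleR_diff_left sum_subtractf)
    finally have "(\<Sum>v\<in>range b. ?z v *\<^sub>R v) = 0" .
    then have "?z (b j) = 0"
      using independentD[OF b(2), of "range b" ?z "b j"] by simp
    then show ?thesis using b(1) by (simp add: inv_f_f)
  qed
  obtain M :: "real^3^3" where M: "det M > 0" "u = (\<Sum>j\<in>UNIV. M $ 1 $ j *\<^sub>R b j)"
    "w = (\<Sum>j\<in>UNIV. M $ 2 $ j *\<^sub>R b j)" "n = (\<Sum>j\<in>UNIV. M $ 3 $ j *\<^sub>R b j)"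
    using 1 by (auto simp: pos_oriented_def)
  obtain N :: "real^3^3" where N: "det N > 0" "c *\<^sub>R u = (\<Sum>j\<in>UNIV. N $ 1 $ j *\<^sub>R b j)"
    "\<alpha> *\<^sub>R u + \<beta> *\<^sub>R w = (\<Sum>j\<in>UNIV. N $ 2 $ j *\<^sub>R b j)" "\<sigma> *\<^sub>R n = (\<Sum>j\<in>UNIV. N $ 3 $ j *\<^sub>R b j)"
    using 2 by (auto simp: pos_oriented_def)
  have n1: "N $ 1 $ j = c * M $ 1 $ j" for j
    by (rule uniq[of "\<lambda>j. N $ 1 $ j" "\<lambda>j. c * M $ 1 $ j"])
      (simp add: M(2) scaleR_sum_right flip: N(2))
  have n2: "N $ 2 $ j = \<alpha> * M $ 1 $ j + \<beta> * M $ 2 $ j" for j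
    by (rule uniq[of "\<lambda>j. N $ 2 $ j" "\<lambda>j. \<alpha> * M $ 1 $ j + \<beta> * M $ 2 $ j"])
      (simp add: M(2,3) scaleR_sum_right scaleR_add_left sum.distrib flip: N(3))
  have n3: "N $ 3 $ j = \<sigma> * M $ 3 $ j" for j
    by (rule uniq[of "\<lambda>j. N $ 3 $ j" "\<lambda>j. \<sigma> * M $ 3 $ j"])
      (simp add: M(4) scaleR_sum_right flip: N(4))
  have "det N = c * \<beta> * \<sigma> * det M"
    unfolding det_3 n1 n2 n3 by (simp add: algebra_simps)
  then show ?thesis using M(1) N(1) by (simp add: zero_less_mult_iff)
qed

text \<open>Both triples are referred to common vectors \<open>q\<close> and \<open>r\<close>, the
  form in which two parallel edges are compared; expressing the second through the first leads back
  to the triangular case.\<close>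

lemma pos_oriented_opposite:
  fixes b :: "3 \<Rightarrow> 'a::euclidean_space"
  assumes b: "inj b" "independent (range b)"
    and 1: "pos_oriented b (c *\<^sub>R q) (\<alpha> *\<^sub>R q + \<beta> *\<^sub>R r) n"
    and 2: "pos_oriented b (c' *\<^sub>R q) (\<alpha>' *\<^sub>R q + \<beta>' *\<^sub>R r) (\<sigma> *\<^sub>R n)"
    and c: "c \<noteq> 0" and \<beta>: "\<beta> > 0"
  shows "c * c' * (\<beta>' * \<sigma>) > 0"
proof -
  have "c' *\<^sub>R q = (c' / c) *\<^sub>R (c *\<^sub>R q)" using c by simp
  moreover have "\<alpha>' *\<^sub>R q + \<beta>' *\<^sub>R r =
      ((\<alpha>' - (\<beta>' / \<beta>) * \<alpha>) / c) *\<^sub>R (c *\<^sub>R q) + (\<beta>' / \<beta>) *\<^sub>R (\<alpha> *\<^sub>R q + \<beta> *\<^sub>R r)"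
    using c \<beta> by (simp add: scaleR_add_right scaleR_diff_left)
  ultimately have "(c' / c) * (\<beta>' / \<beta>) * \<sigma> > 0"
    using pos_oriented_sign[OF b 1] 2 by metis
  moreover have "c * c * \<beta> > 0" using c \<beta> by (auto simp: zero_less_mult_iff)
  ultimately have "(c' / c) * (\<beta>' / \<beta>) * \<sigma> * (c * c * \<beta>) > 0" by (rule mult_pos_pos)
  then show ?thesis using c \<beta> by (simp add: field_simps)
qed

section \<open>Area forms and cyclic orientations of a polygon\<close>

definition area_form :: "('a::euclidean_space \<Rightarrow> 'a \<Rightarrow> real) \<Rightarrow> 'a set \<Rightarrow> bool" where
  "area_form \<omega> D \<longleftrightarrow> (\<forall>x y z a b. \<omega> (a *\<^sub>R x + b *\<^sub>R y) z = a * \<omega> x z + b * \<omega> y z) \<and>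
     (\<forall>x y. \<omega> y x = - \<omega> x y) \<and> (\<forall>v\<in>D. \<forall>r\<in>D. v \<noteq> 0 \<longrightarrow> r \<notin> span {v} \<longrightarrow> \<omega> v r \<noteq> 0)"

text \<open>The determinant of coordinates read off by two functionals, each vanishing at one vector
  of a basis of \<open>D\<close> and not at the other.\<close>

lemma area_form_exists:
  fixes D :: "'a::euclidean_space set"
  assumes D: "subspace D" "dim D = 2"
  obtains \<omega> where "area_form \<omega> D"
proof -
  obtain q where q: "q \<in> D" "q \<noteq> 0"
    using dim_2_not_in_span_singleton[OF D(2), of 0] by (metis span_0)
  obtain r where r: "r \<in> D" "r \<notin> span {q}" using dim_2_not_in_span_singleton[OF D(2)] .
  then have r0: "r \<noteq> 0" using span_zero by metis
  have qr: "q \<notin> span {r}" using r(2) span_singleton_sym[of q r] q(2) by blast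
  obtain h where h: "h \<bullet> r = 0" "h \<bullet> q \<noteq> 0"
    using exists_orthogonal_nonvanishing[of "{q}" r] qr by auto
  obtain k where k: "k \<bullet> q = 0" "k \<bullet> r \<noteq> 0"
    using exists_orthogonal_nonvanishing[of "{r}" q] r by auto
  define \<omega> where "\<omega> = (\<lambda>x y. (h \<bullet> x) * (k \<bullet> y) - (k \<bullet> x) * (h \<bullet> y))"
  have lin: "\<omega> (a *\<^sub>R x + b *\<^sub>R y) z = a * \<omega> x z + b * \<omega> y z" for a b x y z
    by (simp add: \<omega>_def inner_add_right algebra_simps)
  have anti: "\<omega> y x = - \<omega> x y" for x y by (simp add: \<omega>_def)
  have nz: "\<omega> v s \<noteq> 0" if v: "v \<in> D" "v \<noteq> 0" and s: "s \<in> D" "s \<notin> span {v}" for v s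
  proof
    assume "\<omega> v s = 0"
    obtain a1 b1 where 1: "q = a1 *\<^sub>R v + b1 *\<^sub>R s" using span_pair_coords[OF D v(1) s(1) v(2) s(2) q(1)] .
    obtain a2 b2 where 2: "r = a2 *\<^sub>R v + b2 *\<^sub>R s" using span_pair_coords[OF D v(1) s(1) v(2) s(2) r(1)] .
    have "\<omega> q r = (a1 * b2 - b1 * a2) * \<omega> v s"
      unfolding 1 2 \<omega>_def by (simp add: inner_add_right algebra_simps)
    also have "\<dots> = 0" using \<open>\<omega> v s = 0\<close> by simp
    finally show False using h k by (simp add: \<omega>_def)
  qed
  have "area_form \<omega> D"
    unfolding area_form_def by (intro conjI allI ballI impI lin anti nz)
  then show thesis by (rule that)
qed

context
  fixes \<omega> :: "'a::euclidean_space \<Rightarrow> 'a \<Rightarrow> real" and D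
  assumes \<omega>: "area_form \<omega> D"
begin

lemma area_form_anti: "\<omega> y x = - \<omega> x y"
  using \<omega> unfolding area_form_def by (elim conjE allE)

lemma area_form_self: "\<omega> x x = 0"
  using area_form_anti[of x x] by simp

lemma area_form_left: "\<omega> (a *\<^sub>R x + b *\<^sub>R y) z = a * \<omega> x z + b * \<omega> y z"
  using \<omega> unfolding area_form_def by blast

lemma area_form_right: "\<omega> z (a *\<^sub>R x + b *\<^sub>R y) = a * \<omega> z x + b * \<omega> z y"
  using area_form_left[of a x b y z] area_form_anti[of z "a *\<^sub>R x + b *\<^sub>R y"] area_form_anti[of z x] area_form_anti[of z y]
  by simp

lemma area_form_scale: "\<omega> (a *\<^sub>R x) z = a * \<omega> x z"
  using area_form_left[of a x 0 x z] by simp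

lemma area_form_diff: "\<omega> (x - y) z = \<omega> x z - \<omega> y z" "\<omega> z (x - y) = \<omega> z x - \<omega> z y"
  using area_form_left[of 1 x "-1" y z] area_form_right[of z 1 x "-1" y] by simp_all

lemma area_form_nonzero: "v \<in> D \<Longrightarrow> r \<in> D \<Longrightarrow> v \<noteq> 0 \<Longrightarrow> r \<notin> span {v} \<Longrightarrow> \<omega> v r \<noteq> 0"
  using \<omega> unfolding area_form_def by blast

end

text \<open>\<open>cyclic_orientation\<close> is combinatorial: one edge in and one edge out at
  every vertex. Geometry enters through the sign of the area form. Consecutive edges have the
  polygon on the same side, and since the boundary cannot split into several cycles, one \<sigma>
  serves all edges.\<close>

lemma cyclic_orientation_consistent:
  assumes F: "polytope F" "dim (direction_space F) = 2" and t: "cyclic_orientation F t"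
    and \<omega>: "area_form \<omega> (direction_space F)"
  obtains \<sigma> :: real where "\<And>e y. e edge_of F \<Longrightarrow> y \<in> F \<Longrightarrow> y \<notin> e \<Longrightarrow>
      \<sigma> * \<omega> (snd (t e) - fst (t e)) (y - fst (t e)) > 0"
proof -
  define sgn where "sgn = (\<lambda>(\<sigma>::real) e. \<forall>y\<in>F - e. \<sigma> * \<omega> (snd (t e) - fst (t e)) (y - fst (t e)) > 0)"
  have cF: "convex F" using F polytope_imp_convex by blast
  have t_cyc: "\<forall>v. v extreme_point_of F \<longrightarrow>
      (\<exists>!e. e edge_of F \<and> fst (t e) = v) \<and> (\<exists>!e. e edge_of F \<and> snd (t e) = v)"
    using t unfolding cyclic_orientation_def by (rule conjunct2)
  have cyc: "\<exists>e. e edge_of F \<and> fst (t e) = v" "\<exists>e. e edge_of F \<and> snd (t e) = v"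
    "\<And>e e'. e edge_of F \<Longrightarrow> e' edge_of F \<Longrightarrow> fst (t e) = v \<Longrightarrow> fst (t e') = v \<Longrightarrow> e = e'"
    if "v extreme_point_of F" for v
  proof -
    note c = t_cyc[rule_format, OF that]
    show "\<exists>e. e edge_of F \<and> fst (t e) = v" using c[THEN conjunct1] by (rule ex1_implies_ex)
    show "\<exists>e. e edge_of F \<and> snd (t e) = v" using c[THEN conjunct2] by (rule ex1_implies_ex)
    show "e = e'" if "e edge_of F" "e' edge_of F" "fst (t e) = v" "fst (t e') = v" for e e'
      using c[THEN conjunct1] that by (auto elim!: ex1E)
  qed
  have or: "fst (t e) \<noteq> snd (t e)" "e = closed_segment (fst (t e)) (snd (t e))" if "e edge_of F" for e
    using t that by (simp_all add: cyclic_orientation_def orients_def)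
  have ends: "fst (t e) \<in> e" "snd (t e) \<in> e" if "e edge_of F" for e
    using or(2)[OF that] by (metis ends_in_segment)+
  have endsF: "fst (t e) \<in> F" "snd (t e) \<in> F" if "e edge_of F" for e
    using ends[OF that] edge_of_imp_subset[OF that] by blast+
  have vert: "fst (t e) extreme_point_of F" "snd (t e) extreme_point_of F" if "e edge_of F" for e
  proof -
    have "e face_of F" using that by (simp add: edge_of_def)
    moreover have "fst (t e) extreme_point_of e" "snd (t e) extreme_point_of e"
      using or(2)[OF that] extreme_point_of_segment by metis+
    ultimately show "fst (t e) extreme_point_of F" "snd (t e) extreme_point_of F"
      using extreme_point_of_face by blast+
  qed
  have dirD: "snd (t e) - fst (t e) \<in> direction_space F" if "e edge_of F" for e
    using endsF[OF that] diff_in_direction_space by blast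
  have sgn_cases: "sgn 1 e \<or> sgn (- 1) e" if e: "e edge_of F" for e
  proof -
    let ?v = "snd (t e) - fst (t e)"
    have v: "?v \<in> direction_space F" "?v \<noteq> 0" using dirD[OF e] or(1)[OF e] by auto
    obtain r where r: "r \<in> direction_space F" "r \<notin> span {?v}" using dim_2_not_in_span_singleton[OF F(2)] .
    have de: "direction_space e = span {?v}" using or(2)[OF e] direction_space_segment by metis
    have side: "sgn 1 e \<or> sgn (- 1) e" if s: "e \<in> side_edges F ?v s" "s = r \<or> s = - r" for s
    proof -
      have "\<omega> ?v r \<noteq> 0" using area_form_nonzero[OF \<omega> v(1) r(1) v(2) r(2)] .
      moreover have "\<omega> ?v (- r) = - \<omega> ?v r" using area_form_diff(2)[OF \<omega>, of ?v 0 r] area_form_diff(2)[OF \<omega>, of ?v r r] by simp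
      ultimately have nz: "\<omega> ?v s \<noteq> 0" using s(2) by auto
      have val: "\<exists>\<beta>>0. \<omega> ?v (y - fst (t e)) = \<beta> * \<omega> ?v s" if y: "y \<in> F - e" for y
      proof -
        obtain \<alpha> \<beta> where ab: "\<beta> > 0" "y - fst (t e) = \<alpha> *\<^sub>R ?v + \<beta> *\<^sub>R s"
          using s(1) y ends(1)[OF e] unfolding side_edges_def by blast
        then show ?thesis using area_form_right[OF \<omega>, of ?v \<alpha> ?v \<beta> s] area_form_self[OF \<omega>, of ?v] by auto
      qed
      show ?thesis
      proof (cases "\<omega> ?v s > 0")
        case True
        then have "sgn 1 e" unfolding sgn_def using val by fastforce
        then show ?thesis ..
      next
        case False
        then have "\<omega> ?v s < 0" using nz by simp
        have "- 1 * \<omega> ?v (y - fst (t e)) > 0" if y: "y \<in> F - e" for y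
        proof -
          obtain \<beta> where "\<beta> > 0" "\<omega> ?v (y - fst (t e)) = \<beta> * \<omega> ?v s" using val[OF y] by blast
          then show ?thesis using \<open>\<omega> ?v s < 0\<close> by (simp add: mult_pos_neg)
        qed
        then have "sgn (- 1) e" unfolding sgn_def by blast
        then show ?thesis ..
      qed
    qed
    show ?thesis using side_edges_cases[OF F v r e de] side by blast
  qed
  have sgn_excl: "\<not> (sgn \<sigma> e \<and> sgn (- \<sigma>) e)" if e: "e edge_of F" for e \<sigma>
  proof
    assume *: "sgn \<sigma> e \<and> sgn (- \<sigma>) e"
    obtain y where y: "y \<in> F - e" using edge_proper[OF F(2) e] by blast
    let ?x = "\<omega> (snd (t e) - fst (t e)) (y - fst (t e))"
    have "\<sigma> * ?x > 0" "- \<sigma> * ?x > 0" using * y unfolding sgn_def by blast+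
    then show False by simp
  qed
  \<comment> \<open>For the edge \<open>e1\<close> leaving \<open>v\<close> and the edge
    \<open>e2\<close> entering it, each sign is tested at the far end of the other edge, and both
    tests evaluate the same area.\<close>
  have local: "snd (t e1) \<in> F - e2 \<and> fst (t e2) \<in> F - e1 \<and>
      \<omega> (snd (t e2) - fst (t e2)) (snd (t e1) - fst (t e2)) = \<omega> (snd (t e1) - v) (fst (t e2) - v)"
    if e: "e1 edge_of F" "e2 edge_of F" "fst (t e1) = v" "snd (t e2) = v" for e1 e2 v
  proof -
    have "e1 \<noteq> e2" using or(1)[OF e(1)] e(3,4) by auto
    have "fst (t e2) \<notin> e1"
    proof
      assume "fst (t e2) \<in> e1"
      moreover have "v \<in> e1" using ends(1)[OF e(1)] e(3) by simp
      moreover have "convex e1" using e(1) face_of_imp_convex by (auto simp: edge_of_def)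
      ultimately have "e2 \<subseteq> e1" using or(2)[OF e(2)] e(4) closed_segment_subset by metis
      then show False using edge_subset_imp_eq[OF cF e(2,1)] \<open>e1 \<noteq> e2\<close> by blast
    qed
    moreover have "snd (t e1) \<notin> e2"
    proof
      assume "snd (t e1) \<in> e2"
      moreover have "v \<in> e2" using ends(2)[OF e(2)] e(4) by simp
      moreover have "convex e2" using e(2) face_of_imp_convex by (auto simp: edge_of_def)
      ultimately have "e1 \<subseteq> e2" using or(2)[OF e(1)] e(3) closed_segment_subset by metis
      then show False using edge_subset_imp_eq[OF cF e(1,2)] \<open>e1 \<noteq> e2\<close> by blast
    qed
    moreover have "\<omega> (v - fst (t e2)) (snd (t e1) - fst (t e2)) = \<omega> (snd (t e1) - v) (fst (t e2) - v)"
      using area_form_self[OF \<omega>, of "fst (t e2)"] area_form_self[OF \<omega>, of v]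
        area_form_anti[OF \<omega>, of "snd (t e1)" v] area_form_anti[OF \<omega>, of "snd (t e1)" "fst (t e2)"]
        area_form_anti[OF \<omega>, of "fst (t e2)" v]
      by (simp add: area_form_diff[OF \<omega>])
    ultimately show ?thesis using endsF e by simp
  qed
  have sgn_adj: "sgn \<sigma> e1 \<longleftrightarrow> sgn \<sigma> e2"
    if e: "e1 edge_of F" "e2 edge_of F" "fst (t e1) = v" "snd (t e2) = v" and \<sigma>: "\<sigma> = 1 \<or> \<sigma> = -1" for e1 e2 v \<sigma>
  proof -
    have iff: "sgn \<tau> e1 \<Longrightarrow> sgn \<tau> e2" "sgn \<tau> e2 \<Longrightarrow> sgn \<tau> e1" if \<tau>: "\<tau> = 1 \<or> \<tau> = -1" for \<tau>
    proof -
      let ?x = "\<omega> (snd (t e1) - v) (fst (t e2) - v)"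
      note l = local[OF e]
      have p1: "\<tau>' * ?x > 0" if "sgn \<tau>' e1" for \<tau>'
      proof -
        have "\<tau>' * \<omega> (snd (t e1) - fst (t e1)) (fst (t e2) - fst (t e1)) > 0"
          using that l unfolding sgn_def by blast
        then show ?thesis using e(3) by simp
      qed
      have p2: "\<tau>' * ?x > 0" if "sgn \<tau>' e2" for \<tau>'
      proof -
        have "\<tau>' * \<omega> (snd (t e2) - fst (t e2)) (snd (t e1) - fst (t e2)) > 0"
          using that l unfolding sgn_def by blast
        then show ?thesis using l by simp
      qed
      have opp: "\<tau> * ?x > 0 \<Longrightarrow> - \<tau> * ?x > 0 \<Longrightarrow> False" by simp
      have c: "sgn \<tau> e1 \<or> sgn (- \<tau>) e1" "sgn \<tau> e2 \<or> sgn (- \<tau>) e2"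
        using sgn_cases[OF e(1)] sgn_cases[OF e(2)] \<tau> by auto
      show "sgn \<tau> e1 \<Longrightarrow> sgn \<tau> e2" using p1 p2 opp c by blast
      show "sgn \<tau> e2 \<Longrightarrow> sgn \<tau> e1" using p1 p2 opp c by blast
    qed
    then show ?thesis using \<sigma> by blast
  qed
  \<comment> \<open>The polygon lies in the cone at \<open>v\<close> spanned by the two edges there,
    so a maximum along these edges is a global one, as in the simplex method.\<close>
  have cone: "f \<bullet> y \<le> f \<bullet> v"
    if e: "e1 edge_of F" "e2 edge_of F" "fst (t e1) = v" "snd (t e2) = v" and s: "sgn 1 e1" "sgn 1 e2"
      and f: "f \<bullet> snd (t e1) \<le> f \<bullet> v" "f \<bullet> fst (t e2) \<le> f \<bullet> v" and y: "y \<in> F" for e1 e2 v f y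
  proof -
    note l = local[OF e]
    let ?a = "snd (t e1) - v" and ?b = "fst (t e2) - v"
    have fab: "f \<bullet> ?a \<le> 0" "f \<bullet> ?b \<le> 0" using f by (simp_all add: inner_diff_right)
    have vF: "v \<in> F" using endsF(1)[OF e(1)] e(3) by simp
    have pos: "\<omega> ?a ?b > 0" using s(1) l e(3) unfolding sgn_def by auto
    have seg: "f \<bullet> y \<le> f \<bullet> v" if "y \<in> closed_segment v p" "f \<bullet> p \<le> f \<bullet> v" for p
    proof -
      obtain u where u: "0 \<le> u" "y = (1 - u) *\<^sub>R v + u *\<^sub>R p" using \<open>y \<in> closed_segment v p\<close>
        by (auto simp: closed_segment_def)
      have "f \<bullet> y = f \<bullet> v + u * (f \<bullet> p - f \<bullet> v)" unfolding u(2) by (simp add: inner_add_right algebra_simps)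
      then show ?thesis using u(1) that(2) by (simp add: mult_le_0_iff)
    qed
    consider "y \<in> e1" | "y \<in> e2" | "y \<notin> e1" "y \<notin> e2" by blast
    then show ?thesis
    proof cases
      case 1
      then show ?thesis using seg or(2)[OF e(1)] e(3) f(1) by metis
    next
      case 2
      then show ?thesis using seg or(2)[OF e(2)] e(4) f(2) closed_segment_commute by metis
    next
      case 3
      have a0: "?a \<noteq> 0" using or(1)[OF e(1)] e(3) by auto
      have bn: "?b \<notin> span {?a}"
      proof
        assume "?b \<in> span {?a}"
        then obtain c where "?b = c *\<^sub>R ?a" by (auto simp: span_singleton)
        then have "\<omega> ?b ?a = 0" using area_form_scale[OF \<omega>, of c ?a ?a] area_form_self[OF \<omega>, of ?a] by simp
        then show False using pos area_form_anti[OF \<omega>, of ?a ?b] by simp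
      qed
      have abD: "?a \<in> direction_space F" "?b \<in> direction_space F" "y - v \<in> direction_space F"
        using endsF e vF y by (auto intro!: diff_in_direction_space)
      obtain \<alpha> \<beta> where ab: "y - v = \<alpha> *\<^sub>R ?a + \<beta> *\<^sub>R ?b"
        using span_pair_coords[OF subspace_direction_space F(2) abD(1,2) a0 bn abD(3)] .
      have "\<omega> ?a (y - v) > 0" using s(1) 3(1) y e(3) unfolding sgn_def by auto
      then have "\<beta> * \<omega> ?a ?b > 0"
        unfolding ab using area_form_right[OF \<omega>, of ?a \<alpha> ?a \<beta> ?b] area_form_self[OF \<omega>, of ?a] by simp
      then have \<beta>: "\<beta> > 0" using pos by (simp add: zero_less_mult_iff)
      have "\<omega> (v - fst (t e2)) (y - fst (t e2)) > 0" using s(2) 3(2) y e(4) unfolding sgn_def by auto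
      moreover have "\<omega> (v - fst (t e2)) (y - fst (t e2)) = \<omega> (y - v) ?b"
        using area_form_self[OF \<omega>, of "fst (t e2)"] area_form_self[OF \<omega>, of v]
        area_form_anti[OF \<omega>, of y v] area_form_anti[OF \<omega>, of y "fst (t e2)"]
        area_form_anti[OF \<omega>, of "fst (t e2)" v]
        by (simp add: area_form_diff[OF \<omega>])
      ultimately have "\<alpha> * \<omega> ?a ?b > 0"
        unfolding ab using area_form_left[OF \<omega>, of \<alpha> ?a \<beta> ?b ?b] area_form_self[OF \<omega>, of ?b] by simp
      then have \<alpha>: "\<alpha> > 0" using pos by (simp add: zero_less_mult_iff)
      have "f \<bullet> (y - v) = \<alpha> * (f \<bullet> ?a) + \<beta> * (f \<bullet> ?b)" unfolding ab by (simp add: inner_add_right)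
      also have "\<dots> \<le> 0" using fab \<alpha> \<beta> by (intro add_nonpos_nonpos mult_nonneg_nonpos) auto
      finally show ?thesis by (simp add: inner_diff_right)
    qed
  qed
  \<comment> \<open>Connectedness of the boundary. The tails of positive edges are closed under
    passing to neighbours, so where \<open>f\<close> is largest among them it is largest on
    \<open>F\<close>. As \<open>f\<close> exposes the tail of a negative edge, that edge would be
    positive as well.\<close>
  have all: "sgn (- 1) e' \<Longrightarrow> \<not> sgn 1 e" if e: "e edge_of F" "e' edge_of F" for e e'
  proof
    assume s: "sgn 1 e" and s': "sgn (- 1) e'"
    define T where "T = {v. \<exists>e. e edge_of F \<and> fst (t e) = v \<and> sgn 1 e}"
    have "T \<subseteq> {x. x extreme_point_of F}" using vert by (auto simp: T_def)
    then have finT: "finite T" using finite_vertices[OF F(1)] finite_subset by blast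
    have neT: "T \<noteq> {}" using s e(1) by (auto simp: T_def)
    obtain f where f: "max_face f F = {fst (t e')}" using vertex_eq_max_face[OF F(1) vert(1)[OF e(2)]] .
    have "Max ((\<bullet>) f ` T) \<in> (\<bullet>) f ` T" using finT neT by (intro Max_in) auto
    then obtain v where v1: "v \<in> T" "Max ((\<bullet>) f ` T) = f \<bullet> v" by blast
    have v: "v \<in> T" "f \<bullet> w \<le> f \<bullet> v" if "w \<in> T" for w
      using v1 Max_ge[of "(\<bullet>) f ` T" "f \<bullet> w"] finT that by auto
    obtain e1 where e1: "e1 edge_of F" "fst (t e1) = v" "sgn 1 e1" using v1(1) by (auto simp: T_def)
    have vv: "v extreme_point_of F" using vert(1)[OF e1(1)] e1(2) by simp
    obtain e2 where e2: "e2 edge_of F" "snd (t e2) = v" using cyc(2)[OF vv] by blast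
    have s2: "sgn 1 e2" using sgn_adj[OF e1(1) e2(1) e1(2) e2(2)] e1(3) by simp
    have y2: "fst (t e2) \<in> T" using e2 s2 by (auto simp: T_def)
    obtain e3 where e3: "e3 edge_of F" "fst (t e3) = snd (t e1)"
      using cyc(1)[OF vert(2)[OF e1(1)]] by blast
    have "sgn 1 e3" using sgn_adj[OF e3(1) e1(1) e3(2) refl] e1(3) by simp
    then have y1: "snd (t e1) \<in> T" using e3 by (auto simp: T_def)
    have "f \<bullet> fst (t e') \<le> f \<bullet> v"
      using cone[OF e1(1) e2(1) e1(2) e2(2) e1(3) s2 v(2)[OF y1] v(2)[OF y2]] endsF(1)[OF e(2)] by blast
    then have "v = fst (t e')"
      using max_face_less[of "fst (t e')" f F v] f vertex_in[OF vv] by fastforce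
    then have "e1 = e'"
      using cyc(3)[OF vv e1(1) e(2) e1(2)] by simp
    then show False using sgn_excl[OF e(2), of 1] e1(3) s' by simp
  qed
  show thesis
  proof (cases "\<exists>e. e edge_of F \<and> sgn (- 1) e")
    case True
    then have "\<forall>e. e edge_of F \<longrightarrow> sgn (- 1) e" using all sgn_cases by blast
    then show thesis using that[of "- 1"] unfolding sgn_def by blast
  next
    case False
    then have "\<forall>e. e edge_of F \<longrightarrow> sgn 1 e" using sgn_cases by blast
    then show thesis using that[of 1] unfolding sgn_def by blast
  qed
qed

section \<open>Compensating edges\<close>

lemma partition_into_pairs:
  assumes sym: "\<And>x y. R x y \<Longrightarrow> R y x"
    and ex: "\<And>x. x \<in> E \<Longrightarrow> \<exists>y\<in>E. R x y"
    and uniq: "\<And>x y z. x \<in> E \<Longrightarrow> R x y \<Longrightarrow> R x z \<Longrightarrow> y \<in> E \<Longrightarrow> z \<in> E \<Longrightarrow> y = z"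
  shows "partition_on E {{x, y} | x y. x \<in> E \<and> y \<in> E \<and> R x y}" (is "partition_on E ?C")
proof (rule partition_onI)
  show "\<Union> ?C = E" using ex by blast
  show "{} \<notin> ?C" by blast
  show "disjnt p p'" if pp: "p \<in> ?C" "p' \<in> ?C" "p \<noteq> p'" for p p'
  proof (rule ccontr)
    assume "\<not> disjnt p p'"
    then obtain z where z: "z \<in> p" "z \<in> p'" by (auto simp: disjnt_def)
    have shape: "\<exists>y\<in>E. R z y \<and> X = {z, y}" if X: "X \<in> ?C" "z \<in> X" for X
    proof -
      obtain x y where xy: "X = {x, y}" "x \<in> E" "y \<in> E" "R x y" using X(1) by blast
      then consider "z = x" | "z = y" using X(2) by blast
      then show ?thesis
      proof cases
        case 1
        then show ?thesis using xy by blast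
      next
        case 2
        then show ?thesis using xy sym[OF xy(4)] by (auto simp: insert_commute)
      qed
    qed
    obtain y y' where "y \<in> E" "R z y" "p = {z, y}" "y' \<in> E" "R z y'" "p' = {z, y'}"
      using shape[OF pp(1) z(1)] shape[OF pp(2) z(2)] by blast
    moreover have "z \<in> E" using pp(1) z(1) by blast
    ultimately show False using uniq[of z y y'] pp(3) by simp
  qed
qed

lemma simultaneously_visible_sym:
  assumes "simultaneously_visible P F F'" "F' \<noteq> {}"
  shows "simultaneously_visible P F' F"
proof -
  obtain W where par: "(F, F') \<in> parallel_rel P" and neq: "F \<noteq> F'"
    and W: "only_degenerating_class P F W" "visible P W F" "visible P W F'"
    using assms by (auto simp: simultaneously_visible_def)
  have "face_class P F' = face_class P F"
    unfolding face_class_def using equiv_class_eq[OF equiv_parallel_rel par] by simp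
  then have "only_degenerating_class P F' W" using W(1) by (simp add: only_degenerating_class_def)
  moreover have "(F', F) \<in> parallel_rel P" using par by (auto simp: parallel_rel_def)
  ultimately show ?thesis using neq W unfolding simultaneously_visible_def by blast
qed

lemma simultaneously_visible_two_face:
  assumes "simultaneously_visible P F F'"
  shows "F \<in> two_faces P"
  using assms by (auto simp: simultaneously_visible_def parallel_rel_def)

lemma edge_direction_coords:
  assumes F: "polytope F" "dim (direction_space F) = 2" and e: "e edge_of F"
  obtains q r where "q \<in> direction_space F" "q \<noteq> 0" "r \<in> direction_space F" "r \<notin> span {q}"
    "e \<in> side_edges F q r"
proof -
  obtain a b where ab: "a \<noteq> b" "e = closed_segment a b" using edge_eq_segment[OF F(1) e] .
  define q where "q = b - a"
  have "a \<in> e" "b \<in> e" using ab by auto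
  then have "a \<in> F" "b \<in> F" using edge_of_imp_subset[OF e] by blast+
  then have q: "q \<in> direction_space F" "q \<noteq> 0"
    using ab(1) diff_in_direction_space by (auto simp: q_def)
  have de: "direction_space e = span {q}" using ab direction_space_segment by (simp add: q_def)
  obtain r where r: "r \<in> direction_space F" "r \<notin> span {q}" using dim_2_not_in_span_singleton[OF F(2)] .
  have mr: "- r \<in> direction_space F" "- r \<notin> span {q}"
    using uminus_transversal[OF r] by blast+
  show thesis using side_edges_cases[OF F q r e de] that[OF q r] that[OF q mr] by blast
qed

lemma orients_direction:
  assumes "orients p e" "direction_space e = span {q}"
  obtains c where "c \<noteq> 0" "snd p - fst p = c *\<^sub>R q"
proof -
  have p: "fst p \<noteq> snd p" "e = closed_segment (fst p) (snd p)" using assms by (auto simp: orients_def)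
  then have "snd p - fst p \<in> span {q}"
    using assms(2) direction_space_segment span_base[of "snd p - fst p" "{snd p - fst p}"] by (metis insertI1)
  then obtain c where "snd p - fst p = c *\<^sub>R q" by (auto simp: span_singleton)
  then show thesis using that p(1) by (metis right_minus_eq scaleR_zero_left)
qed

lemma parallel_opposite_scaleR:
  assumes "snd p - fst p = c *\<^sub>R q" "snd p' - fst p' = c' *\<^sub>R q" "c * c' < 0"
  shows "parallel_opposite p p'"
proof -
  have "c' \<noteq> 0" "- (c / c') > 0" using assms(3) by (auto simp: mult_less_0_iff divide_less_0_iff)
  moreover have "snd p - fst p = - ((- (c / c')) *\<^sub>R (snd p' - fst p'))"
    using assms(1,2) \<open>c' \<noteq> 0\<close> by simp
  ultimately show ?thesis unfolding parallel_opposite_def by blast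
qed

lemma side_edge_inward:
  assumes "dim (direction_space F) = 2" "e \<in> side_edges F q r"
  obtains \<alpha> \<beta> where "\<beta> > 0" "points_into e F (\<alpha> *\<^sub>R q + \<beta> *\<^sub>R r)"
proof -
  have e: "e edge_of F" using assms by (simp add: side_edges_def)
  obtain y where y: "y \<in> F - e" using edge_proper[OF assms(1) e] by blast
  obtain x where x: "x \<in> e" using e by (force simp: edge_of_def)
  obtain \<alpha> \<beta> where "\<beta> > 0" "y - x = \<alpha> *\<^sub>R q + \<beta> *\<^sub>R r"
    using assms(2) x y unfolding side_edges_def by blast
  moreover have "points_into e F (y - x)" using x y unfolding points_into_def by blast
  ultimately show thesis using that by simp
qed

text \<open>Parallel edges run in opposite directions when exactly one factor of the determinant
  changes sign: the side, for two edges of one face (\<tau> = -1), or the outward normal, for edges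
  of the two faces on the same side (\<sigma> = -1).\<close>

lemma counterclockwise_opposite:
  fixes b :: "3 \<Rightarrow> 'a::euclidean_space"
  assumes b: "inj b" "independent (range b)"
    and cc: "counterclockwise b Q F t" "counterclockwise b Q G t'"
    and n: "outward_normal Q F n" "outward_normal Q G (\<sigma> *\<^sub>R n)"
    and d: "dim (direction_space F) = 2" "dim (direction_space G) = 2"
    and e: "e \<in> side_edges F q r" "e' \<in> side_edges G q (\<tau> *\<^sub>R r)" and st: "\<sigma> * \<tau> < 0"
  shows "parallel_opposite (t e) (t' e')"
proof -
  have e1: "e edge_of F" "direction_space e = span {q}" using e(1) by (auto simp: side_edges_def)
  have e2: "e' edge_of G" "direction_space e' = span {q}" using e(2) by (auto simp: side_edges_def)
  obtain c where c: "c \<noteq> 0" "snd (t e) - fst (t e) = c *\<^sub>R q"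
    using cc(1) e1 orients_direction unfolding counterclockwise_def by metis
  obtain c' where c': "c' \<noteq> 0" "snd (t' e') - fst (t' e') = c' *\<^sub>R q"
    using cc(2) e2 orients_direction unfolding counterclockwise_def by metis
  obtain \<alpha> \<beta> where w: "\<beta> > 0" "points_into e F (\<alpha> *\<^sub>R q + \<beta> *\<^sub>R r)"
    using side_edge_inward[OF d(1) e(1)] .
  obtain \<alpha>' \<beta>' where w': "\<beta>' > 0" "points_into e' G (\<alpha>' *\<^sub>R q + \<beta>' *\<^sub>R (\<tau> *\<^sub>R r))"
    using side_edge_inward[OF d(2) e(2)] .
  have p: "pos_oriented b (c *\<^sub>R q) (\<alpha> *\<^sub>R q + \<beta> *\<^sub>R r) n"
    using cc(1) e1(1) w(2) n(1) c(2) unfolding counterclockwise_def by metis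
  have p': "pos_oriented b (c' *\<^sub>R q) (\<alpha>' *\<^sub>R q + (\<beta>' * \<tau>) *\<^sub>R r) (\<sigma> *\<^sub>R n)"
    using cc(2) e2(1) w'(2) n(2) c'(2) unfolding counterclockwise_def by (metis scaleR_scaleR)
  have "c * c' * (\<beta>' * \<tau> * \<sigma>) > 0" by (rule pos_oriented_opposite[OF b p p' c(1) w(1)])
  moreover have "\<beta>' * \<tau> * \<sigma> < 0" using mult_pos_neg[OF w'(1) st] by (simp add: algebra_simps)
  ultimately have "c * c' < 0" by (metis mult_neg_neg mult_nonneg_nonpos not_le order_less_imp_le)
  then show ?thesis using parallel_opposite_scaleR c c' by blast
qed

text \<open>All edges keep the polygon on the same hand; two parallel edges facing it from opposite
  sides must therefore run in opposite directions.\<close>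

lemma cyclic_orientation_opposite:
  assumes F: "polytope F" "dim (direction_space F) = 2" and t: "cyclic_orientation F t"
    and e: "e \<in> side_edges F q r" "e' \<in> side_edges F q (- r)"
  shows "parallel_opposite (t e) (t e')"
proof -
  obtain \<omega> where \<omega>: "area_form \<omega> (direction_space F)"
    using area_form_exists[OF subspace_direction_space F(2)] by blast
  obtain \<sigma> where \<sigma>: "\<And>e y. e edge_of F \<Longrightarrow> y \<in> F \<Longrightarrow> y \<notin> e \<Longrightarrow>
      \<sigma> * \<omega> (snd (t e) - fst (t e)) (y - fst (t e)) > 0"
    using cyclic_orientation_consistent[OF F t \<omega>] by blast
  have main: "\<exists>c. c \<noteq> 0 \<and> snd (t e) - fst (t e) = c *\<^sub>R q \<and> \<sigma> * c * \<omega> q s > 0"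
    if e: "e \<in> side_edges F q s" for e s
  proof -
    have ee: "e edge_of F" "direction_space e = span {q}" using e by (auto simp: side_edges_def)
    have or: "orients (t e) e" using t ee by (simp add: cyclic_orientation_def)
    then obtain c where c: "c \<noteq> 0" "snd (t e) - fst (t e) = c *\<^sub>R q"
      using orients_direction ee(2) by metis
    obtain y where y: "y \<in> F - e" using edge_proper[OF F(2) ee(1)] by blast
    have "fst (t e) \<in> e" using or unfolding orients_def by (metis ends_in_segment(1))
    then obtain \<alpha> \<beta> where ab: "\<beta> > 0" "y - fst (t e) = \<alpha> *\<^sub>R q + \<beta> *\<^sub>R s"
      using e y unfolding side_edges_def by blast
    have "0 < \<sigma> * \<omega> (c *\<^sub>R q) (\<alpha> *\<^sub>R q + \<beta> *\<^sub>R s)"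
      using \<sigma>[OF ee(1), of y] y c(2) ab(2) by simp
    also have "\<dots> = \<beta> * (\<sigma> * c * \<omega> q s)"
      by (simp add: area_form_scale[OF \<omega>] area_form_right[OF \<omega>] area_form_self[OF \<omega>])
    finally show ?thesis using c ab(1) by (auto simp: zero_less_mult_iff)
  qed
  obtain c where c: "snd (t e) - fst (t e) = c *\<^sub>R q" "\<sigma> * c * \<omega> q r > 0" using main[OF e(1)] by blast
  obtain c' where c': "snd (t e') - fst (t e') = c' *\<^sub>R q" "\<sigma> * c' * \<omega> q (- r) > 0" using main[OF e(2)] by blast
  have "\<omega> q (- r) = - \<omega> q r" using area_form_right[OF \<omega>, of q "-1" r 0 r] by simp
  then have "\<sigma> * c' * \<omega> q r < 0" using c'(2) by simp
  then have "(\<sigma> * c * \<omega> q r) * (\<sigma> * c' * \<omega> q r) < 0" by (rule mult_pos_neg[OF c(2)])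
  then have "(c * c') * (\<sigma> * \<omega> q r)\<^sup>2 < 0" by (simp add: power2_eq_square mult.assoc mult.left_commute)
  then have "c * c' < 0" by (metis mult_nonneg_nonneg not_le zero_le_power2)
  then show ?thesis using parallel_opposite_scaleR c c' by blast
qed

text \<open>A functional exposing \<open>F\<close> need not lie in the direction space of the
  intersected polytope, as an outward normal must. Projecting it there preserves its values on
  differences of points of that polytope.\<close>

lemma outward_normals_pair:
  assumes P: "polytope P" "aff_dim P \<ge> 3" and sv: "simultaneously_visible P F F'" "F' \<noteq> {}"
  obtains n where "outward_normal (P \<inter> affine hull (F \<union> F')) F n"
    "outward_normal (P \<inter> affine hull (F \<union> F')) F' (- n)"
proof -
  let ?Q = "P \<inter> affine hull (F \<union> F')"
  obtain m where m: "max_face m P = F" "max_face (- m) P = F'"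
    using simultaneously_visible_pair[OF P sv] by blast
  have neq: "F \<noteq> F'" using sv by (auto simp: simultaneously_visible_def)
  have "F \<in> two_faces P" "F' \<in> two_faces P"
    using simultaneously_visible_two_face sv simultaneously_visible_sym by blast+
  then have ne: "F \<noteq> {}" "F' \<noteq> {}" using two_faceD(3) by blast+
  have sub: "F \<subseteq> ?Q" "F' \<subseteq> ?Q"
    using m max_face_subset hull_subset[of "F \<union> F'" affine] by blast+
  define n where "n = orth_proj (direction_space ?Q) m"
  have nD: "n \<in> direction_space ?Q" unfolding n_def by (rule orth_proj) simp
  have nm: "n \<bullet> (x - g) = m \<bullet> (x - g)" if "x \<in> ?Q" "g \<in> ?Q" for x g
  proof -
    have "orth_proj (direction_space ?Q) (x - g) = x - g"
      by (rule orth_proj_eqI[OF subspace_direction_space diff_in_direction_space[OF that]])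
        (simp add: orthogonal_comp_def orthogonal_def)
    then show ?thesis unfolding n_def using inner_orth_proj2[OF subspace_direction_space] by metis
  qed
  obtain g g' where g: "g \<in> F" "g' \<in> F'" using ne by blast
  \<comment> \<open>Equal values would put all of \<open>P\<close> into both faces and make them
    equal. The inequality keeps the projected functional nonzero.\<close>
  have "m \<bullet> g \<noteq> m \<bullet> g'"
  proof
    assume eq: "m \<bullet> g = m \<bullet> g'"
    have gm: "g \<in> max_face m P" "g' \<in> max_face (- m) P" using g m by auto
    have "m \<bullet> y = m \<bullet> g" if "y \<in> P" for y
      using max_face_le[OF gm(1) that] max_face_le[OF gm(2) that] eq by simp
    then have "P \<subseteq> F" "P \<subseteq> F'"
      using in_max_face_iff[OF gm(1)] in_max_face_iff[OF gm(2)] m eq by auto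
    then show False using neq sub by blast
  qed
  then have "n \<bullet> (g - g') \<noteq> 0" using nm g sub by (simp add: inner_diff_right subset_eq)
  then have n0: "n \<noteq> 0" by auto
  have "n \<bullet> x \<le> n \<bullet> g" if "g \<in> F" "x \<in> ?Q" for g x
  proof -
    have "m \<bullet> x \<le> m \<bullet> g" using max_face_le[of g m P x] that m by blast
    then have "n \<bullet> (x - g) \<le> 0" using nm that sub by (simp add: inner_diff_right subset_eq)
    then show ?thesis by (simp add: inner_diff_right)
  qed
  moreover have "- n \<bullet> x \<le> - n \<bullet> g" if "g \<in> F'" "x \<in> ?Q" for g x
  proof -
    have "- m \<bullet> x \<le> - m \<bullet> g" using max_face_le[of g "- m" P x] that m by blast
    then have "n \<bullet> (x - g) \<ge> 0" using nm that sub by (simp add: inner_diff_right subset_eq)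
    then show ?thesis by (simp add: inner_diff_right)
  qed
  moreover have "- n \<noteq> 0" using n0 by simp
  ultimately have "outward_normal ?Q F n" "outward_normal ?Q F' (- n)"
    using nD n0 subspace_neg[OF subspace_direction_space nD] unfolding outward_normal_def by blast+
  then show thesis by (rule that)
qed

section \<open>The canonical pairing of edge-2-faces\<close>

definition opposite_edges :: "'a::euclidean_space set \<Rightarrow> 'a set \<Rightarrow> 'a set set" where
  "opposite_edges F e = {e'. e' edge_of F \<and> e' \<noteq> e \<and> direction_space e' = direction_space e}"

text \<open>This frees the opposite edge from the auxiliary choice of \<open>q\<close> and
  \<open>r\<close>, so that the pairing depends on the faces alone.\<close>

lemma opposite_edges_eq:
  assumes F: "polytope F" "dim (direction_space F) = 2"
    and q: "q \<in> direction_space F" "q \<noteq> 0" and r: "r \<in> direction_space F" "r \<notin> span {q}"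
    and e: "e \<in> side_edges F q r"
  shows "opposite_edges F e = side_edges F q (- r)"
proof
  have de: "direction_space e = span {q}" using e by (simp add: side_edges_def)
  show "opposite_edges F e \<subseteq> side_edges F q (- r)"
    using side_edges_cases[OF F q r] side_edges_unique[OF F q r _ e] de by (auto simp: opposite_edges_def)
  show "side_edges F q (- r) \<subseteq> opposite_edges F e"
    using side_edges_disjoint[OF F q r] e de by (auto simp: opposite_edges_def side_edges_def)
qed

text \<open>Both cases mention both edges, redundantly, so that the relation is visibly symmetric.\<close>

fun partner :: "'a::euclidean_space set \<times> 'a set \<times> 'a set \<Rightarrow> 'a set \<times> 'a set \<times> 'a set \<Rightarrow> bool" where
  "partner (e, F, F') (e', G, G') \<longleftrightarrow>
     F = G \<and> F' = G' \<and> e \<in> opposite_edges F e' \<and> e' \<in> opposite_edges F e \<or>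
     F = G' \<and> F' = G \<and> F \<noteq> F' \<and> opposite_edges F e = {} \<and> opposite_edges F' e' = {} \<and>
       direction_space e = direction_space e'"

lemma partner_sym: "partner x y \<Longrightarrow> partner y x"
  by (cases x; cases y) auto

lemma partner_unique:
  fixes P :: "'a::euclidean_space set"
  assumes P: "polytope P" and E: "x \<in> edge_two_faces P" "y \<in> edge_two_faces P" "z \<in> edge_two_faces P"
    and xy: "partner x y" and xz: "partner x z"
  shows "y = z"
proof -
  obtain e F F' where x: "x = (e, F, F')" by (cases x)
  obtain e1 G1 G1' where y: "y = (e1, G1, G1')" by (cases y)
  obtain e2 G2 G2' where z: "z = (e2, G2, G2')" by (cases z)
  have sv: "simultaneously_visible P F F'" and e: "e edge_of F"
    and e1: "e1 edge_of G1" and e2: "e2 edge_of G2"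
    using E by (auto simp: x y z edge_two_faces_def)
  have F: "F \<in> two_faces P" using simultaneously_visible_two_face[OF sv] .
  have pF: "polytope F" "dim (direction_space F) = 2"
    using two_faceD[OF F] P face_of_polytope_polytope by blast+
  show ?thesis
  proof (cases "opposite_edges F e = {}")
    case True
    then have G: "G1 = F'" "G1' = F" "G2 = F'" "G2' = F" "opposite_edges F' e1 = {}"
      "direction_space e = direction_space e1" "direction_space e = direction_space e2"
      using xy xz unfolding x y z by auto
    \<comment> \<open>Any edge of \<open>F'\<close> parallel to \<open>e1\<close> is
      \<open>e1\<close> itself, because \<open>e1\<close> has no opposite edge.\<close>
    then have "e1 = e2" using e2 by (auto simp: opposite_edges_def)
    then show ?thesis using G y z by simp
  next
    case False
    then have G: "G1 = F" "G1' = F'" "G2 = F" "G2' = F'" "e1 \<in> opposite_edges F e" "e2 \<in> opposite_edges F e"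
      using xy xz unfolding x y z by auto
    obtain q r where q: "q \<in> direction_space F" "q \<noteq> 0" and r: "r \<in> direction_space F" "r \<notin> span {q}"
      and er: "e \<in> side_edges F q r"
      using edge_direction_coords[OF pF e] .
    have mr: "- r \<in> direction_space F" "- r \<notin> span {q}"
      using uminus_transversal[OF r] by blast+
    have "e1 = e2"
      using G(5,6) side_edges_unique[OF pF q mr] unfolding opposite_edges_eq[OF pF q r er] by blast
    then show ?thesis using G y z by simp
  qed
qed

lemma partner_exists:
  assumes P: "polytope P" "aff_dim P \<ge> 3" "equiprojective P" and ori: "edge_orientation P ori"
    and x: "x \<in> edge_two_faces P"
  obtains y where "y \<in> edge_two_faces P" "partner x y" "compensate ori x y"
proof -
  obtain e F F' where xe: "x = (e, F, F')" by (cases x)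
  have sv: "simultaneously_visible P F F'" and e: "e edge_of F"
    using x by (auto simp: xe edge_two_faces_def)
  have F: "F \<in> two_faces P" using simultaneously_visible_two_face[OF sv] .
  have pF: "polytope F" "dim (direction_space F) = 2"
    using two_faceD[OF F] P face_of_polytope_polytope by blast+
  obtain q r where q: "q \<in> direction_space F" "q \<noteq> 0" and r: "r \<in> direction_space F" "r \<notin> span {q}"
    and er: "e \<in> side_edges F q r"
    using edge_direction_coords[OF pF e] .
  have mr: "- r \<in> direction_space F" "- r \<notin> span {q}"
    using uminus_transversal[OF r] by blast+
  have opp: "opposite_edges F e = side_edges F q (- r)" by (rule opposite_edges_eq[OF pF q r er])
  have s1: "side_edges F q r = {e}" using side_edges_unique[OF pF q r] er by blast
  have pair: "\<exists>b n. inj b \<and> independent (range b) \<and>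
      counterclockwise b (P \<inter> affine hull (F \<union> F')) F (\<lambda>e. ori (e, F, F')) \<and>
      counterclockwise b (P \<inter> affine hull (F \<union> F')) F' (\<lambda>e. ori (e, F', F)) \<and>
      outward_normal (P \<inter> affine hull (F \<union> F')) F n \<and>
      outward_normal (P \<inter> affine hull (F \<union> F')) F' (- n)" if ne: "F' \<noteq> {}"
  proof -
    obtain n where "outward_normal (P \<inter> affine hull (F \<union> F')) F n"
      "outward_normal (P \<inter> affine hull (F \<union> F')) F' (- n)"
      using outward_normals_pair[OF P(1,2) sv ne] .
    moreover obtain b where "ordered_basis b (direction_space (affine hull (F \<union> F')))"
      "counterclockwise b (P \<inter> affine hull (F \<union> F')) F (\<lambda>e. ori (e, F, F'))"
      "counterclockwise b (P \<inter> affine hull (F \<union> F')) F' (\<lambda>e. ori (e, F', F))"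
      using ori sv ne unfolding edge_orientation_def Let_def by blast
    ultimately show ?thesis unfolding ordered_basis_def by blast
  qed
  show thesis
  proof (cases "side_edges F q (- r) = {}")
    case False
    then obtain e' where e': "e' \<in> side_edges F q (- r)" by blast
    then have eo: "e' \<in> opposite_edges F e" using opp by simp
    then have e'F: "e' edge_of F" "e' \<noteq> e" "e \<in> opposite_edges F e'"
      using e by (auto simp: opposite_edges_def)
    have "parallel_opposite (ori (e, F, F')) (ori (e', F, F'))"
    proof (cases "F' = {}")
      case True
      then have "cyclic_orientation F (\<lambda>e. ori (e, F, F'))"
        using ori sv unfolding edge_orientation_def by blast
      then show ?thesis using cyclic_orientation_opposite[OF pF _ er e'] by blast
    next
      case nonempty: False
      obtain b n where b: "inj b" "independent (range b)" and
        cc: "counterclockwise b (P \<inter> affine hull (F \<union> F')) F (\<lambda>e. ori (e, F, F'))" and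
        n: "outward_normal (P \<inter> affine hull (F \<union> F')) F n"
        using pair[OF nonempty] by blast
      show ?thesis
        using counterclockwise_opposite[OF b cc cc n _ pF(2) pF(2) er, of 1 e' "-1"] n e' by simp
    qed
    then have "compensate ori x (e', F, F')" using e'F(2) by (simp add: xe)
    moreover have "partner x (e', F, F')" using eo e'F(3) by (simp add: xe)
    moreover have "(e', F, F') \<in> edge_two_faces P" using sv e'F(1) by (simp add: edge_two_faces_def)
    ultimately show thesis using that by blast
  next
    case True
    \<comment> \<open>A lone face has equally many edges on both sides, so the lack of an opposite
      edge already demands a second face.\<close>
    have ne: "F' \<noteq> {}"
    proof
      assume "F' = {}"
      then have "card (side_edges F q r) = card (side_edges F q (- r))"
        using edge_balance_single[OF P _ q r] sv by blast
      then show False using True s1 by simp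
    qed
    have sv': "simultaneously_visible P F' F" using simultaneously_visible_sym[OF sv ne] .
    have F': "F' \<in> two_faces P" "direction_space F' = direction_space F" "F \<noteq> F'"
      using sv ne by (auto simp: simultaneously_visible_def parallel_rel_def)
    have pF': "polytope F'" "dim (direction_space F') = 2"
      using two_faceD[OF F'(1)] P face_of_polytope_polytope by blast+
    have q': "q \<in> direction_space F'" and r': "r \<in> direction_space F'" using q r F'(2) by auto
    \<comment> \<open>One edge of \<open>F\<close> on the side of \<open>r\<close> and none
      opposite: as the counts for \<open>F'\<close> are 0 or 1, they must be 1 on the side of
      \<open>r\<close> and 0 opposite.\<close>
    have bal: "1 + card (side_edges F' q (- r)) = card (side_edges F' q r)"
      using edge_balance_pair[OF P sv ne q r] True s1 by simp
    then have "side_edges F' q r \<noteq> {}" by auto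
    then obtain e' where e': "e' \<in> side_edges F' q r" by blast
    then have "side_edges F' q r = {e'}" using side_edges_unique[OF pF' q' q(2) r' r(2)] by blast
    then have "card (side_edges F' q (- r)) = 0" using bal by simp
    moreover have "finite (side_edges F' q (- r))"
      using finite_edges[OF pF'(1)] by (rule finite_subset[rotated]) (auto simp: side_edges_def)
    ultimately have "side_edges F' q (- r) = {}" by simp
    then have opp': "opposite_edges F' e' = {}"
      using opposite_edges_eq[OF pF' q' q(2) r' r(2) e'] by simp
    have e'F: "e' edge_of F'" "direction_space e' = span {q}" using e' by (auto simp: side_edges_def)
    obtain b n where b: "inj b" "independent (range b)" and
      cc: "counterclockwise b (P \<inter> affine hull (F \<union> F')) F (\<lambda>e. ori (e, F, F'))"
        "counterclockwise b (P \<inter> affine hull (F \<union> F')) F' (\<lambda>e. ori (e, F', F))" and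
      n: "outward_normal (P \<inter> affine hull (F \<union> F')) F n"
        "outward_normal (P \<inter> affine hull (F \<union> F')) F' (- n)"
      using pair[OF ne] by blast
    have "parallel_opposite (ori (e, F, F')) (ori (e', F', F))"
      using counterclockwise_opposite[OF b cc n(1) _ pF(2) pF'(2) er, of "-1" e' 1] n(2) e' by simp
    then have "compensate ori x (e', F', F)" using F'(3) by (simp add: xe)
    moreover have "direction_space e = span {q}" using er by (simp add: side_edges_def)
    then have "partner x (e', F', F)" using True opp opp' e'F(2) F'(3) by (simp add: xe)
    moreover have "(e', F', F) \<in> edge_two_faces P" using sv' e'F(1) by (simp add: edge_two_faces_def)
    ultimately show thesis using that by blast
  qed
qed

theorem theorem5:
  fixes P :: "(real ^ 'n) set"
    and ori :: "(real ^ 'n) set \<times> (real ^ 'n) set \<times> (real ^ 'n) set \<Rightarrow> (real ^ 'n) \<times> (real ^ 'n)"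
  assumes "CARD('n) \<ge> 3"
    and "polytope P"
    and "aff_dim P = int CARD('n)"
    and "equiprojective P"
    and "edge_orientation P ori"
  shows "\<exists>\<C>. partition_on (edge_two_faces P) \<C> \<and>
             (\<forall>X\<in>\<C>. \<exists>x y. X = {x, y} \<and> compensate ori x y)"
proof -
  have "aff_dim P \<ge> 3" using assms(1,3) by simp
  note ex = partner_exists[OF assms(2) this assms(4,5)]
  let ?C = "{{x, y} | x y. x \<in> edge_two_faces P \<and> y \<in> edge_two_faces P \<and> partner x y}"
  have "partition_on (edge_two_faces P) ?C"
  proof (rule partition_into_pairs)
    show "\<exists>y\<in>edge_two_faces P. partner x y" if "x \<in> edge_two_faces P" for x
      by (rule ex[OF that]) blast
  qed (use partner_sym partner_unique[OF assms(2)] in blast)+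
  moreover have "\<exists>x y. X = {x, y} \<and> compensate ori x y" if XC: "X \<in> ?C" for X
  proof -
    obtain x y where X: "X = {x, y}" "x \<in> edge_two_faces P" "y \<in> edge_two_faces P" "partner x y"
      using XC by blast
    obtain z where z: "z \<in> edge_two_faces P" "partner x z" "compensate ori x z" using ex[OF X(2)] .
    \<comment> \<open>Existence delivers some compensating partner of \<open>x\<close>; uniqueness
      identifies it with the one in the block, so partners always compensate.\<close>
    have "z = y" by (rule partner_unique[OF assms(2) X(2) z(1) X(3) z(2) X(4)])
    then show ?thesis using X(1) z(3) by blast
  qed
  ultimately show ?thesis by blast
qed

end
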